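(* Let $n\ge 2$, let $\pi$ be the standard multiplicative Poisson structure on $SU(n)$, and let $U(n-1)\subset SU(n)$ denote the closed subgroup $\{\det(u)^{-1}\oplus u : u \text{ an } (n-1)\times(n-1)\text{ unitary matrix}\}$. For $c\in[0,1]$ put $$\sigma_c:=\left(\sqrt{c}\,e_{11}+\sqrt{1-c}\,e_{n1}-\sqrt{1-c}\,e_{1n}+\sqrt{c}\,e_{nn}\right)+\sum_{i=2}^{n-1}e_{ii}\in SU(n).$$ Then $U(n-1)$ is coisotropic with respect to the left $SU(n)$-covariant affine Poisson structure $\pi_{\sigma_c}$ on $SU(n)$. Hence $\pi_{\sigma_c}$ induces a left $SU(n)$-covariant Poisson structure $\tau_c$ on $\mathbb{C}P^{n-1}\cong SU(n)/U(n-1)$, given by $\tau_c([u\,U(n-1)])=(D\phi)_u(\pi_{\sigma_c}(u))$ for $u\in SU(n)$, where $\phi:SU(n)\to SU(n)/U(n-1)$ is the quotient map.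
   Context: Let $e_{ij}$ be the $n\times n$ matrix units. A Poisson structure on a manifold $M$ is identified with its Poisson 2-tensor (bivector field) in $\Gamma(\wedge^2TM)$. For a Lie group $G$ with Lie algebra $\mathfrak g$, $L_g$ and $R_g$ denote left and right translation by $g$ and also the maps they induce on tangent vectors and 2-tensors. Standard Poisson $SU(n)$: for $1\le i<j\le n$ let $X_{ij}^+=e_{ij}-e_{ji}$ and $X_{ij}^-=\sqrt{-1}\,(e_{ij}+e_{ji})$, elements of $\mathfrak{su}(n)$, and let $r=\sum_{1\le i<j\le n}X_{ij}^+\wedge X_{ij}^-\in\mathfrak{su}(n)\wedge\mathfrak{su}(n)$. The standard multiplicative Poisson structure on $SU(n)$ is $\pi(u)=L_u r-R_u r$. For $\sigma\in G$ and a multiplicative Poisson 2-tensor $\pi$ on $G$, $\pi_\sigma$ denotes the push-forward of $\pi$ by right translation by $\sigma$: $\pi_\sigma(g)=R_\sigma(\pi(g\sigma^{-1}))$. It is an affine Poisson structure on $G$ and is left $(G,\pi)$-covariant. A Poisson structure $\tau$ on a left homogeneous space $M$ of $G$ is left $(G,\pi)$-covariant (here $G=SU(n)$ with its standard $\pi$) if the action map $G\times M\to M$ is a Poisson map, where $G\times M$ carries the product Poisson structure $\pi\times\tau$. A closed subgroup $H\subset G$ with Lie algebra $\mathfrak h$ is called coisotropic with respect to a Poisson structure $\rho$ on $G$ if $\rho(gh)-R_h(\rho(g))\in L_{gh}(\mathfrak h\wedge\mathfrak g)$ for all $g\in G$, $h\in H$, where $\mathfrak h\wedge\mathfrak g\subset\wedge^2\mathfrak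 g$ is the span of all $x\wedge y$ with $x\in\mathfrak h$, $y\in\mathfrak g$. *)

theory Defs
  imports "HOL-Analysis.Analysis"
begin

section \<open>Two-tensors on real vector spaces\<close>

text \<open>
  For finite-dimensional \<open>V\<close>, elements of \<open>V \<otimes> V\<close> are identified with bilinear forms on the dual
  of \<open>V\<close>; the wedge is \<open>v \<otimes> w - w \<otimes> v\<close>. A factor \<open>1/2\<close> in the wedge would rescale all 2-tensors
  below by the same constant, which changes none of the notions defined here.
\<close>

type_synonym 'a two_tensor = "('a \<Rightarrow>\<^sub>L real) \<Rightarrow>\<^sub>L ('a \<Rightarrow>\<^sub>L real) \<Rightarrow>\<^sub>L real"

definition wedge :: "'a::real_normed_vector \<Rightarrow> 'a \<Rightarrow> 'a two_tensor" where
  "wedge v w = Blinfun (\<lambda>\<alpha>::'a \<Rightarrow>\<^sub>L real. Blinfun (\<lambda>\<beta>::'a \<Rightarrow>\<^sub>L real. \<alpha> v * \<beta> w - \<alpha> w * \<beta> v))"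

text \<open>The map on 2-tensors induced by a bounded linear map \<open>A\<close>.\<close>

definition push :: "('a::real_normed_vector \<Rightarrow> 'b::real_normed_vector) \<Rightarrow> 'a two_tensor \<Rightarrow> 'b two_tensor"
  where "push A P = Blinfun (\<lambda>\<alpha>::'b \<Rightarrow>\<^sub>L real. Blinfun (\<lambda>\<beta>::'b \<Rightarrow>\<^sub>L real. P (\<alpha> o\<^sub>L Blinfun A) (\<beta> o\<^sub>L Blinfun A)))"

lemma Blinfun_Blinfun_apply:
  assumes F: "bounded_bilinear F"
  shows "blinfun_apply (blinfun_apply (Blinfun (\<lambda>a. Blinfun (F a))) a) b = F a b"
proof -
  interpret bounded_bilinear F by (rule F)
  have Fa: "Blinfun (F a) = prod_right a" for a
    by (rule blinfun_eqI) (simp add: bounded_linear_Blinfun_apply bounded_linear_right)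
  have "bounded_linear (\<lambda>a. Blinfun (F a))"
    unfolding Fa by (rule bounded_linear_prod_right)
  then show ?thesis
    by (simp add: bounded_linear_Blinfun_apply bounded_linear_right)
qed

lemma wedge_apply:
  fixes \<alpha> \<beta> :: "'a::real_normed_vector \<Rightarrow>\<^sub>L real"
  shows "wedge v w \<alpha> \<beta> = \<alpha> v * \<beta> w - \<alpha> w * \<beta> v"
proof -
  define F where "F = (\<lambda>(\<alpha>::'a \<Rightarrow>\<^sub>L real) (\<beta>::'a \<Rightarrow>\<^sub>L real). \<alpha> v * \<beta> w - \<alpha> w * \<beta> v)"
  have "bounded_bilinear F"
  proof
    show "\<exists>K. \<forall>a b. norm (F a b) \<le> norm a * norm b * K"
    proof (rule exI[of _ "2 * norm v * norm w"], intro allI)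
      fix a b :: "'a \<Rightarrow>\<^sub>L real"
      have 1: "\<bar>a v * b w\<bar> \<le> (norm a * norm v) * (norm b * norm w)"
        unfolding abs_mult using norm_blinfun[of a v] norm_blinfun[of b w]
        by (intro mult_mono) auto
      have 2: "\<bar>a w * b v\<bar> \<le> (norm a * norm w) * (norm b * norm v)"
        unfolding abs_mult using norm_blinfun[of a w] norm_blinfun[of b v]
        by (intro mult_mono) auto
      have "norm (F a b) \<le> \<bar>a v * b w\<bar> + \<bar>a w * b v\<bar>"
        unfolding F_def real_norm_def by (rule abs_triangle_ineq4)
      also have "\<dots> \<le> norm a * norm b * (2 * norm v * norm w)"
        using 1 2 by (simp add: algebra_simps)
      finally show "norm (F a b) \<le> norm a * norm b * (2 * norm v * norm w)" .
    qed
  qed (simp_all add: F_def blinfun.bilinear_simps algebra_simps)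
  from Blinfun_Blinfun_apply[OF this, of \<alpha> \<beta>] show ?thesis
    by (simp add: wedge_def F_def)
qed

lemma push_apply:
  fixes P :: "'a::real_normed_vector two_tensor" and A :: "'a \<Rightarrow> 'b::real_normed_vector"
  shows "push A P \<alpha> \<beta> = P (\<alpha> o\<^sub>L Blinfun A) (\<beta> o\<^sub>L Blinfun A)"
proof -
  have lin: "bounded_linear (\<lambda>\<alpha>::'b \<Rightarrow>\<^sub>L real. \<alpha> o\<^sub>L Blinfun A)"
    by (rule bounded_bilinear.bounded_linear_left[OF bounded_bilinear_blinfun_compose])
  have "bounded_bilinear (\<lambda>\<alpha>. blinfun_apply (blinfun_apply P \<alpha>))"
    by (rule bounded_bilinear.comp1[OF bounded_bilinear_blinfun_apply blinfun.bounded_linear_right])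
  then have "bounded_bilinear (\<lambda>(\<alpha>::'b \<Rightarrow>\<^sub>L real) (\<beta>::'b \<Rightarrow>\<^sub>L real).
      blinfun_apply (blinfun_apply P (\<alpha> o\<^sub>L Blinfun A)) (\<beta> o\<^sub>L Blinfun A))"
    by (rule bounded_bilinear.comp[OF _ lin lin])
  from Blinfun_Blinfun_apply[OF this, of \<alpha> \<beta>] show ?thesis
    by (simp add: push_def)
qed

lemma push_wedge: "bounded_linear A \<Longrightarrow> push A (wedge v w) = wedge (A v) (A w)"
  by (intro blinfun_eqI) (simp add: push_apply wedge_apply bounded_linear_Blinfun_apply)

section \<open>Smooth functions\<close>

primrec Ck_on :: "nat \<Rightarrow> 'a::real_normed_vector set \<Rightarrow> ('a \<Rightarrow> real) \<Rightarrow> bool" where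
  "Ck_on 0 U f \<longleftrightarrow> continuous_on U f"
| "Ck_on (Suc k) U f \<longleftrightarrow> (\<forall>x\<in>U. f differentiable (at x)) \<and>
     (\<forall>v. Ck_on k U (\<lambda>x. frechet_derivative f (at x) v))"

text \<open>Smooth functions on an embedded submanifold \<open>S\<close> of a finite-dimensional space.\<close>

definition smooth_fun :: "'a::real_normed_vector set \<Rightarrow> ('a \<Rightarrow> real) \<Rightarrow> bool" where
  "smooth_fun S f \<longleftrightarrow> (\<forall>p\<in>S. \<exists>U g. open U \<and> p \<in> U \<and> (\<forall>k. Ck_on k U g) \<and> (\<forall>x\<in>U \<inter> S. g x = f x))"

text \<open>
  If \<open>S\<close> is an embedded submanifold and \<open>q : S \<rightarrow> M\<close> is a surjective submersion, a function on the
  manifold \<open>M = q ` S\<close> is smooth iff its pull-back to \<open>S\<close> is. The values off \<open>M\<close> are irrelevant.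
\<close>

definition smooth_funs :: "'a::real_normed_vector set \<Rightarrow> ('a \<Rightarrow> 'p) \<Rightarrow> ('p \<Rightarrow> real) set" where
  "smooth_funs S q = {f. smooth_fun S (f \<circ> q)}"

section \<open>Poisson structures on manifolds\<close>

text \<open>
  Below, \<open>M\<close> is the underlying set of a manifold and \<open>C\<close> its algebra of smooth functions. Tangent
  vectors are point derivations of \<open>C\<close>, and an element of the second exterior power of the tangent
  space is given by its values on pairs of differentials of functions in \<open>C\<close>.
\<close>

type_synonym 'p tensor_action = "('p \<Rightarrow> real) \<Rightarrow> ('p \<Rightarrow> real) \<Rightarrow> real"

definition tangent_vector :: "('p \<Rightarrow> real) set \<Rightarrow> 'p \<Rightarrow> (('p \<Rightarrow> real) \<Rightarrow> real) \<Rightarrow> bool" where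
  "tangent_vector C p v \<longleftrightarrow>
     (\<forall>f\<in>C. \<forall>g\<in>C. v (\<lambda>x. f x + g x) = v f + v g) \<and>
     (\<forall>a. \<forall>f\<in>C. v (\<lambda>x. a * f x) = a * v f) \<and>
     (\<forall>f\<in>C. \<forall>g\<in>C. v (\<lambda>x. f x * g x) = v f * g p + f p * v g)"

definition bivector_at :: "('p \<Rightarrow> real) set \<Rightarrow> 'p \<Rightarrow> 'p tensor_action \<Rightarrow> bool" where
  "bivector_at C p P \<longleftrightarrow>
     (\<exists>(m::nat) v w. (\<forall>i<m. tangent_vector C p (v i) \<and> tangent_vector C p (w i)) \<and>
        (\<forall>f\<in>C. \<forall>g\<in>C. P f g = (\<Sum>i<m. v i f * w i g - w i f * v i g)))"

text \<open>
  A field \<open>\<tau>\<close> of bivectors is smooth iff \<open>p \<mapsto> \<tau> p f g\<close> is smooth for all smooth \<open>f\<close> and \<open>g\<close>;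
  the last condition is the Jacobi identity for the bracket \<open>{f, g} = (\<lambda>p. \<tau> p f g)\<close>.
\<close>

definition poisson_structure ::
  "'p set \<Rightarrow> ('p \<Rightarrow> real) set \<Rightarrow> ('p \<Rightarrow> 'p tensor_action) \<Rightarrow> bool" where
  "poisson_structure M C \<tau> \<longleftrightarrow>
     (\<forall>p\<in>M. bivector_at C p (\<tau> p)) \<and>
     (\<forall>f\<in>C. \<forall>g\<in>C. (\<lambda>p. \<tau> p f g) \<in> C) \<and>
     (\<forall>f\<in>C. \<forall>g\<in>C. \<forall>h\<in>C. \<forall>p\<in>M.
        \<tau> p f (\<lambda>q. \<tau> q g h) + \<tau> p g (\<lambda>q. \<tau> q h f) + \<tau> p h (\<lambda>q. \<tau> q f g) = 0)"

definition poisson_map ::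
  "'p set \<Rightarrow> ('p \<Rightarrow> real) set \<Rightarrow> ('p \<Rightarrow> 'p tensor_action) \<Rightarrow>
   ('r \<Rightarrow> real) set \<Rightarrow> ('r \<Rightarrow> 'r tensor_action) \<Rightarrow> ('p \<Rightarrow> 'r) \<Rightarrow> bool" where
  "poisson_map M C \<tau> C' \<tau>' F \<longleftrightarrow>
     (\<forall>f\<in>C'. f \<circ> F \<in> C) \<and>
     (\<forall>f\<in>C'. \<forall>g\<in>C'. \<forall>p\<in>M. \<tau> p (f \<circ> F) (g \<circ> F) = \<tau>' (F p) f g)"

text \<open>
  The product \<open>\<pi> \<times> \<tau>\<close>: at \<open>(g, p)\<close> it is the sum of the push-forwards of \<open>\<pi> g\<close> and \<open>\<tau> p\<close> along
  the inclusions \<open>x \<mapsto> (x, p)\<close> and \<open>y \<mapsto> (g, y)\<close>.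
\<close>

definition product_tensor ::
  "('p \<Rightarrow> 'p tensor_action) \<Rightarrow> ('r \<Rightarrow> 'r tensor_action) \<Rightarrow> 'p \<times> 'r \<Rightarrow> ('p \<times> 'r) tensor_action" where
  "product_tensor \<pi> \<tau> = (\<lambda>(g, p) f k.
     \<pi> g (\<lambda>x. f (x, p)) (\<lambda>x. k (x, p)) + \<tau> p (\<lambda>y. f (g, y)) (\<lambda>y. k (g, y)))"

text \<open>
  The derivative at \<open>p\<close> of a function on \<open>S\<close>, as a covector of the ambient space. Its restriction to
  the tangent space of \<open>S\<close> at \<open>p\<close> is uniquely determined; its values on other vectors are an
  arbitrary choice and are never seen by 2-tensors that are tangent to \<open>S\<close>.
\<close>

definition differential :: "'a::real_normed_vector set \<Rightarrow> 'a \<Rightarrow> ('a \<Rightarrow> real) \<Rightarrow> 'a \<Rightarrow>\<^sub>L real" where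
  "differential S p f = Blinfun (frechet_derivative f (at p within S))"

text \<open>
  The image under \<open>D q\<close> at \<open>u\<close> of a tangent 2-tensor \<open>P\<close> of \<open>S\<close> at \<open>u\<close>; with \<open>q = id\<close> it is \<open>P\<close>
  itself, acting on functions.
\<close>

definition push_action ::
  "'a::real_normed_vector set \<Rightarrow> ('a \<Rightarrow> 'p) \<Rightarrow> 'a \<Rightarrow> 'a two_tensor \<Rightarrow> 'p tensor_action" where
  "push_action S q u P f g = P (differential S u (f \<circ> q)) (differential S u (g \<circ> q))"

section \<open>The group \<open>SU(n)\<close> and its standard Poisson structure\<close>

text \<open>
  Rows and columns are indexed by a finite linearly ordered type \<open>'n\<close> with \<open>n\<close> elements; its least
  and greatest elements play the roles of the indices \<open>1\<close> and \<open>n\<close>.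
\<close>

type_synonym 'n cmat = "complex ^ 'n ^ 'n"

definition ix1 :: "'n::{finite,linorder}" where "ix1 = Min UNIV"
definition ixn :: "'n::{finite,linorder}" where "ixn = Max UNIV"

definition mat_unit :: "'n::finite \<Rightarrow> 'n \<Rightarrow> 'n cmat" where
  "mat_unit i j = axis i (axis j 1)"

definition unitary :: "'n::finite cmat \<Rightarrow> bool" where
  "unitary u \<longleftrightarrow> (\<chi> i j. cnj (u $ j $ i)) ** u = mat 1"

definition SU :: "'n::finite cmat set" where
  "SU = {u. unitary u \<and> det u = 1}"

definition closed_subgroup :: "'n::finite cmat set \<Rightarrow> 'n cmat set \<Rightarrow> bool" where
  "closed_subgroup H G \<longleftrightarrow> H \<subseteq> G \<and> closedin (top_of_set G) H \<and> mat 1 \<in> H \<and>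
     (\<forall>g\<in>H. \<forall>h\<in>H. g ** h \<in> H) \<and> (\<forall>h\<in>H. matrix_inv h \<in> H)"

text \<open>Initial velocities of one-parameter subgroups.\<close>

definition lie_algebra :: "'n::finite cmat set \<Rightarrow> 'n cmat set" where
  "lie_algebra H = {X. \<exists>\<gamma>. (\<forall>t. \<gamma> t \<in> H) \<and> (\<forall>s t. \<gamma> (s + t) = \<gamma> s ** \<gamma> t) \<and>
     (\<gamma> has_vector_derivative X) (at (0::real))}"

definition ltrans :: "'n::finite cmat \<Rightarrow> 'n cmat two_tensor \<Rightarrow> 'n cmat two_tensor" where
  "ltrans g = push (\<lambda>X. g ** X)"

definition rtrans :: "'n::finite cmat \<Rightarrow> 'n cmat two_tensor \<Rightarrow> 'n cmat two_tensor" where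
  "rtrans g = push (\<lambda>X. X ** g)"

definition Xplus :: "'n::finite \<Rightarrow> 'n \<Rightarrow> 'n cmat" where
  "Xplus i j = mat_unit i j - mat_unit j i"

definition Xminus :: "'n::finite \<Rightarrow> 'n \<Rightarrow> 'n cmat" where
  "Xminus i j = mat \<i> ** (mat_unit i j + mat_unit j i)"

definition r_tensor :: "'n::{finite,linorder} cmat two_tensor" where
  "r_tensor = (\<Sum>(i, j) | i < j. wedge (Xplus i j) (Xminus i j))"

definition std_poisson :: "'n::{finite,linorder} cmat \<Rightarrow> 'n cmat two_tensor" where
  "std_poisson u = ltrans u r_tensor - rtrans u r_tensor"

definition right_translate ::
  "'n::finite cmat \<Rightarrow> ('n cmat \<Rightarrow> 'n cmat two_tensor) \<Rightarrow> 'n cmat \<Rightarrow> 'n cmat two_tensor" where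
  "right_translate \<sigma> \<pi> g = rtrans \<sigma> (\<pi> (g ** matrix_inv \<sigma>))"

abbreviation on_SU :: "('n::finite cmat \<Rightarrow> 'n cmat two_tensor) \<Rightarrow> 'n cmat \<Rightarrow> 'n cmat tensor_action" where
  "on_SU \<rho> \<equiv> \<lambda>g. push_action SU id g (\<rho> g)"

text \<open>
  Affine 2-tensors on \<open>SU(n)\<close>: equivalently, \<open>g \<mapsto> \<rho> g - ltrans g (\<rho> 1)\<close> is multiplicative.
\<close>

definition affine_tensor :: "('n::finite cmat \<Rightarrow> 'n cmat two_tensor) \<Rightarrow> bool" where
  "affine_tensor \<rho> \<longleftrightarrow>
     (\<forall>g\<in>SU. \<forall>h\<in>SU. \<rho> (g ** h) = ltrans g (\<rho> h) + rtrans h (\<rho> g) - ltrans g (rtrans h (\<rho> (mat 1))))"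

definition coisotropic :: "'n::finite cmat set \<Rightarrow> ('n cmat \<Rightarrow> 'n cmat two_tensor) \<Rightarrow> bool" where
  "coisotropic H \<rho> \<longleftrightarrow> closed_subgroup H SU \<and>
     (\<forall>g\<in>SU. \<forall>h\<in>H. \<rho> (g ** h) - rtrans h (\<rho> g)
        \<in> ltrans (g ** h) ` span {wedge x y | x y. x \<in> lie_algebra H \<and> y \<in> lie_algebra SU})"

text \<open>
  Covariance of a tensor \<open>\<tau>\<close> on \<open>M = q ` SU\<close>, where \<open>q : SU \<rightarrow> M\<close> is a surjective submersion and
  \<open>act\<close> an action of \<open>SU\<close> on \<open>M\<close>.
\<close>

definition left_covariant ::
  "('n::{finite,linorder} cmat \<Rightarrow> 'p) \<Rightarrow> ('n cmat \<Rightarrow> 'p \<Rightarrow> 'p) \<Rightarrow> ('p \<Rightarrow> 'p tensor_action) \<Rightarrow> bool" where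
  "left_covariant q act \<tau> \<longleftrightarrow>
     poisson_map (SU \<times> q ` SU) (smooth_funs (SU \<times> SU) (map_prod id q))
       (product_tensor (on_SU std_poisson) \<tau>)
       (smooth_funs SU q) \<tau> (\<lambda>(g, p). act g p)"

section \<open>The homogeneous space \<open>SU(n) / U(n - 1)\<close>\<close>

text \<open>
  An \<open>(n - 1) \<times> (n - 1)\<close> matrix \<open>u\<close> is represented by the \<open>n \<times> n\<close> matrix \<open>1 \<oplus> u\<close>, which is unitary
  iff \<open>u\<close> is and has the same determinant. The left coset of \<open>v\<close> modulo this subgroup corresponds
  to the complex line spanned by the first column of \<open>v\<close>.
\<close>

definition U_sub :: "'n::{finite,linorder} cmat set" where
  "U_sub = {(\<chi> i j. if i = ix1 \<and> j = ix1 then inverse (det u) else u $ i $ j) | u.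
     unitary u \<and> u $ ix1 $ ix1 = 1 \<and> (\<forall>j. j \<noteq> ix1 \<longrightarrow> u $ ix1 $ j = 0 \<and> u $ j $ ix1 = 0)}"

definition coset :: "'n::{finite,linorder} cmat \<Rightarrow> 'n cmat set" where
  "coset u = (\<lambda>h. u ** h) ` U_sub"

definition coset_act :: "'n::finite cmat \<Rightarrow> 'n cmat set \<Rightarrow> 'n cmat set" where
  "coset_act g K = (\<lambda>u. g ** u) ` K"

definition sigma :: "real \<Rightarrow> 'n::{finite,linorder} cmat" where
  "sigma c = sqrt c *\<^sub>R mat_unit ix1 ix1 + sqrt (1 - c) *\<^sub>R mat_unit ixn ix1 - sqrt (1 - c) *\<^sub>R mat_unit ix1 ixn
     + sqrt c *\<^sub>R mat_unit ixn ixn + (\<Sum>i\<in>{ix1<..<ixn}. mat_unit i i)"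

end

theory Submission
  imports Defs
begin

text \<open>
  Write \<open>\<rho>(g) = L\<^sub>g r' - R\<^sub>g r\<close> with \<open>r' = Ad\<^sub>\<sigma>\<^sup>-\<^sup>1 r\<close>. In the Jacobi identity for \<open>\<rho>\<close> the second derivatives
  cancel by symmetry and the mixed left-right terms cancel because left and right invariant vector
  fields commute; what remains is the difference of the left translate of \<open>[r', r']\<close> and the right
  translate of \<open>[r, r]\<close>. Since \<open>r\<close> solves the modified Yang--Baxter equation, \<open>[r, r]\<close> is a multiple of
  the invariant trivector \<open>tr(\<xi>[\<eta>, \<zeta>])\<close>, so the two agree.

  For coisotropy, \<open>\<rho>(gh) - R\<^sub>h \<rho>(g) = L\<^sub>g\<^sub>h (r' - Ad\<^sub>h\<^sup>-\<^sup>1 r')\<close>, so the image of \<open>r'\<close> in the second exterior power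
  of \<open>\<gg>/\<hh>\<close> has to be \<open>U(n - 1)\<close>-invariant. Evaluated on covectors \<open>\<xi>\<close>, \<open>\<eta>\<close> annihilating \<open>\<hh>\<close> it is a multiple
  (by \<open>2 c - 1\<close>) of the imaginary part of the corner entry of \<open>[\<xi>, \<eta>]\<close>, which is invariant. Coisotropy
  makes the bracket of two \<open>U(n - 1)\<close>-invariant functions invariant, and all properties descend.
\<close>

section \<open>Calculus of smooth functions\<close>

text \<open>All calculus takes place in the ambient matrix space: functions on \<open>SU\<close>
  extend locally to smooth functions of matrices, and the affine tensor is the restriction of a
  quadratic tensor field. The point to settle is independence of the extension. The covector
  \<open>differential\<close> is an arbitrary choice off the tangent directions; this is harmless
  because the vectors on which its values matter are velocities of curves in \<open>SU\<close>. Such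
  curves come from generators with X^3 = -X, whose exponentials are explicit. Contraction with r
  multiplies the entry (k, l) of a covector by the sign of l - k, up to -2i, so the Yang--Baxter
  equation becomes a statement about the signs of three indices. The matrix \<open>sigma c\<close>
  rotates the plane of the first and last coordinates, the extremes of the index order; this is why
  a single factor cos^2 - sin^2 = 2 c - 1 comes out of the coisotropy computation.\<close>

abbreviation dir_deriv :: "'a::real_normed_vector \<Rightarrow> ('a \<Rightarrow> real) \<Rightarrow> 'a \<Rightarrow> real" where
  "dir_deriv v f \<equiv> \<lambda>x. frechet_derivative f (at x) v"

lemma frechet_derivative_linear:
  assumes "f differentiable (at x)"
  shows "linear (frechet_derivative f (at x))"
  using assms frechet_derivative_works has_derivative_linear by blast

lemma Ck_on_subset: "Ck_on k U f \<Longrightarrow> V \<subseteq> U \<Longrightarrow> Ck_on k V f"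
  by (induction k arbitrary: f) (auto intro: continuous_on_subset)

lemma Ck_on_cong:
  assumes "open U" "\<And>x. x \<in> U \<Longrightarrow> f x = g x" "Ck_on k U f"
  shows "Ck_on k U g"
  using assms(2,3)
proof (induction k arbitrary: f g)
  case 0
  then show ?case by (metis Ck_on.simps(1) continuous_on_cong)
next
  case (Suc k)
  have diff: "g differentiable (at x)" if "x \<in> U" for x
    using Suc.prems that \<open>open U\<close>
    by (metis Ck_on.simps(2) differentiable_def has_derivative_transform_within_open)
  have "Ck_on k U (dir_deriv v g)" for v
  proof (rule Suc.IH)
    show "Ck_on k U (dir_deriv v f)" using Suc.prems by simp
    show "dir_deriv v f x = dir_deriv v g x" if "x \<in> U" for x
      using frechet_derivative_transform_within_open[of f x U g] Suc.prems that \<open>open U\<close> by auto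
  qed
  with diff show ?case by simp
qed

lemma Ck_on_imp_continuous_on: "Ck_on k U f \<Longrightarrow> continuous_on U f"
  by (cases k) (auto intro!: differentiable_imp_continuous_on simp: differentiable_on_def differentiable_at_withinI)

lemma Ck_on_SucD: "Ck_on (Suc k) U f \<Longrightarrow> Ck_on k U f"
proof (induction k arbitrary: f)
  case 0
  then show ?case using Ck_on_imp_continuous_on[of "Suc 0"] by (simp only: Ck_on.simps(1))
next
  case (Suc k)
  then show ?case by (simp only: Ck_on.simps(2)) blast
qed

lemma Ck_on_const: "Ck_on k U (\<lambda>x. c)"
  by (induction k arbitrary: c) (auto simp: frechet_derivative_const)

lemma Ck_on_add:
  assumes "open U" "Ck_on k U f" "Ck_on k U g"
  shows "Ck_on k U (\<lambda>x. f x + g x)"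
  using assms(2,3)
proof (induction k arbitrary: f g)
  case (Suc k)
  have "Ck_on k U (dir_deriv v (\<lambda>x. f x + g x))" for v
  proof (rule Ck_on_cong[OF \<open>open U\<close>])
    show "Ck_on k U (\<lambda>x. dir_deriv v f x + dir_deriv v g x)"
      using Suc by auto
    show "dir_deriv v f x + dir_deriv v g x = dir_deriv v (\<lambda>x. f x + g x) x" if "x \<in> U" for x
    proof -
      have "f differentiable (at x)" "g differentiable (at x)"
        using Suc.prems that by simp_all
      from has_derivative_add[OF this[unfolded frechet_derivative_works]]
      show ?thesis by (rule fun_cong[OF frechet_derivative_at])
    qed
  qed
  with Suc.prems show ?case by simp
qed (auto intro: continuous_intros)

lemma Ck_on_mult:
  assumes "open U" "Ck_on k U f" "Ck_on k U g"
  shows "Ck_on k U (\<lambda>x. f x * g x)"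
  using assms(2,3)
proof (induction k arbitrary: f g)
  case (Suc k)
  have "Ck_on k U (dir_deriv v (\<lambda>x. f x * g x))" for v
  proof (rule Ck_on_cong[OF \<open>open U\<close>])
    show "Ck_on k U (\<lambda>x. f x * dir_deriv v g x + dir_deriv v f x * g x)"
      using Suc.prems Suc.prems[THEN Ck_on_SucD] by (intro Ck_on_add \<open>open U\<close> Suc.IH) auto
    show "f x * dir_deriv v g x + dir_deriv v f x * g x = dir_deriv v (\<lambda>x. f x * g x) x"
      if "x \<in> U" for x
    proof -
      have "f differentiable (at x)" "g differentiable (at x)"
        using Suc.prems that by simp_all
      from has_derivative_mult[OF this[unfolded frechet_derivative_works]]
      show ?thesis by (rule fun_cong[OF frechet_derivative_at])
    qed
  qed
  with Suc.prems show ?case by simp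
qed (auto intro: continuous_intros)

lemma Ck_on_diff:
  assumes "open U" "Ck_on k U f" "Ck_on k U g"
  shows "Ck_on k U (\<lambda>x. f x - g x)"
  using Ck_on_add[OF assms(1,2) Ck_on_mult[OF assms(1) Ck_on_const[of k U "-1"] assms(3)]] by simp

lemma Ck_on_sum:
  assumes "open U" "\<And>i. i \<in> I \<Longrightarrow> Ck_on k U (f i)"
  shows "Ck_on k U (\<lambda>x. \<Sum>i\<in>I. f i x)"
  using assms(2) by (induction I rule: infinite_finite_induct) (auto intro: Ck_on_const Ck_on_add assms(1))

lemma Ck_on_bounded_linear:
  assumes "bounded_linear f"
  shows "Ck_on k U f"
proof (cases k)
  case 0
  then show ?thesis
    using assms by (simp add: linear_continuous_on)
next
  case (Suc j)
  have "frechet_derivative f (at x) = f" for x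
    using assms frechet_derivative_at bounded_linear_imp_has_derivative by metis
  with Suc assms show ?thesis
    by (auto simp: Ck_on_const bounded_linear_imp_differentiable)
qed

text \<open>\<open>Ck_on\<close> speaks of real functions, so the inner map enters through its
  coordinates. The chain rule writes a directional derivative of the composite as a sum of products
  whose factors are one order lower and again covered by the induction.\<close>

lemma Ck_on_compose:
  fixes f :: "'b::euclidean_space \<Rightarrow> real" and m :: "'a::real_normed_vector \<Rightarrow> 'b"
  assumes "open U" "open V" "m ` V \<subseteq> U" "Ck_on k U f"
    and "\<And>b. b \<in> Basis \<Longrightarrow> Ck_on k V (\<lambda>x. m x \<bullet> b)"
  shows "Ck_on k V (\<lambda>x. f (m x))"
  using assms(4,5)
proof (induction k arbitrary: f)
  case 0
  then have "continuous_on V m"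
    by (intro continuous_on_componentwise[THEN iffD2]) auto
  with 0 assms(3) show ?case
    by (auto intro: continuous_on_compose2)
next
  case (Suc k)
  have md: "m differentiable (at x)" if "x \<in> V" for x
    using Suc.prems(2) that by (intro differentiable_componentwise_within[THEN iffD2]) simp
  have mb: "frechet_derivative m (at x) v \<bullet> b = dir_deriv v (\<lambda>x. m x \<bullet> b) x"
    if "x \<in> V" "b \<in> Basis" for x v b
  proof -
    have "((\<lambda>x. m x \<bullet> b) has_derivative (\<lambda>v. frechet_derivative m (at x) v \<bullet> b)) (at x)"
      using md[OF that(1)] frechet_derivative_works that(2) has_derivative_componentwise_within
      by blast
    from frechet_derivative_at[OF this] show ?thesis by metis
  qed
  have chain: "((\<lambda>x. f (m x)) has_derivative
      (\<lambda>v. frechet_derivative f (at (m x)) (frechet_derivative m (at x) v))) (at x)" if "x \<in> V" for x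
    using diff_chain_at[of m _ x f] md[OF that] Suc.prems(1) that assms(3)
    by (force simp: frechet_derivative_works o_def)
  have "Ck_on k V (dir_deriv v (\<lambda>x. f (m x)))" for v
  proof (rule Ck_on_cong[OF \<open>open V\<close>])
    show "Ck_on k V (\<lambda>x. \<Sum>b\<in>Basis. dir_deriv v (\<lambda>x. m x \<bullet> b) x * dir_deriv b f (m x))"
      proof (intro Ck_on_sum Ck_on_mult \<open>open V\<close>)
      fix b :: 'b assume b: "b \<in> Basis"
      show "Ck_on k V (dir_deriv v (\<lambda>x. m x \<bullet> b))"
        using Suc.prems(2)[OF b] by simp
      show "Ck_on k V (\<lambda>x. dir_deriv b f (m x))"
      proof (rule Suc.IH)
        show "Ck_on k U (dir_deriv b f)"
          using Suc.prems(1) by simp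
      qed (rule Ck_on_SucD[OF Suc.prems(2)])
    qed
    show "(\<Sum>b\<in>Basis. dir_deriv v (\<lambda>x. m x \<bullet> b) x * dir_deriv b f (m x))
        = dir_deriv v (\<lambda>x. f (m x)) x" if "x \<in> V" for x
    proof -
      have lin: "linear (frechet_derivative f (at (m x)))"
        using Suc.prems(1) that assms(3) by (auto intro: frechet_derivative_linear)
      have "dir_deriv v (\<lambda>x. f (m x)) x
          = frechet_derivative f (at (m x)) (frechet_derivative m (at x) v)"
        using frechet_derivative_at[OF chain[OF that]] by metis
      also have "\<dots> = frechet_derivative f (at (m x))
          (\<Sum>b\<in>Basis. (frechet_derivative m (at x) v \<bullet> b) *\<^sub>R b)"
        by (simp add: euclidean_representation)
      also have "\<dots> = (\<Sum>b\<in>Basis. (frechet_derivative m (at x) v \<bullet> b) * dir_deriv b f (m x))"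
        by (simp add: linear_sum[OF lin] linear_cmul[OF lin])
      also have "\<dots> = (\<Sum>b\<in>Basis. dir_deriv v (\<lambda>x. m x \<bullet> b) x * dir_deriv b f (m x))"
        using that mb by (intro sum.cong) auto
      finally show ?thesis by simp
    qed
  qed
  moreover have "(\<lambda>x. f (m x)) differentiable (at x)" if "x \<in> V" for x
    using chain[OF that] differentiable_def by blast
  ultimately show ?case by simp
qed

lemma smooth_fun_compose:
  fixes f :: "'b::euclidean_space \<Rightarrow> real" and m :: "'a::real_normed_vector \<Rightarrow> 'b"
  assumes f: "smooth_fun T f" and m: "m ` S \<subseteq> T"
    and "\<And>k b. b \<in> Basis \<Longrightarrow> Ck_on k UNIV (\<lambda>x. m x \<bullet> b)"
  shows "smooth_fun S (\<lambda>x. f (m x))"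
  unfolding smooth_fun_def
proof
  fix p assume "p \<in> S"
  then obtain U g where U: "open U" "m p \<in> U" "\<And>k. Ck_on k U g" "\<And>x. x \<in> U \<inter> T \<Longrightarrow> g x = f x"
    using f m unfolding smooth_fun_def by (metis image_subset_iff)
  have "continuous_on UNIV m"
    using assms(3)[of _ 0] by (intro continuous_on_componentwise[THEN iffD2]) auto
  then have "open (m -` U)"
    using U(1) open_vimage by blast
  moreover have "Ck_on k (m -` U) (\<lambda>x. g (m x))" for k
    by (rule Ck_on_compose[OF U(1) \<open>open (m -` U)\<close> _ U(3)]) (use Ck_on_subset[OF assms(3)] in blast)+
  moreover have "g (m x) = f (m x)" if "x \<in> (m -` U) \<inter> S" for x
    using U(4) m that by auto
  ultimately show "\<exists>U h. open U \<and> p \<in> U \<and> (\<forall>k. Ck_on k U h) \<and> (\<forall>x\<in>U \<inter> S. h x = f (m x))"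
    using U(2) by (intro exI[of _ "m -` U"] exI[of _ "\<lambda>x. g (m x)"]) auto
qed

lemma smooth_fun_cong:
  assumes "smooth_fun S f" "\<And>x. x \<in> S \<Longrightarrow> f x = g x"
  shows "smooth_fun S g"
  using assms unfolding smooth_fun_def by (metis IntE)

text \<open>The mean value theorem in each variable writes the second difference of \<open>f\<close> over a small
  parallelogram as a multiple of either mixed derivative at a nearby point.\<close>

lemma second_difference:
  fixes f :: "'a::real_normed_vector \<Rightarrow> real"
  assumes C: "Ck_on 2 U f" and t: "0 < t"
    and U: "\<And>a b. 0 \<le> a \<Longrightarrow> a \<le> t \<Longrightarrow> 0 \<le> b \<Longrightarrow> b \<le> t \<Longrightarrow> x + a *\<^sub>R u + b *\<^sub>R v \<in> U"
  obtains a b where "0 \<le> a" "a \<le> t" "0 \<le> b" "b \<le> t"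
    "f (x + t *\<^sub>R u + t *\<^sub>R v) - f (x + t *\<^sub>R u) - f (x + t *\<^sub>R v) + f x
      = t * t * dir_deriv v (dir_deriv u f) (x + a *\<^sub>R u + b *\<^sub>R v)"
proof -
  have C: "\<And>y. y \<in> U \<Longrightarrow> f differentiable (at y)"
    "\<And>y. y \<in> U \<Longrightarrow> dir_deriv u f differentiable (at y)"
    using C by (simp_all add: numeral_2_eq_2)
  have line: "((\<lambda>s. g (y + s *\<^sub>R w)) has_real_derivative dir_deriv w g (y + s *\<^sub>R w)) (at s)"
    if "g differentiable (at (y + s *\<^sub>R w))" for g :: "'a \<Rightarrow> real" and y w s
  proof -
    have "((\<lambda>s. y + s *\<^sub>R w) has_derivative (\<lambda>h. h *\<^sub>R w)) (at s)"
      by (auto intro!: derivative_eq_intros)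
    from diff_chain_at[OF this that[unfolded frechet_derivative_works]]
    show ?thesis
      using linear_cmul[OF frechet_derivative_linear[OF that]]
      by (simp add: has_field_derivative_def o_def mult.commute[of _ "dir_deriv w g _"])
  qed
  let ?g = "\<lambda>s. f (x + t *\<^sub>R v + s *\<^sub>R u) - f (x + s *\<^sub>R u)"
  have "\<exists>a. 0 < a \<and> a < t \<and> ?g t - ?g 0 = (t - 0) *
      (dir_deriv u f (x + t *\<^sub>R v + a *\<^sub>R u) - dir_deriv u f (x + a *\<^sub>R u))"
  proof (rule MVT2[OF t])
    fix s assume s: "0 \<le> s" "s \<le> t"
    have "x + t *\<^sub>R v + s *\<^sub>R u \<in> U" "x + s *\<^sub>R u \<in> U"
      using U[OF s, of t] U[OF s, of 0] t by (simp_all add: algebra_simps)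
    then show "(?g has_real_derivative dir_deriv u f (x + t *\<^sub>R v + s *\<^sub>R u)
        - dir_deriv u f (x + s *\<^sub>R u)) (at s)"
      using C by (intro DERIV_diff line) auto
  qed
  then obtain a where a: "0 < a" "a < t" and ga: "?g t - ?g 0 = t *
      (dir_deriv u f (x + t *\<^sub>R v + a *\<^sub>R u) - dir_deriv u f (x + a *\<^sub>R u))"
    by auto
  let ?h = "\<lambda>s. dir_deriv u f (x + a *\<^sub>R u + s *\<^sub>R v)"
  have "\<exists>b. 0 < b \<and> b < t \<and> ?h t - ?h 0 = (t - 0) *
      dir_deriv v (dir_deriv u f) (x + a *\<^sub>R u + b *\<^sub>R v)"
    using a U C by (intro MVT2[OF t] line) auto
  then obtain b where b: "0 < b" "b < t"
      "?h t - ?h 0 = t * dir_deriv v (dir_deriv u f) (x + a *\<^sub>R u + b *\<^sub>R v)"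
    by auto
  have "?g t - ?g 0 = t * (?h t - ?h 0)"
    using ga by (simp add: algebra_simps)
  with a b show ?thesis
    by (intro that[of a b]) (auto simp: algebra_simps)
qed

text \<open>The second difference is symmetric in \<open>u\<close> and \<open>v\<close>, so the two
  mixed derivatives coincide at a pair of points as close to \<open>x\<close> as desired; their
  continuity moves both to \<open>x\<close>.\<close>

lemma dir_deriv_commute:
  fixes f :: "'a::real_normed_vector \<Rightarrow> real"
  assumes C: "Ck_on 2 U f" and "open U" "x \<in> U"
  shows "dir_deriv v (dir_deriv u f) x = dir_deriv u (dir_deriv v f) x"
proof -
  have "dist (dir_deriv v (dir_deriv u f) x) (dir_deriv u (dir_deriv v f) x) \<le> e" if "e > 0" for e
  proof -
    have near: "\<exists>d>0. \<forall>y. dist y x < d \<longrightarrow>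
        dist (dir_deriv w' (dir_deriv w f) y) (dir_deriv w' (dir_deriv w f) x) < e / 2" for w w'
    proof -
      have "continuous (at x) (dir_deriv w' (dir_deriv w f))"
        using C \<open>open U\<close> \<open>x \<in> U\<close> by (simp add: numeral_2_eq_2 continuous_on_eq_continuous_at)
      then show ?thesis
        unfolding continuous_at_eps_delta using half_gt_zero[OF that] by blast
    qed
    obtain d1 where d1: "d1 > 0" "\<And>y. dist y x < d1 \<Longrightarrow>
        dist (dir_deriv v (dir_deriv u f) y) (dir_deriv v (dir_deriv u f) x) < e / 2"
      using near by meson
    obtain d2 where d2: "d2 > 0" "\<And>y. dist y x < d2 \<Longrightarrow>
        dist (dir_deriv u (dir_deriv v f) y) (dir_deriv u (dir_deriv v f) x) < e / 2"
      using near by meson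
    obtain d3 where d3: "d3 > 0" "ball x d3 \<subseteq> U"
      using \<open>open U\<close> \<open>x \<in> U\<close> openE by blast
    define d where "d = min d1 (min d2 d3)"
    \<comment> \<open>This size keeps the parallelogram with sides \<open>t *\<^sub>R u\<close> and
      \<open>t *\<^sub>R v\<close> within distance \<open>d\<close> of \<open>x\<close>; the summand
      1 covers \<open>u = v = 0\<close>.\<close>
    define t where "t = d / (2 * (norm u + norm v + 1))"
    have d: "d > 0" using d1 d2 d3 by (simp add: d_def)
    have pos: "norm u + norm v + 1 > 0"
      by (smt (verit) norm_ge_zero)
    then have t: "t > 0" "t * (norm u + norm v) < d"
    proof -
      show "t > 0" using d pos by (simp add: t_def)
      then have "t * (norm u + norm v) \<le> t * (norm u + norm v + 1)" by simp
      also have "\<dots> = d / 2" using pos by (simp add: t_def field_simps)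
      finally show "t * (norm u + norm v) < d" using d by simp
    qed
    have close: "dist (x + a *\<^sub>R u + b *\<^sub>R v) x < d"
      if "0 \<le> a" "a \<le> t" "0 \<le> b" "b \<le> t" for a b
    proof -
      have "dist (x + a *\<^sub>R u + b *\<^sub>R v) x = norm (a *\<^sub>R u + b *\<^sub>R v)"
        by (simp add: dist_norm algebra_simps)
      also have "\<dots> \<le> a * norm u + b * norm v"
        using that norm_triangle_ineq[of "a *\<^sub>R u" "b *\<^sub>R v"] by simp
      also have "\<dots> \<le> t * norm u + t * norm v"
        using that by (intro add_mono mult_right_mono) auto
      finally show ?thesis using t(2) by (simp add: algebra_simps)
    qed
    have inU: "x + a *\<^sub>R u + b *\<^sub>R v \<in> U" if "0 \<le> a" "a \<le> t" "0 \<le> b" "b \<le> t" for a b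
      using close[OF that] d3 by (auto simp: d_def dist_commute subset_eq)
    have inU': "x + a *\<^sub>R v + b *\<^sub>R u \<in> U" if "0 \<le> a" "a \<le> t" "0 \<le> b" "b \<le> t" for a b
      using inU[OF that(3,4,1,2)] by (simp add: algebra_simps)
    let ?D = "f (x + t *\<^sub>R u + t *\<^sub>R v) - f (x + t *\<^sub>R u) - f (x + t *\<^sub>R v) + f x"
    obtain a b where ab: "0 \<le> a" "a \<le> t" "0 \<le> b" "b \<le> t"
      "?D = t * t * dir_deriv v (dir_deriv u f) (x + a *\<^sub>R u + b *\<^sub>R v)"
      using second_difference[OF C t(1) inU] by blast
    obtain a' b' where ab': "0 \<le> a'" "a' \<le> t" "0 \<le> b'" "b' \<le> t"
      "f (x + t *\<^sub>R v + t *\<^sub>R u) - f (x + t *\<^sub>R v) - f (x + t *\<^sub>R u) + f x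
        = t * t * dir_deriv u (dir_deriv v f) (x + a' *\<^sub>R v + b' *\<^sub>R u)"
      using second_difference[OF C t(1) inU'] by blast
    have "t * t * dir_deriv v (dir_deriv u f) (x + a *\<^sub>R u + b *\<^sub>R v)
        = t * t * dir_deriv u (dir_deriv v f) (x + b' *\<^sub>R u + a' *\<^sub>R v)"
      using ab(5) ab'(5) by (simp add: algebra_simps)
    then have "dir_deriv v (dir_deriv u f) (x + a *\<^sub>R u + b *\<^sub>R v)
        = dir_deriv u (dir_deriv v f) (x + b' *\<^sub>R u + a' *\<^sub>R v)"
      using t(1) by simp
    moreover have "dist (dir_deriv v (dir_deriv u f) (x + a *\<^sub>R u + b *\<^sub>R v))
        (dir_deriv v (dir_deriv u f) x) < e / 2"
      using close[OF ab(1-4)] by (intro d1(2)) (simp add: d_def)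
    moreover have "dist (dir_deriv u (dir_deriv v f) (x + b' *\<^sub>R u + a' *\<^sub>R v))
        (dir_deriv u (dir_deriv v f) x) < e / 2"
      using close[OF ab'(3,4,1,2)] by (intro d2(2)) (simp add: d_def)
    ultimately show ?thesis
      by (metis dist_triangle_half_r less_imp_le)
  qed
  then have "dist (dir_deriv v (dir_deriv u f) x) (dir_deriv u (dir_deriv v f) x) \<le> 0"
    using field_le_epsilon by (metis add_0)
  then show ?thesis by simp
qed

section \<open>Differentials along curves\<close>

text \<open>Velocities of globally defined curves; the linear structure of the tangent spaces is never used.\<close>

definition curve_tangent :: "'a::real_normed_vector set \<Rightarrow> 'a \<Rightarrow> 'a set" where
  "curve_tangent S p =
     {Z. \<exists>c. (\<forall>t. c t \<in> S) \<and> c 0 = p \<and> (c has_vector_derivative Z) (at (0::real))}"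

lemma has_derivative_along_curve:
  assumes f: "(f has_derivative D) (at p within S)"
    and c: "\<And>t. c t \<in> S" "c 0 = p" "(c has_vector_derivative Z) (at (0::real))"
  shows "((\<lambda>t. f (c t)) has_vector_derivative D Z) (at 0)"
proof -
  have "(f has_derivative D) (at (c 0) within range c)"
    using has_derivative_subset[OF f, of "range c"] c(1,2) by blast
  with c(3) have "(f \<circ> c has_derivative D \<circ> (\<lambda>h. h *\<^sub>R Z)) (at 0)"
    unfolding has_vector_derivative_def by (intro diff_chain_within) auto
  moreover have "D (h *\<^sub>R Z) = h *\<^sub>R D Z" for h
    using has_derivative_linear[OF f] linear_cmul by blast
  ultimately show ?thesis
    by (simp add: has_vector_derivative_def o_def)
qed

lemma differential_works:
  assumes "f differentiable (at p within S)"
  shows "(f has_derivative blinfun_apply (differential S p f)) (at p within S)"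
  using assms bounded_linear_Blinfun_apply has_derivative_bounded_linear
  unfolding differential_def frechet_derivative_works by metis

text \<open>Derivatives within \<open>S\<close> need not be unique, but along a curve inside
  \<open>S\<close> each of them computes the velocity of the same real function. Hence the choice
  made in \<open>differential\<close> has no effect on \<open>curve_tangent\<close>.\<close>

lemma differential_eq:
  assumes f: "(f has_derivative D) (at p within S)" and Z: "Z \<in> curve_tangent S p"
  shows "differential S p f Z = D Z"
proof -
  have "f differentiable (at p within S)"
    using f differentiable_def by blast
  then have f': "(f has_derivative blinfun_apply (differential S p f)) (at p within S)"
    by (rule differential_works)
  obtain c where "\<And>t. c t \<in> S" "c 0 = p" "(c has_vector_derivative Z) (at (0::real))"
    using Z unfolding curve_tangent_def by blast
  then show ?thesis
    using has_derivative_along_curve[OF f] has_derivative_along_curve[OF f']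
      vector_derivative_unique_at by metis
qed

text \<open>Functions that agree on \<open>S\<close> have the same set of derivatives within
  \<open>S\<close>, so Hilbert choice selects the same one; the equality therefore holds on all
  vectors, tangent or not.\<close>

lemma differential_cong:
  assumes "p \<in> S" "\<And>x. x \<in> S \<Longrightarrow> f x = g x"
  shows "differential S p f = differential S p g"
proof -
  have "(f has_derivative D) (at p within S) \<longleftrightarrow> (g has_derivative D) (at p within S)" for D
    using assms has_derivative_transform by metis
  then show ?thesis
    unfolding differential_def frechet_derivative_def by simp
qed

lemma smooth_fun_has_derivative:
  assumes "open U" "p \<in> U" "p \<in> S" "\<And>k. Ck_on k U g" "\<And>x. x \<in> U \<inter> S \<Longrightarrow> g x = f x"
  shows "(f has_derivative frechet_derivative g (at p)) (at p within S)"
proof -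
  have "g differentiable (at p)"
    using assms(2) assms(4)[of "Suc 0"] by simp
  then have "(g has_derivative frechet_derivative g (at p)) (at p within S)"
    by (simp add: frechet_derivative_works has_derivative_at_withinI)
  moreover obtain e where "e > 0" "\<And>x. x \<in> S \<Longrightarrow> dist x p < e \<Longrightarrow> g x = f x"
    using assms by (metis IntI openE mem_ball dist_commute subsetD)
  ultimately show ?thesis
    using has_derivative_transform_within assms(3) by blast
qed

lemma smooth_fun_differentiable:
  assumes "smooth_fun S f" "p \<in> S"
  shows "f differentiable (at p within S)"
  using assms smooth_fun_has_derivative unfolding smooth_fun_def differentiable_def by metis

lemmas smooth_fun_differential = differential_works[OF smooth_fun_differentiable]

lemma differential_compose:
  assumes f: "smooth_fun T f" and m: "(m has_derivative m') (at p)" and "m ` S \<subseteq> T"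
    and "p \<in> S" "Z \<in> curve_tangent S p"
  shows "differential S p (\<lambda>x. f (m x)) Z = differential T (m p) f (m' Z)"
proof (rule differential_eq[OF _ assms(5)])
  have "(f has_derivative blinfun_apply (differential T (m p) f)) (at (m p) within m ` S)"
    using smooth_fun_differential[OF f] assms(3,4) has_derivative_subset by blast
  from diff_chain_within[OF has_derivative_at_withinI[OF m] this]
  show "((\<lambda>x. f (m x)) has_derivative (\<lambda>Z. differential T (m p) f (m' Z))) (at p within S)"
    by (simp add: o_def)
qed

lemma differential_eq_0:
  assumes "smooth_fun S f" "\<And>t. c t \<in> S" "c 0 = p" "(c has_vector_derivative Z) (at (0::real))"
    and const: "\<And>t. f (c t) = f p"
  shows "differential S p f Z = 0"
proof -
  have "p \<in> S" using assms(2,3) by metis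
  then have "((\<lambda>t. f (c t)) has_vector_derivative differential S p f Z) (at 0)"
    using has_derivative_along_curve[OF smooth_fun_differential] assms by blast
  moreover have "((\<lambda>t. f (c t)) has_vector_derivative 0) (at 0)"
    by (simp add: const)
  ultimately show ?thesis
    using vector_derivative_unique_at by blast
qed

lemma tangent_vector_differential:
  assumes p: "p \<in> S" and Z: "Z \<in> curve_tangent S p"
  shows "tangent_vector (smooth_funs S q) (q p) (\<lambda>f. differential S p (f \<circ> q) Z)"
proof -
  have D: "(f \<circ> q has_derivative blinfun_apply (differential S p (f \<circ> q))) (at p within S)"
    if "f \<in> smooth_funs S q" for f
    using smooth_fun_differential p that by (auto simp: smooth_funs_def)
  show ?thesis
    unfolding tangent_vector_def
  proof (intro conjI ballI allI)
    fix f g assume fg: "f \<in> smooth_funs S q" "g \<in> smooth_funs S q"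
    show "differential S p ((\<lambda>x. f x + g x) \<circ> q) Z
        = differential S p (f \<circ> q) Z + differential S p (g \<circ> q) Z"
      using differential_eq[OF has_derivative_add[OF fg[THEN D]] Z] by (simp add: o_def)
    show "differential S p ((\<lambda>x. f x * g x) \<circ> q) Z
        = differential S p (f \<circ> q) Z * g (q p) + f (q p) * differential S p (g \<circ> q) Z"
      using differential_eq[OF has_derivative_mult[OF fg[THEN D]] Z] by (simp add: o_def)
  next
    fix a f assume f: "f \<in> smooth_funs S q"
    show "differential S p ((\<lambda>x. a * f x) \<circ> q) Z = a * differential S p (f \<circ> q) Z"
      using differential_eq[OF has_derivative_mult_right[OF D[OF f], of a] Z] by (simp add: o_def)
  qed
qed

lemma bivector_at_sum:
  assumes "finite I" "\<And>i. i \<in> I \<Longrightarrow> tangent_vector C p (v i) \<and> tangent_vector C p (w i)"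
    and "\<And>f g. f \<in> C \<Longrightarrow> g \<in> C \<Longrightarrow> P f g = (\<Sum>i\<in>I. v i f * w i g - w i f * v i g)"
  shows "bivector_at C p P"
proof -
  obtain h where h: "bij_betw h {0..<card I} I"
    using ex_bij_betw_nat_finite[OF assms(1)] by blast
  show ?thesis
    unfolding bivector_at_def
  proof (intro exI conjI allI impI ballI)
    fix i assume "i < card I"
    then have "h i \<in> I" using h bij_betwE by fastforce
    then show "tangent_vector C p ((v \<circ> h) i)" "tangent_vector C p ((w \<circ> h) i)"
      using assms(2) by auto
  next
    fix f g assume "f \<in> C" "g \<in> C"
    then show "P f g = (\<Sum>i<card I. (v \<circ> h) i f * (w \<circ> h) i g - (w \<circ> h) i f * (v \<circ> h) i g)"
      using assms(3) sum.reindex_bij_betw[OF h, of "\<lambda>i. v i f * w i g - w i f * v i g"]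
      by (simp add: atLeast0LessThan)
  qed
qed

section \<open>Special unitary matrices\<close>

lemma bounded_bilinear_matrix_mult:
  "bounded_bilinear ((**) :: 'n::finite cmat \<Rightarrow> 'n cmat \<Rightarrow> 'n cmat)"
  by (subst bilinear_conv_bounded_bilinear[symmetric])
    (simp add: bilinear_def linear_iff matrix_matrix_mult_def vec_eq_iff algebra_simps
      sum.distrib scaleR_sum_right)

interpretation mm: bounded_bilinear "(**) :: 'n::finite cmat \<Rightarrow> 'n cmat \<Rightarrow> 'n cmat"
  by (rule bounded_bilinear_matrix_mult)

definition adjoint_mat :: "'n::finite cmat \<Rightarrow> 'n cmat" ("_\<^sup>\<dagger>" [1000] 1000) where
  "u\<^sup>\<dagger> = (\<chi> i j. cnj (u $ j $ i))"

lemma adjoint_nth [simp]: "u\<^sup>\<dagger> $ i $ j = cnj (u $ j $ i)"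
  by (simp add: adjoint_mat_def)

lemma adjoint_adjoint [simp]: "u\<^sup>\<dagger>\<^sup>\<dagger> = u"
  by (simp add: vec_eq_iff)

lemma adjoint_mult: "(u ** v)\<^sup>\<dagger> = v\<^sup>\<dagger> ** u\<^sup>\<dagger>"
  by (simp add: vec_eq_iff matrix_matrix_mult_def mult.commute)

lemma adjoint_simps [simp]:
  "(u + v)\<^sup>\<dagger> = u\<^sup>\<dagger> + v\<^sup>\<dagger>" "(u - v)\<^sup>\<dagger> = u\<^sup>\<dagger> - v\<^sup>\<dagger>" "(- u)\<^sup>\<dagger> = - u\<^sup>\<dagger>" "(a *\<^sub>R u)\<^sup>\<dagger> = a *\<^sub>R u\<^sup>\<dagger>"
  "(mat 1)\<^sup>\<dagger> = mat 1"
  by (auto simp: vec_eq_iff mat_def)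

lemma unitary_iff: "unitary u \<longleftrightarrow> u\<^sup>\<dagger> ** u = mat 1"
  by (simp add: unitary_def adjoint_mat_def)

lemma SU_adjoint: "u \<in> SU \<Longrightarrow> u\<^sup>\<dagger> ** u = mat 1" "u \<in> SU \<Longrightarrow> u ** u\<^sup>\<dagger> = mat 1"
  by (auto simp: SU_def unitary_iff matrix_left_right_inverse)

lemma SU_cancel:
  "u \<in> SU \<Longrightarrow> u\<^sup>\<dagger> ** (u ** X) = X" "u \<in> SU \<Longrightarrow> u ** (u\<^sup>\<dagger> ** X) = X"
  by (simp_all add: matrix_mul_assoc SU_adjoint)

lemma det_adjoint: "det (u\<^sup>\<dagger>) = cnj (det u)"
proof -
  have "det (u\<^sup>\<dagger>) = det (transpose (\<chi> i j. cnj (u $ i $ j)))"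
    by (rule arg_cong[where f = det]) (simp add: vec_eq_iff transpose_def)
  also have "\<dots> = cnj (det u)"
    unfolding det_transpose by (simp add: det_def)
  finally show ?thesis .
qed

lemma SU_one: "mat 1 \<in> SU"
  by (simp add: SU_def unitary_iff)

lemma SU_mult: "u \<in> SU \<Longrightarrow> v \<in> SU \<Longrightarrow> u ** v \<in> SU"
  by (simp add: SU_def unitary_iff adjoint_mult det_mul) (metis matrix_mul_assoc matrix_mul_lid)

lemma SU_adjoint_mem: "u \<in> SU \<Longrightarrow> u\<^sup>\<dagger> \<in> SU"
  using SU_adjoint(2)[of u] by (simp add: SU_def unitary_iff det_adjoint)

lemma matrix_inv_SU:
  assumes "u \<in> SU"
  shows "matrix_inv u = u\<^sup>\<dagger>"
proof -
  have "u ** matrix_inv u = mat 1"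
    unfolding matrix_inv_def
    by (rule someI2[of _ "u\<^sup>\<dagger>"]) (use SU_adjoint[OF assms] in auto)
  then show ?thesis
    using SU_cancel(1)[OF assms, of "matrix_inv u"] by simp
qed

text \<open>In the Leibniz sum only the identity and the transposition of \<open>i\<close> and \<open>j\<close> contribute.\<close>

lemma det_embedded_2x2:
  fixes M :: "'n::finite cmat"
  assumes "i \<noteq> j"
    and M: "\<And>k l. k \<notin> {i, j} \<or> l \<notin> {i, j} \<Longrightarrow> M $ k $ l = (if k = l then 1 else 0)"
  shows "det M = M $ i $ i * M $ j $ j - M $ i $ j * M $ j $ i"
proof -
  let ?T = "Transposition.transpose i j"
  let ?f = "\<lambda>p. of_int (sign p) * (\<Prod>k\<in>UNIV. M $ k $ p k)"
  have prod: "(\<Prod>k\<in>UNIV. M $ k $ p k) = M $ i $ p i * M $ j $ p j"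
    if "\<And>k. k \<notin> {i, j} \<Longrightarrow> p k = k" for p
  proof -
    have "(\<Prod>k\<in>UNIV. M $ k $ p k) = (\<Prod>k\<in>{i, j}. M $ k $ p k)"
      using that M by (intro prod.mono_neutral_right) auto
    then show ?thesis using \<open>i \<noteq> j\<close> by simp
  qed
  have "det M = (\<Sum>p\<in>{id, ?T}. ?f p)"
    unfolding det_def
  proof (intro sum.mono_neutral_right ballI)
    show "{id, ?T} \<subseteq> {p. p permutes UNIV}"
      by (auto simp: permutes_id permutes_swap_id)
  next
    fix p assume p: "p \<in> {p. p permutes UNIV} - {id, ?T}"
    have "\<exists>k. k \<notin> {i, j} \<and> p k \<noteq> k"
    proof (rule ccontr)
      assume "\<not> ?thesis"
      then have outside: "\<And>k. k \<notin> {i, j} \<Longrightarrow> p k = k" by blast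
      have "inj p" using p by (auto dest: permutes_inj)
      then have "p k \<in> {i, j}" if "k \<in> {i, j}" for k
        using outside that by (metis injD)
      then have "p i \<in> {i, j}" "p j \<in> {i, j}" by blast+
      moreover have "p i \<noteq> p j"
        using \<open>inj p\<close> \<open>i \<noteq> j\<close> by (simp add: inj_eq)
      ultimately consider "p i = i" "p j = j" | "p i = j" "p j = i"
        by auto
      then have "p = id \<or> p = ?T"
      proof cases
        case 1
        then have "p k = k" for k using outside by (cases "k \<in> {i, j}") auto
        then show ?thesis by auto
      next
        case 2
        then have "p k = ?T k" for k
          using outside by (cases "k \<in> {i, j}") (auto simp: Transposition.transpose_def)
        then show ?thesis by auto
      qed
      then show False using p by blast
    qed
    then obtain k where "k \<notin> {i, j}" "p k \<noteq> k" by blast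
    then have "M $ k $ p k = 0" using M by auto
    then have "(\<Prod>k\<in>UNIV. M $ k $ p k) = 0" by (intro prod_zero) auto
    then show "?f p = 0" by simp
  qed simp
  also have "\<dots> = ?f id + ?f ?T"
    using \<open>i \<noteq> j\<close> by (subst sum.insert) (auto simp: fun_eq_iff Transposition.transpose_def)
  also have "?f id = M $ i $ i * M $ j $ j"
    by (subst prod) (auto simp: sign_id)
  also have "?f ?T = - (M $ i $ j * M $ j $ i)"
    using \<open>i \<noteq> j\<close> by (subst prod) (auto simp: sign_swap_id Transposition.transpose_def)
  finally show ?thesis by simp
qed

section \<open>Generators of su(n) and their one-parameter groups\<close>

lemma mat_unit_nth: "mat_unit i j $ k $ l = (if k = i \<and> l = j then 1 else 0)"
  by (auto simp: mat_unit_def axis_def)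

lemma mat_unit_mult: "mat_unit i j ** mat_unit k l = (if j = k then mat_unit i l else 0)"
proof -
  have "(\<Sum>m\<in>UNIV. mat_unit i j $ a $ m * mat_unit k l $ m $ b)
      = (\<Sum>m\<in>UNIV. if m = j then (if a = i \<and> j = k \<and> b = l then 1 else 0) else 0)" for a b
    by (intro sum.cong) (auto simp: mat_unit_nth)
  then show ?thesis
    by (auto simp: vec_eq_iff matrix_matrix_mult_def mat_unit_nth)
qed

lemma mat_mult_nth: "(mat c ** A) $ k $ l = c * A $ k $ l"
proof -
  have "(\<Sum>m\<in>UNIV. mat c $ k $ m * A $ m $ l) = (\<Sum>m\<in>UNIV. if m = k then c * A $ k $ l else 0)"
    by (intro sum.cong) (auto simp: mat_def)
  then show ?thesis by (simp add: matrix_matrix_mult_def)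
qed

lemma Xplus_nth: "Xplus i j $ k $ l
    = (if k = i \<and> l = j then 1 else 0) - (if k = j \<and> l = i then 1 else 0)"
  by (simp add: Xplus_def mat_unit_nth)

lemma Xminus_nth: "Xminus i j $ k $ l
    = \<i> * ((if k = i \<and> l = j then 1 else 0) + (if k = j \<and> l = i then 1 else 0))"
  by (simp add: Xminus_def mat_unit_nth mat_mult_nth)

text \<open>Diagonal directions are absent from r, but they complete \<open>Xplus\<close> and
  \<open>Xminus\<close> to a spanning set of the traceless skew-Hermitian matrices.\<close>

definition Hdiag :: "'n::finite \<Rightarrow> 'n \<Rightarrow> 'n cmat" where
  "Hdiag i j = mat \<i> ** (mat_unit i i - mat_unit j j)"

lemma Hdiag_nth: "Hdiag i j $ k $ l
    = \<i> * ((if k = i \<and> l = i then 1 else 0) - (if k = j \<and> l = j then 1 else 0))"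
  by (simp add: Hdiag_def mat_unit_nth mat_mult_nth)

lemma mat_i_mult_mat_i: "mat \<i> ** A ** (mat \<i> ** B) = - (A ** B)"
  by (simp add: vec_eq_iff matrix_matrix_mult_def[of "mat \<i> ** A"] mat_mult_nth)
    (simp add: matrix_matrix_mult_def sum_negf[symmetric] algebra_simps)

text \<open>All three kinds of generators square to minus the projection onto the coordinates
  \<open>i\<close> and \<open>j\<close> and live on these coordinates; hence the cube of each is its
  negative.\<close>

lemma Xplus_sq: "i \<noteq> j \<Longrightarrow> Xplus i j ** Xplus i j = - (mat_unit i i + mat_unit j j)"
  by (simp add: Xplus_def mm.diff_left mm.diff_right mat_unit_mult)

lemma Xminus_sq: "i \<noteq> j \<Longrightarrow> Xminus i j ** Xminus i j = - (mat_unit i i + mat_unit j j)"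
  by (simp add: Xminus_def mat_i_mult_mat_i mm.add_left mm.add_right mat_unit_mult)

lemma Hdiag_sq: "i \<noteq> j \<Longrightarrow> Hdiag i j ** Hdiag i j = - (mat_unit i i + mat_unit j j)"
  by (simp add: Hdiag_def mat_i_mult_mat_i mm.diff_left mm.diff_right mat_unit_mult)

lemma adjoint_generators:
  fixes i j :: "'a::finite"
  shows "(Xplus i j)\<^sup>\<dagger> = - Xplus i j" "(Xminus i j)\<^sup>\<dagger> = - Xminus i j" "(Hdiag i j)\<^sup>\<dagger> = - Hdiag i j"
  proof -
  have u: "(mat_unit k l)\<^sup>\<dagger> = mat_unit l k" for k l :: 'a
    by (auto simp: vec_eq_iff mat_unit_nth)
  have i: "(mat \<i> ** A)\<^sup>\<dagger> = - (mat \<i> ** A\<^sup>\<dagger>)" for A :: "'a cmat"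
    by (simp add: vec_eq_iff mat_mult_nth)
  show "(Xplus i j)\<^sup>\<dagger> = - Xplus i j" "(Xminus i j)\<^sup>\<dagger> = - Xminus i j" "(Hdiag i j)\<^sup>\<dagger> = - Hdiag i j"
    by (simp_all add: Xplus_def Xminus_def Hdiag_def u i add.commute)
qed

text \<open>The exponential of \<open>t X\<close> for a matrix with \<open>X\<^sup>3 = - X\<close>.\<close>

definition rot :: "'n::finite cmat \<Rightarrow> real \<Rightarrow> 'n cmat" where
  "rot X t = mat 1 + sin t *\<^sub>R X + (1 - cos t) *\<^sub>R (X ** X)"

lemma rot_0: "rot X 0 = mat 1"
  by (simp add: rot_def)

text \<open>The cubic relation reduces every product to \<open>mat 1\<close>, \<open>X\<close> and
  \<open>X ** X\<close>; the resulting coefficients are the addition theorems for sine and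
  cosine.\<close>

lemma rot_add:
  assumes "X ** X ** X = - X"
  shows "rot X (s + t) = rot X s ** rot X t"
proof -
  have X3: "X ** (X ** X) = - X" and X4: "X ** X ** (X ** X) = - (X ** X)"
    using assms by (simp_all add: matrix_mul_assoc mm.minus_left)
  have "rot X s ** rot X t = mat 1
      + (sin s + sin t - sin s * (1 - cos t) - (1 - cos s) * sin t) *\<^sub>R X
      + ((1 - cos s) + (1 - cos t) + sin s * sin t - (1 - cos s) * (1 - cos t)) *\<^sub>R (X ** X)"
    by (simp add: rot_def mm.add_left mm.add_right mm.scaleR_left mm.scaleR_right X3 X4 assms
        del: mult_minus_left mult_minus_right)
      (simp add: algebra_simps)
  also have "\<dots> = rot X (s + t)"
    by (simp add: rot_def sin_add cos_add algebra_simps)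
  finally show ?thesis ..
qed

lemma rot_has_vector_derivative: "(rot X has_vector_derivative X) (at 0)"
  unfolding rot_def by (auto intro!: derivative_eq_intros)

lemma rot_unitary:
  assumes "X ** X ** X = - X" "X\<^sup>\<dagger> = - X"
  shows "unitary (rot X t)"
proof -
  have "(rot X t)\<^sup>\<dagger> = rot X (- t)"
    by (simp add: rot_def adjoint_mult assms(2) mm.minus_left mm.minus_right)
  then show ?thesis
    using rot_add[OF assms(1), of "- t" t] by (simp add: unitary_iff rot_0)
qed

inductive_set su_gen :: "'n::finite cmat set" where
  Xplus: "i \<noteq> j \<Longrightarrow> Xplus i j \<in> su_gen"
| Xminus: "i \<noteq> j \<Longrightarrow> Xminus i j \<in> su_gen"
| Hdiag: "i \<noteq> j \<Longrightarrow> Hdiag i j \<in> su_gen"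

lemma su_gen_cube:
  assumes "X \<in> su_gen"
  shows "X ** X ** X = - X"
proof -
  have c: "(mat \<i> ** A) ** B = mat \<i> ** (A ** B)" for A B :: "'a cmat"
    by (simp add: matrix_mul_assoc)
  have c': "A ** (mat \<i> ** B) = mat \<i> ** (A ** B)" for A B :: "'a cmat"
    by (simp add: vec_eq_iff mat_mult_nth matrix_matrix_mult_def[of A]
        sum_distrib_left algebra_simps)
  show ?thesis
    using assms
    by cases (auto simp: Xplus_sq Xminus_sq Hdiag_sq,
      auto simp: Xplus_def Xminus_def Hdiag_def mm.add_left mm.add_right mm.diff_left mm.diff_right
        mm.minus_left mm.minus_right mat_unit_mult c c')
qed

text \<open>\<open>rot X t\<close> differs from the identity only in the rows and columns
  \<open>i\<close>, \<open>j\<close>, so its determinant is a 2 by 2 one, equal to cos^2 + sin^2 for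
  every kind of generator.\<close>

lemma rot_su_gen_SU:
  assumes "X \<in> su_gen"
  shows "rot X t \<in> SU"
proof -
  have "X\<^sup>\<dagger> = - X"
    using assms by cases (auto simp: adjoint_generators)
  then have "unitary (rot X t)"
    using rot_unitary su_gen_cube[OF assms] by blast
  moreover have "det (rot X t) = 1"
  proof -
    have sc: "(complex_of_real (cos t))\<^sup>2 + (complex_of_real (sin t))\<^sup>2 = 1"
      using sin_cos_squared_add2[of t] by (metis of_real_1 of_real_add of_real_power)
    show ?thesis
      using assms
    proof cases
      case (Xplus i j)
      then show ?thesis
        using sc by (subst det_embedded_2x2[of i j])
          (auto simp: rot_def Xplus_sq mat_def mat_unit_nth Xplus_nth scaleR_conv_of_real[where 'a = complex]
            power2_eq_square algebra_simps)
    next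
      case (Xminus i j)
      then show ?thesis
        using sc by (subst det_embedded_2x2[of i j])
          (auto simp: rot_def Xminus_sq mat_def mat_unit_nth Xminus_nth scaleR_conv_of_real[where 'a = complex]
            power2_eq_square algebra_simps)
    next
      case (Hdiag i j)
      then show ?thesis
        using sc by (subst det_embedded_2x2[of i j])
          (auto simp: rot_def Hdiag_sq mat_def mat_unit_nth Hdiag_nth scaleR_conv_of_real[where 'a = complex]
            power2_eq_square algebra_simps)
    qed
  qed
  ultimately show ?thesis by (simp add: SU_def)
qed

lemma lie_algebraI_rot:
  assumes "X \<in> su_gen" "\<And>t. rot X t \<in> H"
  shows "X \<in> lie_algebra H"
  unfolding lie_algebra_def
  using assms rot_add[OF su_gen_cube[OF assms(1)]] rot_has_vector_derivative by blast

lemma su_gen_tangent: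
  assumes "X \<in> su_gen" "u \<in> SU" "v \<in> SU"
  shows "u ** X ** v \<in> curve_tangent SU (u ** v)"
  unfolding curve_tangent_def
proof (intro CollectI exI conjI allI)
  show "u ** rot X t ** v \<in> SU" for t
    using assms rot_su_gen_SU SU_mult by blast
  show "u ** rot X 0 ** v = u ** v" by (simp add: rot_0)
  have "bounded_linear (\<lambda>Y. u ** Y ** v)"
    by (intro bounded_linear_compose[OF mm.bounded_linear_left mm.bounded_linear_right])
  then show "((\<lambda>t. u ** rot X t ** v) has_vector_derivative u ** X ** v) (at 0)"
    using bounded_linear.has_vector_derivative rot_has_vector_derivative by blast
qed

section \<open>The Jacobi identity for quadratic bivector fields\<close>

text \<open>The bivector field \<open>\<Sum>\<^sub>i A\<^sub>i \<wedge> B\<^sub>i\<close> built from linear vector fields, its contraction with a covector,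
  and the derivative of its values on constant covectors.\<close>

definition lin_bivec ::
  "'i set \<Rightarrow> ('i \<Rightarrow> 'a \<Rightarrow> 'a) \<Rightarrow> ('i \<Rightarrow> 'a \<Rightarrow> 'a) \<Rightarrow> 'a \<Rightarrow> ('a \<Rightarrow> real) \<Rightarrow> ('a \<Rightarrow> real) \<Rightarrow> real" where
  "lin_bivec I A B x \<alpha> \<beta> = (\<Sum>i\<in>I. \<alpha> (A i x) * \<beta> (B i x) - \<alpha> (B i x) * \<beta> (A i x))"

definition lin_bivec_sharp ::
  "'i set \<Rightarrow> ('i \<Rightarrow> 'a \<Rightarrow> 'a) \<Rightarrow> ('i \<Rightarrow> 'a \<Rightarrow> 'a) \<Rightarrow> 'a \<Rightarrow> ('a \<Rightarrow> real) \<Rightarrow> 'a::real_vector" where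
  "lin_bivec_sharp I A B x \<alpha> = (\<Sum>i\<in>I. \<alpha> (A i x) *\<^sub>R B i x - \<alpha> (B i x) *\<^sub>R A i x)"

definition lin_bivec_deriv ::
  "'i set \<Rightarrow> ('i \<Rightarrow> 'a \<Rightarrow> 'a) \<Rightarrow> ('i \<Rightarrow> 'a \<Rightarrow> 'a) \<Rightarrow> 'a \<Rightarrow> ('a \<Rightarrow> real) \<Rightarrow> ('a \<Rightarrow> real) \<Rightarrow> 'a \<Rightarrow> real" where
  "lin_bivec_deriv I A B x \<alpha> \<beta> Z = (\<Sum>i\<in>I. \<alpha> (A i Z) * \<beta> (B i x) + \<alpha> (A i x) * \<beta> (B i Z)
     - \<alpha> (B i Z) * \<beta> (A i x) - \<alpha> (B i x) * \<beta> (A i Z))"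

lemma lin_bivec_sharp:
  assumes "linear \<beta>"
  shows "lin_bivec I A B x \<alpha> \<beta> = \<beta> (lin_bivec_sharp I A B x \<alpha>)"
  by (simp add: lin_bivec_def lin_bivec_sharp_def linear_sum[OF assms] linear_diff[OF assms]
      linear_cmul[OF assms])

text \<open>Differentiability is known for derivatives in fixed directions, so the moving direction
  \<open>A y\<close> is expanded in a basis. Symmetry of second derivatives then puts
  \<open>Z\<close> in the inner position; the Hessian term becomes visibly linear in
  \<open>A x\<close>, which later lets such terms be collected in
  \<open>lin_bivec_sharp\<close>.\<close>

lemma has_derivative_dir_deriv_linear_field:
  fixes G :: "'a::euclidean_space \<Rightarrow> real"
  assumes G: "Ck_on 2 U G" and "open U" "x \<in> U" and A: "bounded_linear A"
  shows "((\<lambda>y. dir_deriv (A y) G y) has_derivative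
     (\<lambda>Z. dir_deriv (A x) (dir_deriv Z G) x + dir_deriv (A Z) G x)) (at x)"
proof -
  have dG: "G differentiable (at y)" "dir_deriv v G differentiable (at y)" if "y \<in> U" for v y
    using G that by (simp_all add: numeral_2_eq_2)
  have expand: "h v = (\<Sum>b\<in>Basis. (v \<bullet> b) * h b)" if "linear h" for h :: "'a \<Rightarrow> real" and v
    using linear_sum[OF that, of "\<lambda>b. (v \<bullet> b) *\<^sub>R b" Basis]
    by (simp add: linear_cmul[OF that] euclidean_representation)
  have "((\<lambda>y. \<Sum>b\<in>Basis. (A y \<bullet> b) * dir_deriv b G y) has_derivative
      (\<lambda>Z. \<Sum>b\<in>Basis. (A x \<bullet> b) * dir_deriv Z (dir_deriv b G) x + (A Z \<bullet> b) * dir_deriv b G x)) (at x)"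
    using dG(2)[OF \<open>x \<in> U\<close>] A unfolding frechet_derivative_works
    by (intro has_derivative_sum has_derivative_mult bounded_linear_imp_has_derivative
        bounded_linear_compose[OF bounded_linear_inner_left])
  moreover have "(\<Sum>b\<in>Basis. (A x \<bullet> b) * dir_deriv Z (dir_deriv b G) x + (A Z \<bullet> b) * dir_deriv b G x)
      = dir_deriv (A x) (dir_deriv Z G) x + dir_deriv (A Z) G x" for Z
    using expand[OF frechet_derivative_linear[OF dG(1)[OF \<open>x \<in> U\<close>]], of "A Z"]
      expand[OF frechet_derivative_linear[OF dG(2)[OF \<open>x \<in> U\<close>]], of Z "A x"]
    by (simp add: sum.distrib dir_deriv_commute[OF assms(1-3), of Z])
  ultimately have "((\<lambda>y. \<Sum>b\<in>Basis. (A y \<bullet> b) * dir_deriv b G y) has_derivative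
      (\<lambda>Z. dir_deriv (A x) (dir_deriv Z G) x + dir_deriv (A Z) G x)) (at x)"
    by simp
  moreover have "(\<Sum>b\<in>Basis. (A y \<bullet> b) * dir_deriv b G y) = dir_deriv (A y) G y" if "y \<in> U" for y
    using expand[OF frechet_derivative_linear[OF dG(1)[OF that]], of "A y"] by simp
  ultimately show ?thesis
    by (rule has_derivative_transform_within_open[OF _ assms(2,3)])
qed

lemma has_derivative_lin_bivec:
  fixes G H :: "'a::euclidean_space \<Rightarrow> real"
  assumes G: "Ck_on 2 U G" and H: "Ck_on 2 U H" and U: "open U" "x \<in> U"
    and AB: "\<And>i. bounded_linear (A i)" "\<And>i. bounded_linear (B i)"
  shows "((\<lambda>y. lin_bivec I A B y (frechet_derivative G (at y)) (frechet_derivative H (at y)))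
    has_derivative (\<lambda>Z.
      dir_deriv (lin_bivec_sharp I A B x (frechet_derivative G (at x))) (dir_deriv Z H) x
      - dir_deriv (lin_bivec_sharp I A B x (frechet_derivative H (at x))) (dir_deriv Z G) x
      + lin_bivec_deriv I A B x (frechet_derivative G (at x)) (frechet_derivative H (at x)) Z)) (at x)"
    (is "(?f has_derivative ?D) _")
proof -
  have lin: "linear (frechet_derivative (dir_deriv Z K) (at x))" if "Ck_on 2 U K" for Z and K :: "'a \<Rightarrow> real"
    using that U by (intro frechet_derivative_linear) (simp add: numeral_2_eq_2)
  note d = has_derivative_dir_deriv_linear_field[OF _ U]
  have "(?f has_derivative (\<lambda>Z. \<Sum>i\<in>I.
      (dir_deriv (A i x) G x * (dir_deriv (B i x) (dir_deriv Z H) x + dir_deriv (B i Z) H x)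
        + (dir_deriv (A i x) (dir_deriv Z G) x + dir_deriv (A i Z) G x) * dir_deriv (B i x) H x)
      - (dir_deriv (B i x) G x * (dir_deriv (A i x) (dir_deriv Z H) x + dir_deriv (A i Z) H x)
        + (dir_deriv (B i x) (dir_deriv Z G) x + dir_deriv (B i Z) G x) * dir_deriv (A i x) H x))) (at x)"
    unfolding lin_bivec_def
    by (intro has_derivative_sum has_derivative_diff has_derivative_mult d G H AB)
  moreover have "(\<Sum>i\<in>I.
      (dir_deriv (A i x) G x * (dir_deriv (B i x) (dir_deriv Z H) x + dir_deriv (B i Z) H x)
        + (dir_deriv (A i x) (dir_deriv Z G) x + dir_deriv (A i Z) G x) * dir_deriv (B i x) H x)
      - (dir_deriv (B i x) G x * (dir_deriv (A i x) (dir_deriv Z H) x + dir_deriv (A i Z) H x)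
        + (dir_deriv (B i x) (dir_deriv Z G) x + dir_deriv (B i Z) G x) * dir_deriv (A i x) H x)) = ?D Z" for Z
    unfolding lin_bivec_sharp_def lin_bivec_deriv_def
    by (simp add: linear_sum[OF lin] linear_diff[OF lin] linear_cmul[OF lin] G H
        sum_subtractf[symmetric] sum.distrib[symmetric])
      (simp add: algebra_simps)
  ultimately show ?thesis by simp
qed

lemma jacobi_lin_bivec:
  fixes F G H :: "'a::euclidean_space \<Rightarrow> real" and I :: "'i set"
  assumes F: "Ck_on 2 U F" and G: "Ck_on 2 U G" and H: "Ck_on 2 U H" and U: "open U" "x \<in> U"
    and AB: "\<And>i. bounded_linear (A i)" "\<And>i. bounded_linear (B i)"
  defines "br \<equiv> \<lambda>f g y. lin_bivec I A B y (frechet_derivative f (at y)) (frechet_derivative g (at y))"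
    and "Q \<equiv> \<lambda>f g h. lin_bivec_deriv I A B x (frechet_derivative g (at x)) (frechet_derivative h (at x))
      (lin_bivec_sharp I A B x (frechet_derivative f (at x)))"
  shows "br F (br G H) x + br G (br H F) x + br H (br F G) x = Q F G H + Q G H F + Q H F G"
proof -
  let ?V = "\<lambda>f. lin_bivec_sharp I A B x (frechet_derivative f (at x))"
  \<comment> \<open>\<open>?V f\<close> is the Hamiltonian vector of \<open>f\<close> at
    \<open>x\<close>, so the outer bracket is the derivative of the inner one along it.
    \<open>Q\<close> is the part in which the coefficients of the bivector field are
    differentiated.\<close>
  have step: "br f (br g h) x = dir_deriv (?V g) (dir_deriv (?V f) h) x
      - dir_deriv (?V h) (dir_deriv (?V f) g) x + Q f g h"
    if "Ck_on 2 U g" "Ck_on 2 U h" for f g h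
  proof -
    note D = has_derivative_lin_bivec[OF that U AB, of I]
    have "linear (frechet_derivative (br g h) (at x))"
      unfolding br_def by (rule frechet_derivative_linear[OF differentiableI[OF D]])
    then have "br f (br g h) x = frechet_derivative (br g h) (at x) (?V f)"
      unfolding br_def by (rule lin_bivec_sharp)
    also have "\<dots> = dir_deriv (?V g) (dir_deriv (?V f) h) x
      - dir_deriv (?V h) (dir_deriv (?V f) g) x + Q f g h"
      unfolding br_def Q_def by (rule fun_cong[OF frechet_derivative_at[OF D], symmetric])
    finally show ?thesis .
  qed
  show ?thesis
    using dir_deriv_commute[OF F U, of "?V G" "?V H"] dir_deriv_commute[OF G U, of "?V H" "?V F"]
      dir_deriv_commute[OF H U, of "?V F" "?V G"]
    step[OF G H, of F] step[OF H F, of G] step[OF F G, of H]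
    by linarith
qed

section \<open>The modified classical Yang--Baxter equation\<close>

definition r_form :: "('n::{finite,linorder} cmat \<Rightarrow> real) \<Rightarrow> ('n cmat \<Rightarrow> real) \<Rightarrow> real" where
  "r_form \<alpha> \<beta> = (\<Sum>(i, j) | i < j. \<alpha> (Xplus i j) * \<beta> (Xminus i j) - \<alpha> (Xminus i j) * \<beta> (Xplus i j))"

definition r_sharp :: "('n::{finite,linorder} cmat \<Rightarrow> real) \<Rightarrow> 'n cmat" where
  "r_sharp \<alpha> = (\<Sum>(i, j) | i < j. \<alpha> (Xplus i j) *\<^sub>R Xminus i j - \<alpha> (Xminus i j) *\<^sub>R Xplus i j)"

lemma r_form_sharp:
  assumes "linear \<beta>"
  shows "r_form \<alpha> \<beta> = \<beta> (r_sharp \<alpha>)"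
  by (simp add: r_form_def r_sharp_def linear_sum[OF assms] linear_diff[OF assms]
      linear_cmul[OF assms] split_def)

lemma r_form_antisym: "r_form \<alpha> \<beta> = - r_form \<beta> \<alpha>"
  by (simp add: r_form_def sum_negf[symmetric] split_def mult.commute)

section \<open>Skew-Hermitian matrices and the trace pairing\<close>

definition skew :: "'n::finite cmat \<Rightarrow> bool" where
  "skew X \<longleftrightarrow> X\<^sup>\<dagger> = - X"

lemma skew_nth: "skew X \<Longrightarrow> cnj (X $ j $ i) = - X $ i $ j"
  unfolding skew_def by (metis adjoint_nth vector_uminus_component)

lemma trace_mult_nth: "trace (A ** B) = (\<Sum>i\<in>UNIV. \<Sum>j\<in>UNIV. A $ i $ j * B $ j $ i)"
  by (simp add: trace_def matrix_matrix_mult_def)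

lemma cnj_trace: "trace (A\<^sup>\<dagger>) = cnj (trace A)"
  by (simp add: trace_def)

lemma skew_representation:
  fixes f :: "'n::finite cmat \<Rightarrow> real"
  assumes "linear f"
  obtains \<xi> where "skew \<xi>" "\<And>X. skew X \<Longrightarrow> f X = Re (trace (\<xi> ** X))"
proof -
  define a :: "'n cmat" where "a = (\<Sum>b\<in>Basis. f b *\<^sub>R b)"
  \<comment> \<open>The skew-Hermitian part of the adjoint of \<open>a\<close>; the discarded
    Hermitian part pairs to zero with skew matrices in the real part of the trace.\<close>
  define \<xi> where "\<xi> = (1/2) *\<^sub>R (a\<^sup>\<dagger> - a)"
  have f: "f X = Re (trace (a\<^sup>\<dagger> ** X))" for X
  proof -
    have "f X = a \<bullet> X"
      using linear_sum[OF assms, of "\<lambda>b. (X \<bullet> b) *\<^sub>R b" Basis]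
      by (simp add: a_def linear_cmul[OF assms] euclidean_representation inner_sum_right
          mult.commute inner_commute[of _ X])
    also have "\<dots> = (\<Sum>i\<in>UNIV. \<Sum>j\<in>UNIV. Re (cnj (a $ i $ j) * X $ i $ j))"
      by (simp add: inner_vec_def inner_complex_def)
    also have "\<dots> = (\<Sum>j\<in>UNIV. \<Sum>i\<in>UNIV. Re (cnj (a $ i $ j) * X $ i $ j))"
      by (rule sum.swap)
    also have "\<dots> = Re (trace (a\<^sup>\<dagger> ** X))"
      by (simp add: trace_mult_nth)
    finally show ?thesis .
  qed
  have "skew \<xi>"
    by (simp add: skew_def \<xi>_def scaleR_diff_right)
  moreover have "f X = Re (trace (\<xi> ** X))" if "skew X" for X
  proof -
    have "Re (trace (a ** X)) = Re (trace ((a ** X)\<^sup>\<dagger>))"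
      by (simp add: cnj_trace)
    also have "\<dots> = - Re (trace (a\<^sup>\<dagger> ** X))"
      using that trace_mul_sym[of X "a\<^sup>\<dagger>"]
      by (simp add: adjoint_mult skew_def mm.minus_left trace_def sum_negf)
    finally have "Re (trace (a\<^sup>\<dagger> ** X)) = (Re (trace (a\<^sup>\<dagger> ** X)) - Re (trace (a ** X))) / 2"
      by simp
    also have "\<dots> = Re (trace (\<xi> ** X))"
      by (simp add: \<xi>_def mm.scaleR_left mm.diff_left trace_def sum_subtractf
          scaleR_sum_right[symmetric] Re_sum[symmetric] del: Re_sum)
    finally show ?thesis by (simp add: f)
  qed
  ultimately show ?thesis by (rule that)
qed

lemma trace_Xplus: "skew \<xi> \<Longrightarrow> Re (trace (\<xi> ** Xplus i j)) = - 2 * Re (\<xi> $ i $ j)"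
  and trace_Xminus: "skew \<xi> \<Longrightarrow> Re (trace (\<xi> ** Xminus i j)) = - 2 * Im (\<xi> $ i $ j)"
proof -
  have unit: "trace (\<xi> ** mat_unit k l) = \<xi> $ l $ k" for k l
  proof -
    have "trace (\<xi> ** mat_unit k l)
        = (\<Sum>a\<in>UNIV. \<Sum>b\<in>UNIV. if b = k then (if a = l then \<xi> $ l $ k else 0) else 0)"
      unfolding trace_mult_nth by (intro sum.cong) (auto simp: mat_unit_nth)
    then show ?thesis by simp
  qed
  have c: "trace (\<xi> ** (mat \<i> ** A)) = \<i> * trace (\<xi> ** A)" for A
    by (simp add: trace_mult_nth mat_mult_nth sum_distrib_left algebra_simps)
  assume "skew \<xi>"
  note s = skew_nth[OF this, of j i]
  have "Re (\<xi> $ j $ i) = - Re (\<xi> $ i $ j)" "Im (\<xi> $ j $ i) = Im (\<xi> $ i $ j)"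
    using arg_cong[OF s, of Re] arg_cong[OF s, of Im] by simp_all
  then show "Re (trace (\<xi> ** Xplus i j)) = - 2 * Re (\<xi> $ i $ j)"
    "Re (trace (\<xi> ** Xminus i j)) = - 2 * Im (\<xi> $ i $ j)"
    by (simp_all add: Xplus_def Xminus_def mm.diff_right mm.add_right trace_sub trace_add unit c)
qed

lemma skew_generators: "skew (Xplus i j)" "skew (Xminus i j)" "skew (Hdiag i j)"
  by (simp_all add: skew_def adjoint_generators)

lemma skew_scaleR: "skew X \<Longrightarrow> skew (a *\<^sub>R X)"
  and skew_add: "skew X \<Longrightarrow> skew Y \<Longrightarrow> skew (X + Y)"
  and skew_diff: "skew X \<Longrightarrow> skew Y \<Longrightarrow> skew (X - Y)"
  by (simp_all add: skew_def)

lemma skew_0: "skew 0"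
  by (simp add: skew_def vec_eq_iff)

lemma skew_sum: "(\<And>i. i \<in> I \<Longrightarrow> skew (X i)) \<Longrightarrow> skew (\<Sum>i\<in>I. X i)"
  by (induction I rule: infinite_finite_induct) (auto simp: skew_0 skew_add)

lemma skew_conj: "skew X \<Longrightarrow> skew (w ** X ** w\<^sup>\<dagger>)"
  by (simp add: skew_def adjoint_mult mm.minus_left mm.minus_right matrix_mul_assoc)

lemma skew_commutator: "skew X \<Longrightarrow> skew Y \<Longrightarrow> skew (X ** Y - Y ** X)"
  by (simp add: skew_def adjoint_mult mm.minus_left mm.minus_right)

lemma skew_r_sharp: "skew (r_sharp f)"
  unfolding r_sharp_def
  by (intro skew_sum) (auto intro!: skew_diff skew_scaleR skew_generators)

text \<open>The standard R-matrix: by \<open>r_sharp_nth\<close>, contraction with r multiplies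
  matrix entries by this sign, up to -2i.\<close>

definition pair_sign :: "'n::linorder \<Rightarrow> 'n \<Rightarrow> complex" where
  "pair_sign i j = (if i < j then 1 else if j < i then - 1 else 0)"

text \<open>The modified Yang--Baxter equation, entry by entry. The value -1 does not depend on the
  order of the indices; the exception of three equal indices produces the diagonal correction in
  \<open>trace_pair_sign_cocycle\<close>.\<close>

lemma pair_sign_cocycle:
  "pair_sign j k * pair_sign k i + pair_sign i j * pair_sign k i + pair_sign i j * pair_sign j k
     = (if i = j \<and> j = k then 0 else - 1)"
  by (auto simp: pair_sign_def)

lemma sum_pairs_delta:
  fixes g :: "'n::{finite,linorder} \<Rightarrow> 'n \<Rightarrow> 'a::comm_monoid_add"
  shows "(\<Sum>(i, j) | i < j. if k = i \<and> l = j then g i j else 0) = (if k < l then g k l else 0)"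
proof -
  have "(\<Sum>(i, j) | i < j. if k = i \<and> l = j then g i j else 0)
      = (\<Sum>p\<in>{(i, j). i < j}. if p = (k, l) then g k l else 0)"
    by (intro sum.cong) (auto split: if_splits)
  then show ?thesis by simp
qed

text \<open>On a pair of generators \<open>f\<close> yields -2 times the real and imaginary part of
  \<open>\<xi> $ i $ j\<close>, and these recombine to that entry and its conjugate, multiplied by
  -2i. In the lower triangle skewness turns the conjugate into minus the entry there, whence the
  sign.\<close>

lemma r_sharp_nth:
  assumes "skew \<xi>" "\<And>X. skew X \<Longrightarrow> f X = Re (trace (\<xi> ** X))"
  shows "r_sharp f $ k $ l = - 2 * \<i> * pair_sign k l * \<xi> $ k $ l"
proof -
  have f: "f (Xplus i j) = - 2 * Re (\<xi> $ i $ j)" "f (Xminus i j) = - 2 * Im (\<xi> $ i $ j)" for i j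
    using assms skew_generators trace_Xplus trace_Xminus by metis+
  have entry: "(f (Xplus i j) *\<^sub>R Xminus i j - f (Xminus i j) *\<^sub>R Xplus i j) $ k $ l
      = (if k = i \<and> l = j then - 2 * \<i> * \<xi> $ i $ j else 0)
      + (if l = i \<and> k = j then - 2 * \<i> * cnj (\<xi> $ i $ j) else 0)" if "i < j" for i j
    proof -
    have "i \<noteq> j" using that by simp
    consider "k = i" "l = j" | "k = j" "l = i" | "\<not> (k = i \<and> l = j)" "\<not> (k = j \<and> l = i)"
      by blast
    then show ?thesis
    proof cases
      case 3
      then have "Xplus i j $ k $ l = 0" "Xminus i j $ k $ l = 0"
        by (simp_all only: Xplus_nth Xminus_nth if_False diff_self add_0 mult_zero_right)
      with 3 show ?thesis
        by (simp only: conj_commute[of "l = i"] vector_minus_component vector_scaleR_component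
            scaleR_zero_right if_False diff_self add_0)
    qed (use \<open>i \<noteq> j\<close> in \<open>simp_all add: f Xplus_nth Xminus_nth complex_eq_iff\<close>)
  qed
  have "r_sharp f $ k $ l = (\<Sum>(i, j) | i < j.
      (if k = i \<and> l = j then - 2 * \<i> * \<xi> $ i $ j else 0)
      + (if l = i \<and> k = j then - 2 * \<i> * cnj (\<xi> $ i $ j) else 0))"
    unfolding r_sharp_def sum_component
    by (intro sum.cong refl) (use entry in \<open>simp add: split_def\<close>)
  also have "\<dots> = (if k < l then - 2 * \<i> * \<xi> $ k $ l else 0)
      + (if l < k then - 2 * \<i> * cnj (\<xi> $ l $ k) else 0)"
    using sum_pairs_delta[of k l "\<lambda>i j. - 2 * \<i> * \<xi> $ i $ j"]
      sum_pairs_delta[of l k "\<lambda>i j. - 2 * \<i> * cnj (\<xi> $ i $ j)"]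
    by (simp add: split_def sum.distrib)
  also have "\<dots> = - 2 * \<i> * pair_sign k l * \<xi> $ k $ l"
    by (auto simp: pair_sign_def skew_nth[OF assms(1)])
  finally show ?thesis .
qed

text \<open>Up to a factor, the contraction of the Schouten bracket \<open>[r, r]\<close> with three covectors.\<close>

definition schouten ::
  "('n::{finite,linorder} cmat \<Rightarrow> real) \<Rightarrow> ('n cmat \<Rightarrow> real) \<Rightarrow> ('n cmat \<Rightarrow> real) \<Rightarrow> real" where
  "schouten f g h =
     f (r_sharp g ** r_sharp h - r_sharp h ** r_sharp g)
     + g (r_sharp h ** r_sharp f - r_sharp f ** r_sharp h)
     + h (r_sharp f ** r_sharp g - r_sharp g ** r_sharp f)"

lemma trace_mult3: "trace (A ** B ** C) = (\<Sum>i\<in>UNIV. \<Sum>j\<in>UNIV. \<Sum>k\<in>UNIV. A $ i $ j * B $ j $ k * C $ k $ i)"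
proof -
  have "trace (A ** B ** C) = (\<Sum>i\<in>UNIV. \<Sum>k\<in>UNIV. \<Sum>j\<in>UNIV. A $ i $ j * B $ j $ k * C $ k $ i)"
    by (simp add: trace_mult_nth matrix_matrix_mult_def[of A] sum_distrib_right)
  also have "\<dots> = (\<Sum>i\<in>UNIV. \<Sum>j\<in>UNIV. \<Sum>k\<in>UNIV. A $ i $ j * B $ j $ k * C $ k $ i)"
    by (intro sum.cong refl sum.swap)
  finally show ?thesis .
qed

text \<open>A triple trace is a sum over closed index triangles, and the three ways of applying r to
  two of the factors weight each triangle by the products in \<open>pair_sign_cocycle\<close>. The
  diagonal remainder is symmetric in \<xi>, \<eta>, \<zeta>.\<close>

lemma trace_pair_sign_cocycle:
  fixes \<xi> \<eta> \<zeta> :: "'n::{finite,linorder} cmat"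
  assumes "\<And>k l. a $ k $ l = - 2 * \<i> * pair_sign k l * \<xi> $ k $ l"
    and "\<And>k l. b $ k $ l = - 2 * \<i> * pair_sign k l * \<eta> $ k $ l"
    and "\<And>k l. c $ k $ l = - 2 * \<i> * pair_sign k l * \<zeta> $ k $ l"
  shows "trace (\<xi> ** b ** c) + trace (a ** \<eta> ** c) + trace (a ** b ** \<zeta>)
    = 4 * trace (\<xi> ** \<eta> ** \<zeta>) - 4 * (\<Sum>i\<in>UNIV. \<xi> $ i $ i * \<eta> $ i $ i * \<zeta> $ i $ i)"
proof -
  let ?t = "\<lambda>i j k. \<xi> $ i $ j * \<eta> $ j $ k * \<zeta> $ k $ i"
  have "trace (\<xi> ** b ** c) + trace (a ** \<eta> ** c) + trace (a ** b ** \<zeta>)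
      = (\<Sum>i\<in>UNIV. \<Sum>j\<in>UNIV. \<Sum>k\<in>UNIV. - 4 * ?t i j k * (pair_sign j k * pair_sign k i
          + pair_sign i j * pair_sign k i + pair_sign i j * pair_sign j k))"
    unfolding trace_mult3 sum.distrib[symmetric] assms by (intro sum.cong refl) (simp add: algebra_simps)
  also have "\<dots> = (\<Sum>i\<in>UNIV. \<Sum>j\<in>UNIV. \<Sum>k\<in>UNIV. 4 * ?t i j k
      - (if k = j then (if j = i then 4 * ?t i i i else 0) else 0))"
    unfolding pair_sign_cocycle by (intro sum.cong refl) auto
  also have "\<dots> = 4 * trace (\<xi> ** \<eta> ** \<zeta>) - 4 * (\<Sum>i\<in>UNIV. ?t i i i)"
    unfolding trace_mult3 by (simp add: sum_subtractf sum_distrib_left)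
  finally show ?thesis .
qed

text \<open>Cyclicity of the trace sorts the commutators into two sums of the form of
  \<open>trace_pair_sign_cocycle\<close>, one for each orientation of the triple; their diagonal
  remainders are equal and cancel in the difference.\<close>

lemma schouten_eq_trace:
  assumes \<xi>: "skew \<xi>" "\<And>X. skew X \<Longrightarrow> f X = Re (trace (\<xi> ** X))"
    and \<eta>: "skew \<eta>" "\<And>X. skew X \<Longrightarrow> g X = Re (trace (\<eta> ** X))"
    and \<zeta>: "skew \<zeta>" "\<And>X. skew X \<Longrightarrow> h X = Re (trace (\<zeta> ** X))"
  shows "schouten f g h = 4 * Re (trace (\<xi> ** \<eta> ** \<zeta>) - trace (\<xi> ** \<zeta> ** \<eta>))"
proof -
  let ?a = "r_sharp f" and ?b = "r_sharp g" and ?c = "r_sharp h"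
  note n = r_sharp_nth[OF \<xi>] r_sharp_nth[OF \<eta>] r_sharp_nth[OF \<zeta>]
  have rot: "trace (A ** B ** C) = trace (B ** C ** A)" for A B C :: "'a cmat"
    using trace_mul_sym[of A "B ** C"] by (simp add: matrix_mul_assoc)
  have "schouten f g h = Re (
      (trace (\<xi> ** ?b ** ?c) + trace (?a ** \<eta> ** ?c) + trace (?a ** ?b ** \<zeta>))
      - (trace (\<xi> ** ?c ** ?b) + trace (?a ** \<zeta> ** ?b) + trace (?a ** ?c ** \<eta>)))"
    unfolding schouten_def
    using rot[of \<eta> ?c ?a] rot[of ?a \<eta> ?c] rot[of \<zeta> ?a ?b] rot[of ?c ?a \<eta>] rot[of ?a ?b \<zeta>] rot[of \<eta> ?a ?c] rot[of ?a ?c \<eta>]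
      rot[of \<zeta> ?b ?a] rot[of ?b ?a \<zeta>] rot[of ?a \<zeta> ?b]
    by (simp add: \<xi>(2) \<eta>(2) \<zeta>(2) skew_commutator skew_r_sharp mm.diff_right trace_sub matrix_mul_assoc)
  also have "\<dots> = 4 * Re (trace (\<xi> ** \<eta> ** \<zeta>) - trace (\<xi> ** \<zeta> ** \<eta>))"
    by (subst (1 2) trace_pair_sign_cocycle) (simp_all add: n \<xi> \<eta> \<zeta> mult.commute mult.left_commute)
  finally show ?thesis .
qed

text \<open>Composing a functional with conjugation by \<open>w\<close> conjugates its representing
  matrix inversely, and a triple trace is unchanged by simultaneous conjugation.\<close>

lemma schouten_conj:
  fixes f g h :: "'n::{finite,linorder} cmat \<Rightarrow> real"
  assumes w: "w \<in> SU" and lin: "linear f" "linear g" "linear h"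
  shows "schouten (\<lambda>X. f (w ** X ** w\<^sup>\<dagger>)) (\<lambda>X. g (w ** X ** w\<^sup>\<dagger>)) (\<lambda>X. h (w ** X ** w\<^sup>\<dagger>)) = schouten f g h"
proof -
  obtain \<xi> where \<xi>: "skew \<xi>" "\<And>X. skew X \<Longrightarrow> f X = Re (trace (\<xi> ** X))"
    using skew_representation[OF lin(1)] by metis
  obtain \<eta> where \<eta>: "skew \<eta>" "\<And>X. skew X \<Longrightarrow> g X = Re (trace (\<eta> ** X))"
    using skew_representation[OF lin(2)] by metis
  obtain \<zeta> where \<zeta>: "skew \<zeta>" "\<And>X. skew X \<Longrightarrow> h X = Re (trace (\<zeta> ** X))"
    using skew_representation[OF lin(3)] by metis
  have conj: "trace (\<theta> ** (w ** X ** w\<^sup>\<dagger>)) = trace ((w\<^sup>\<dagger> ** \<theta> ** w) ** X)" for \<theta> X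
    using trace_mul_sym[of "\<theta> ** w ** X" "w\<^sup>\<dagger>"] by (simp add: matrix_mul_assoc)
  have skew': "skew (w\<^sup>\<dagger> ** \<theta> ** w)" if "skew \<theta>" for \<theta>
    using skew_conj[OF that, of "w\<^sup>\<dagger>"] by simp
  have tr: "trace ((w\<^sup>\<dagger> ** A ** w) ** (w\<^sup>\<dagger> ** B ** w) ** (w\<^sup>\<dagger> ** C ** w)) = trace (A ** B ** C)" for A B C
    using trace_mul_sym[of "w\<^sup>\<dagger>" "A ** B ** C ** w"]
    by (simp add: matrix_mul_assoc[symmetric] SU_cancel[OF w] SU_adjoint[OF w])
  have "schouten (\<lambda>X. f (w ** X ** w\<^sup>\<dagger>)) (\<lambda>X. g (w ** X ** w\<^sup>\<dagger>)) (\<lambda>X. h (w ** X ** w\<^sup>\<dagger>))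
      = 4 * Re (trace ((w\<^sup>\<dagger> ** \<xi> ** w) ** (w\<^sup>\<dagger> ** \<eta> ** w) ** (w\<^sup>\<dagger> ** \<zeta> ** w))
        - trace ((w\<^sup>\<dagger> ** \<xi> ** w) ** (w\<^sup>\<dagger> ** \<zeta> ** w) ** (w\<^sup>\<dagger> ** \<eta> ** w)))"
    by (rule schouten_eq_trace) (auto simp: skew' \<xi> \<eta> \<zeta> skew_conj conj)
  also have "\<dots> = schouten f g h"
    by (simp add: tr schouten_eq_trace[OF \<xi> \<eta> \<zeta>])
  finally show ?thesis .
qed

section \<open>The affine Poisson structure on \<open>SU(n)\<close>\<close>

lemma r_tensor_apply: "r_tensor \<alpha> \<beta> = r_form \<alpha> \<beta>"
  by (simp add: r_tensor_def r_form_def blinfun.sum_left split_def wedge_apply)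

lemma ltrans_apply: "ltrans g P \<alpha> \<beta>
    = P (\<alpha> o\<^sub>L Blinfun (\<lambda>X. g ** X)) (\<beta> o\<^sub>L Blinfun (\<lambda>X. g ** X))"
  by (simp add: ltrans_def push_apply)

lemma rtrans_apply: "rtrans g P \<alpha> \<beta>
    = P (\<alpha> o\<^sub>L Blinfun (\<lambda>X. X ** g)) (\<beta> o\<^sub>L Blinfun (\<lambda>X. X ** g))"
  by (simp add: rtrans_def push_apply)

lemma blinfun_compose_mult [simp]:
  fixes g :: "'n::finite cmat"
  shows "blinfun_apply (\<alpha> o\<^sub>L Blinfun (\<lambda>X. g ** X)) = (\<lambda>X. \<alpha> (g ** X))"
    and "blinfun_apply (\<alpha> o\<^sub>L Blinfun (\<lambda>X. X ** g)) = (\<lambda>X. \<alpha> (X ** g))"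
  by (simp_all add: fun_eq_iff bounded_linear_Blinfun_apply mm.bounded_linear_right mm.bounded_linear_left)

lemma std_poisson_apply:
  "std_poisson u \<alpha> \<beta> = r_form (\<lambda>X. \<alpha> (u ** X)) (\<lambda>X. \<beta> (u ** X))
     - r_form (\<lambda>X. \<alpha> (X ** u)) (\<lambda>X. \<beta> (X ** u))"
  by (simp add: std_poisson_def blinfun.diff_left ltrans_apply rtrans_apply r_tensor_apply)

text \<open>Right translation by \<open>\<sigma>\<close> leaves the right invariant part of the
  standard structure as it is and only conjugates r in the left invariant part.\<close>

lemma right_translate_std_poisson_apply:
  assumes "\<sigma> \<in> SU"
  shows "right_translate \<sigma> std_poisson u \<alpha> \<beta>
    = r_form (\<lambda>X. \<alpha> (u ** \<sigma>\<^sup>\<dagger> ** X ** \<sigma>)) (\<lambda>X. \<beta> (u ** \<sigma>\<^sup>\<dagger> ** X ** \<sigma>))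
      - r_form (\<lambda>X. \<alpha> (X ** u)) (\<lambda>X. \<beta> (X ** u))"
proof -
  have "X ** (u ** \<sigma>\<^sup>\<dagger>) ** \<sigma> = X ** u" for X :: "'a cmat"
    by (simp add: matrix_mul_assoc[symmetric] SU_adjoint[OF assms])
  then show ?thesis
    by (simp add: right_translate_def matrix_inv_SU[OF assms] rtrans_apply std_poisson_apply)
qed

text \<open>For a left invariant minus a right invariant tensor, the terms translated by
  \<open>g\<close> on the left and by \<open>h\<close> on the right cancel among the three
  summands.\<close>

lemma affine_right_translate_std_poisson:
  assumes "\<sigma> \<in> SU"
  shows "affine_tensor (right_translate \<sigma> std_poisson)"
  unfolding affine_tensor_def
  by (intro ballI blinfun_eqI)
    (simp add: blinfun.add_left blinfun.diff_left ltrans_apply rtrans_apply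
      right_translate_std_poisson_apply[OF assms] matrix_mul_assoc)

text \<open>The linear vector fields whose wedge products add up to the affine Poisson tensor: the left
  invariant ones and, with a sign, the right invariant ones.\<close>

definition fieldA :: "'n::finite cmat \<Rightarrow> bool \<times> 'n \<times> 'n \<Rightarrow> 'n cmat \<Rightarrow> 'n cmat" where
  "fieldA \<sigma> = (\<lambda>(s, i, j) x. if s then x ** \<sigma>\<^sup>\<dagger> ** Xplus i j ** \<sigma> else Xplus j i ** x)"

definition fieldB :: "'n::finite cmat \<Rightarrow> bool \<times> 'n \<times> 'n \<Rightarrow> 'n cmat \<Rightarrow> 'n cmat" where
  "fieldB \<sigma> = (\<lambda>(s, i, j) x. if s then x ** \<sigma>\<^sup>\<dagger> ** Xminus i j ** \<sigma> else Xminus i j ** x)"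

definition field_ix :: "(bool \<times> 'n::linorder \<times> 'n) set" where
  "field_ix = {(s, i, j). i < j}"

lemma sum_field_ix:
  fixes h :: "bool \<times> 'n::{finite,linorder} \<times> 'n \<Rightarrow> 'a::comm_monoid_add"
  shows "sum h field_ix = (\<Sum>(i, j) | i < j. h (True, i, j)) + (\<Sum>(i, j) | i < j. h (False, i, j))"
proof -
  have "field_ix = UNIV \<times> {(i, j). (i::'n) < j}"
    by (auto simp: field_ix_def)
  then have "sum h field_ix = (\<Sum>s\<in>UNIV. \<Sum>p\<in>{(i, j). i < j}. h (s, p))"
    by (simp add: sum.cartesian_product)
  then show ?thesis
    by (simp add: UNIV_bool add.commute split_def)
qed

text \<open>The transposed indices in \<open>fieldA\<close> carry the minus sign of the right
  invariant part; reversing them exhibits it.\<close>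

lemma Xplus_swap: "Xplus j i = - Xplus i j"
  by (simp add: Xplus_def)

lemma bounded_linear_fields:
  fixes \<sigma> :: "'n::finite cmat"
  shows "bounded_linear (fieldA \<sigma> p)" "bounded_linear (fieldB \<sigma> p)"
proof -
  have "bounded_linear (\<lambda>x :: 'n cmat. x ** \<sigma>\<^sup>\<dagger> ** X ** \<sigma>)" for X
    by (rule bounded_linear_compose[OF mm.bounded_linear_left
          bounded_linear_compose[OF mm.bounded_linear_left mm.bounded_linear_left]])
  moreover obtain s i j where "p = (s, i, j)" by (cases p)
  ultimately show "bounded_linear (fieldA \<sigma> p)" "bounded_linear (fieldB \<sigma> p)"
    by (cases s; simp add: fieldA_def fieldB_def mm.bounded_linear_right)+
qed

lemma fields_tangent:
  assumes "\<sigma> \<in> SU" "u \<in> SU" "p \<in> field_ix"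
  shows "fieldA \<sigma> p u \<in> curve_tangent SU u" "fieldB \<sigma> p u \<in> curve_tangent SU u"
proof -
  obtain s i j where p: "p = (s, i, j)" "i \<noteq> j"
    using assms(3) by (auto simp: field_ix_def)
  have L: "u ** \<sigma>\<^sup>\<dagger> ** X ** \<sigma> \<in> curve_tangent SU u" if "X \<in> su_gen" for X
    using su_gen_tangent[OF that SU_mult[OF assms(2) SU_adjoint_mem[OF assms(1)]] assms(1)]
    by (simp add: matrix_mul_assoc[symmetric] SU_adjoint[OF assms(1)])
  have R: "X ** u \<in> curve_tangent SU u" if "X \<in> su_gen" for X
    using su_gen_tangent[OF that SU_one assms(2)] by simp
  show "fieldA \<sigma> p u \<in> curve_tangent SU u" "fieldB \<sigma> p u \<in> curve_tangent SU u"
    using p by (auto simp: fieldA_def fieldB_def intro!: L R su_gen.intros)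
qed

lemma right_translate_std_poisson_lin_bivec:
  assumes "\<sigma> \<in> SU"
  shows "right_translate \<sigma> std_poisson u \<alpha> \<beta> = lin_bivec field_ix (fieldA \<sigma>) (fieldB \<sigma>) u \<alpha> \<beta>"
proof -
  have swap: "\<delta> (Xplus j i ** u) = - \<delta> (Xplus i j ** u)" for i j :: 'a and \<delta> :: "'a cmat \<Rightarrow>\<^sub>L real"
    by (simp add: Xplus_swap[of j i] mm.minus_left blinfun.minus_right)
  show ?thesis
    unfolding right_translate_std_poisson_apply[OF assms] lin_bivec_def sum_field_ix fieldA_def
      fieldB_def r_form_def
    by (simp add: split_def swap[of _ "snd _" "fst _"] sum_subtractf sum_negf sum.distrib)
qed

section \<open>The bracket of functions on SU(n) and its Jacobi identity\<close>

definition bracket ::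
  "'n::{finite,linorder} cmat \<Rightarrow> ('n cmat \<Rightarrow> real) \<Rightarrow> ('n cmat \<Rightarrow> real) \<Rightarrow> 'n cmat \<Rightarrow> real" where
  "bracket \<sigma> F G u = right_translate \<sigma> std_poisson u (differential SU u F) (differential SU u G)"

lemma bracket_eq_sum:
  assumes "\<sigma> \<in> SU"
  shows "bracket \<sigma> F G u = (\<Sum>p\<in>field_ix.
      differential SU u F (fieldA \<sigma> p u) * differential SU u G (fieldB \<sigma> p u)
      - differential SU u F (fieldB \<sigma> p u) * differential SU u G (fieldA \<sigma> p u))"
  by (simp add: bracket_def right_translate_std_poisson_lin_bivec[OF assms] lin_bivec_def)

text \<open>Since the fields are tangent to \<open>SU\<close>, any smooth extensions of
  \<open>F\<close> and \<open>G\<close> give the same bracket. This replaces the covectors chosen by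
  \<open>differential\<close> with genuine derivatives on an open set.\<close>

lemma bracket_local:
  assumes "\<sigma> \<in> SU" "open U" "u \<in> U" "u \<in> SU"
    and F: "\<And>k. Ck_on k U F'" "\<And>x. x \<in> U \<inter> SU \<Longrightarrow> F' x = F x"
    and G: "\<And>k. Ck_on k U G'" "\<And>x. x \<in> U \<inter> SU \<Longrightarrow> G' x = G x"
  shows "bracket \<sigma> F G u = lin_bivec field_ix (fieldA \<sigma>) (fieldB \<sigma>) u
    (frechet_derivative F' (at u)) (frechet_derivative G' (at u))"
proof -
  have "differential SU u F Z = frechet_derivative F' (at u) Z"
    "differential SU u G Z = frechet_derivative G' (at u) Z" if "Z \<in> curve_tangent SU u" for Z
    using differential_eq[OF smooth_fun_has_derivative[OF assms(2-4) F] that]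
      differential_eq[OF smooth_fun_has_derivative[OF assms(2-4) G] that] by auto
  then show ?thesis
    unfolding bracket_eq_sum[OF assms(1)] lin_bivec_def
    by (intro sum.cong refl) (simp add: fields_tangent[OF assms(1,4)])
qed

lemma Ck_on_dir_deriv_linear_field:
  fixes G :: "'a::euclidean_space \<Rightarrow> real"
  assumes "open U" "Ck_on (Suc k) U G" "bounded_linear A"
  shows "Ck_on k U (\<lambda>y. dir_deriv (A y) G y)"
proof (rule Ck_on_cong[OF assms(1)])
  have "bounded_linear (\<lambda>y. A y \<bullet> b)" for b
    by (rule bounded_linear_compose[OF bounded_linear_inner_left assms(3)])
  then show "Ck_on k U (\<lambda>y. \<Sum>b\<in>Basis. (A y \<bullet> b) * dir_deriv b G y)"
    using assms(2) by (intro Ck_on_sum Ck_on_mult assms(1)) (auto intro: Ck_on_bounded_linear)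
  show "(\<Sum>b\<in>Basis. (A y \<bullet> b) * dir_deriv b G y) = dir_deriv (A y) G y" if "y \<in> U" for y
  proof -
    have lin: "linear (frechet_derivative G (at y))"
      using assms(2) that by (intro frechet_derivative_linear) simp
    show ?thesis
      using linear_sum[OF lin, of "\<lambda>b. (A y \<bullet> b) *\<^sub>R b" Basis]
      by (simp add: linear_cmul[OF lin] euclidean_representation)
  qed
qed

lemma Ck_on_lin_bivec:
  fixes F G :: "'n::{finite,linorder} cmat \<Rightarrow> real"
  assumes "open U" "\<And>k. Ck_on k U F" "\<And>k. Ck_on k U G"
  shows "Ck_on k U (\<lambda>y. lin_bivec field_ix (fieldA \<sigma>) (fieldB \<sigma>) y
    (frechet_derivative F (at y)) (frechet_derivative G (at y)))"
  unfolding lin_bivec_def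
  by (intro Ck_on_sum Ck_on_diff Ck_on_mult Ck_on_dir_deriv_linear_field assms bounded_linear_fields)

lemma smooth_bracket:
  assumes "\<sigma> \<in> SU" "smooth_fun SU F" "smooth_fun SU G"
  shows "smooth_fun SU (bracket \<sigma> F G)"
  unfolding smooth_fun_def
proof
  fix p :: "'a cmat" assume p: "p \<in> SU"
  obtain U F' where F: "open U" "p \<in> U" "\<And>k. Ck_on k U F'" "\<And>x. x \<in> U \<inter> SU \<Longrightarrow> F' x = F x"
    using assms(2) p unfolding smooth_fun_def by metis
  obtain V G' where G: "open V" "p \<in> V" "\<And>k. Ck_on k V G'" "\<And>x. x \<in> V \<inter> SU \<Longrightarrow> G' x = G x"
    using assms(3) p unfolding smooth_fun_def by metis
  let ?W = "U \<inter> V"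
  let ?h = "\<lambda>y. lin_bivec field_ix (fieldA \<sigma>) (fieldB \<sigma>) y
    (frechet_derivative F' (at y)) (frechet_derivative G' (at y))"
  have W: "open ?W" "p \<in> ?W" using F G by auto
  have C: "Ck_on k ?W F'" "Ck_on k ?W G'" for k
    using Ck_on_subset[OF F(3)] Ck_on_subset[OF G(3)] by auto
  show "\<exists>U g. open U \<and> p \<in> U \<and> (\<forall>k. Ck_on k U g) \<and> (\<forall>x\<in>U \<inter> SU. g x = bracket \<sigma> F G x)"
  proof (intro exI conjI allI ballI)
    show "Ck_on k ?W ?h" for k by (rule Ck_on_lin_bivec[OF W(1) C])
    fix x assume "x \<in> ?W \<inter> SU"
    then show "?h x = bracket \<sigma> F G x"
      using F(4) G(4) by (intro bracket_local[OF assms(1) W(1) _ _ C(1) _ C(2), symmetric]) auto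
  qed (use W in auto)
qed

lemma
  fixes w x \<sigma> :: "'n::finite cmat"
  assumes "linear \<alpha>"
  shows linear_left_field: "linear (\<lambda>X. \<alpha> (w ** X ** \<sigma>))"
    and linear_right_field: "linear (\<lambda>X. \<alpha> (X ** x))"
  using assms by (simp_all add: linear_iff mm.add_left mm.add_right mm.scaleR_left mm.scaleR_right)

lemma lin_bivec_sharp_fields:
  assumes "linear \<alpha>"
  shows "lin_bivec_sharp field_ix (fieldA \<sigma>) (fieldB \<sigma>) x \<alpha>
    = x ** \<sigma>\<^sup>\<dagger> ** r_sharp (\<lambda>X. \<alpha> (x ** \<sigma>\<^sup>\<dagger> ** X ** \<sigma>)) ** \<sigma> - r_sharp (\<lambda>X. \<alpha> (X ** x)) ** x"
proof -
  have swap: "\<alpha> (Xplus j i ** y) = - \<alpha> (Xplus i j ** y)" "Xplus j i ** y = - (Xplus i j ** y)" for i j y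
    by (simp_all add: Xplus_swap[of j i] mm.minus_left linear_neg[OF assms])
  show ?thesis
    unfolding lin_bivec_sharp_def sum_field_ix fieldA_def fieldB_def r_sharp_def
    by (simp add: split_def mm.sum_left mm.sum_right mm.diff_left mm.diff_right mm.scaleR_left mm.scaleR_right
        swap[of "snd _" "fst _"] linear_neg[OF assms] sum_negf[symmetric] sum_subtractf sum.distrib)
qed

lemma lin_bivec_deriv_fields:
  assumes lin: "linear \<alpha>" "linear \<gamma>"
  shows "lin_bivec_deriv field_ix (fieldA \<sigma>) (fieldB \<sigma>) x \<alpha> \<gamma> Z
    = \<gamma> (Z ** \<sigma>\<^sup>\<dagger> ** r_sharp (\<lambda>X. \<alpha> (x ** \<sigma>\<^sup>\<dagger> ** X ** \<sigma>)) ** \<sigma>)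
      - \<alpha> (Z ** \<sigma>\<^sup>\<dagger> ** r_sharp (\<lambda>X. \<gamma> (x ** \<sigma>\<^sup>\<dagger> ** X ** \<sigma>)) ** \<sigma>)
      - \<gamma> (r_sharp (\<lambda>X. \<alpha> (X ** x)) ** Z) + \<alpha> (r_sharp (\<lambda>X. \<gamma> (X ** x)) ** Z)"
proof -
  let ?L = "\<lambda>y \<delta> X. \<delta> (y ** \<sigma>\<^sup>\<dagger> ** X ** \<sigma>)" and ?R = "\<lambda>y \<delta> X. \<delta> (X ** y)"
  have swap: "\<delta> (Xplus j i ** y) = - \<delta> (Xplus i j ** y)" if "linear \<delta>" for \<delta> :: "'a cmat \<Rightarrow> real" and i j y
    using that by (simp add: Xplus_swap[of j i] mm.minus_left linear_neg)
  \<comment> \<open>The fields are linear, so differentiating the tensor along \<open>Z\<close>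
    means replacing one of the two base points \<open>x\<close> by \<open>Z\<close>; each such term
    is an \<open>r_form\<close>.\<close>
  have "lin_bivec_deriv field_ix (fieldA \<sigma>) (fieldB \<sigma>) x \<alpha> \<gamma> Z
      = r_form (?L x \<alpha>) (?L Z \<gamma>) + r_form (?L Z \<alpha>) (?L x \<gamma>)
        - r_form (?R x \<alpha>) (?R Z \<gamma>) - r_form (?R Z \<alpha>) (?R x \<gamma>)"
    unfolding lin_bivec_deriv_def sum_field_ix fieldA_def fieldB_def r_form_def
    by (simp add: split_def swap[OF lin(1), of "snd _" "fst _"] swap[OF lin(2), of "snd _" "fst _"]
        sum.distrib[symmetric] sum_subtractf[symmetric])
      (simp add: algebra_simps)
  also have "r_form (?L x \<alpha>) (?L Z \<gamma>) = ?L Z \<gamma> (r_sharp (?L x \<alpha>))"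
    by (rule r_form_sharp) (rule linear_left_field[OF lin(2)])
  also have "r_form (?L Z \<alpha>) (?L x \<gamma>) = - ?L Z \<alpha> (r_sharp (?L x \<gamma>))"
    by (subst r_form_antisym, subst r_form_sharp) (auto intro: linear_left_field[OF lin(1)])
  also have "r_form (?R x \<alpha>) (?R Z \<gamma>) = ?R Z \<gamma> (r_sharp (?R x \<alpha>))"
    by (rule r_form_sharp) (rule linear_right_field[OF lin(2)])
  also have "r_form (?R Z \<alpha>) (?R x \<gamma>) = - ?R Z \<alpha> (r_sharp (?R x \<gamma>))"
    by (subst r_form_antisym, subst r_form_sharp) (auto intro: linear_right_field[OF lin(1)])
  finally show ?thesis by simp
qed

text \<open>The left and right parts are the contractions of \<open>[r, r]\<close> with two conjugate triples of covectors,
  with opposite signs.\<close>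

lemma lin_bivec_deriv_fields_cyclic:
  fixes \<alpha> \<beta> \<gamma> :: "'n::{finite,linorder} cmat \<Rightarrow> real"
  assumes \<sigma>: "\<sigma> \<in> SU" and x: "x \<in> SU" and lin: "linear \<alpha>" "linear \<beta>" "linear \<gamma>"
  defines "Q \<equiv> \<lambda>f g h. lin_bivec_deriv field_ix (fieldA \<sigma>) (fieldB \<sigma>) x g h
    (lin_bivec_sharp field_ix (fieldA \<sigma>) (fieldB \<sigma>) x f)"
  shows "Q \<beta> \<alpha> \<gamma> + Q \<alpha> \<gamma> \<beta> + Q \<gamma> \<beta> \<alpha> = 0"
proof -
  let ?w = "x ** \<sigma>\<^sup>\<dagger>"
  let ?L = "\<lambda>\<delta> X. \<delta> (?w ** X ** \<sigma>)" and ?R = "\<lambda>\<delta> X. \<delta> (X ** x)"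
  let ?l = "\<lambda>\<delta>. r_sharp (?L \<delta>)" and ?r = "\<lambda>\<delta>. r_sharp (?R \<delta>)"
  \<comment> \<open>Terms containing both \<open>?l\<close> and \<open>?r\<close> are the mixed
    ones. In the cyclic sum each appears twice with opposite signs, and the pure terms assemble into
    the two contractions of \<open>schouten\<close>.\<close>
  have Q: "Q f g h = ?L h (?l f ** ?l g) - h (?r f ** ?w ** ?l g ** \<sigma>)
      - ?L g (?l f ** ?l h) + g (?r f ** ?w ** ?l h ** \<sigma>)
      - h (?r g ** ?w ** ?l f ** \<sigma>) + ?R h (?r g ** ?r f)
      + g (?r h ** ?w ** ?l f ** \<sigma>) - ?R g (?r h ** ?r f)"
    if l: "linear f" "linear g" "linear h" for f g h
  proof -
    let ?Z = "?w ** ?l f ** \<sigma> - ?r f ** x"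
    have 1: "?Z ** \<sigma>\<^sup>\<dagger> ** B ** \<sigma> = ?w ** (?l f ** B) ** \<sigma> - ?r f ** ?w ** B ** \<sigma>" for B :: "'n cmat"
      by (simp add: mm.diff_left matrix_mul_assoc[symmetric] SU_cancel[OF \<sigma>])
    have 2: "B ** ?Z = B ** ?w ** ?l f ** \<sigma> - B ** ?r f ** x" for B :: "'n cmat"
      by (simp add: mm.diff_right matrix_mul_assoc)
    show ?thesis
      unfolding Q_def lin_bivec_sharp_fields[OF l(1)] lin_bivec_deriv_fields[OF l(2,3)] 1 2
      by (simp add: linear_diff[OF l(2)] linear_diff[OF l(3)])
  qed
  have w: "?w \<in> SU" using SU_mult[OF x SU_adjoint_mem[OF \<sigma>]] .
  \<comment> \<open>By this identity the left covectors are the right ones conjugated by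
    \<open>?w\<close>, which is the situation of \<open>schouten_conj\<close>.\<close>
  have "?w\<^sup>\<dagger> ** x = \<sigma>"
    by (simp add: adjoint_mult matrix_mul_assoc[symmetric] SU_adjoint[OF x])
  then have RL: "(\<lambda>X. ?R \<delta> (?w ** X ** ?w\<^sup>\<dagger>)) = ?L \<delta>" for \<delta> :: "'n cmat \<Rightarrow> real"
    by (simp add: matrix_mul_assoc[symmetric])
  have eq: "schouten (?L \<alpha>) (?L \<beta>) (?L \<gamma>) = schouten (?R \<alpha>) (?R \<beta>) (?R \<gamma>)"
    using schouten_conj[OF w linear_right_field[OF lin(1)] linear_right_field[OF lin(2)]
        linear_right_field[OF lin(3)], of x x x] unfolding RL .
  have d: "f (M - N) = f M - f N" if "linear f" for f :: "'n cmat \<Rightarrow> real" and M N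
    using linear_diff[OF that] .
  have "schouten (?L \<alpha>) (?L \<beta>) (?L \<gamma>) =
      ?L \<alpha> (?l \<beta> ** ?l \<gamma>) - ?L \<alpha> (?l \<gamma> ** ?l \<beta>) + (?L \<beta> (?l \<gamma> ** ?l \<alpha>) - ?L \<beta> (?l \<alpha> ** ?l \<gamma>))
      + (?L \<gamma> (?l \<alpha> ** ?l \<beta>) - ?L \<gamma> (?l \<beta> ** ?l \<alpha>))"
    unfolding schouten_def lin[THEN linear_left_field, THEN d] ..
  moreover have "schouten (?R \<alpha>) (?R \<beta>) (?R \<gamma>) =
      ?R \<alpha> (?r \<beta> ** ?r \<gamma>) - ?R \<alpha> (?r \<gamma> ** ?r \<beta>) + (?R \<beta> (?r \<gamma> ** ?r \<alpha>) - ?R \<beta> (?r \<alpha> ** ?r \<gamma>))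
      + (?R \<gamma> (?r \<alpha> ** ?r \<beta>) - ?R \<gamma> (?r \<beta> ** ?r \<alpha>))"
    unfolding schouten_def lin[THEN linear_right_field, THEN d] ..
  ultimately show ?thesis
    unfolding Q[OF lin(2,1,3)] Q[OF lin(1,3,2)] Q[OF lin(3,2,1)] using eq by linarith
qed

lemma jacobi_bracket:
  fixes F G H :: "'n::{finite,linorder} cmat \<Rightarrow> real"
  assumes \<sigma>: "\<sigma> \<in> SU" and FGH: "smooth_fun SU F" "smooth_fun SU G" "smooth_fun SU H" and u: "u \<in> SU"
  shows "bracket \<sigma> F (bracket \<sigma> G H) u + bracket \<sigma> G (bracket \<sigma> H F) u
    + bracket \<sigma> H (bracket \<sigma> F G) u = 0"
proof -
  obtain U1 F' where F: "open U1" "u \<in> U1" "\<And>k. Ck_on k U1 F'" "\<And>x. x \<in> U1 \<inter> SU \<Longrightarrow> F' x = F x"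
    using FGH(1) u unfolding smooth_fun_def by metis
  obtain U2 G' where G: "open U2" "u \<in> U2" "\<And>k. Ck_on k U2 G'" "\<And>x. x \<in> U2 \<inter> SU \<Longrightarrow> G' x = G x"
    using FGH(2) u unfolding smooth_fun_def by metis
  obtain U3 H' where H: "open U3" "u \<in> U3" "\<And>k. Ck_on k U3 H'" "\<And>x. x \<in> U3 \<inter> SU \<Longrightarrow> H' x = H x"
    using FGH(3) u unfolding smooth_fun_def by metis
  define U where "U = U1 \<inter> U2 \<inter> U3"
  have U: "open U" "u \<in> U" using F G H by (auto simp: U_def)
  have C: "Ck_on k U F'" "Ck_on k U G'" "Ck_on k U H'" for k
    by (rule Ck_on_subset[OF F(3)] Ck_on_subset[OF G(3)] Ck_on_subset[OF H(3)]; auto simp: U_def)+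
  have E: "x \<in> U \<inter> SU \<Longrightarrow> F' x = F x" "x \<in> U \<inter> SU \<Longrightarrow> G' x = G x" "x \<in> U \<inter> SU \<Longrightarrow> H' x = H x" for x
    using F(4) G(4) H(4) by (auto simp: U_def)
  let ?br = "\<lambda>f g y. lin_bivec field_ix (fieldA \<sigma>) (fieldB \<sigma>) y
    (frechet_derivative f (at y)) (frechet_derivative g (at y))"
  \<comment> \<open>The inner bracket has an extension to \<open>U\<close> of the same kind as the
    functions, so localisation applies a second time, to the outer bracket.\<close>
  have nest: "bracket \<sigma> f (bracket \<sigma> g h) u = ?br f' (?br g' h') u"
    if fgh: "\<And>k. Ck_on k U f'" "\<And>x. x \<in> U \<inter> SU \<Longrightarrow> f' x = f x"
      "\<And>k. Ck_on k U g'" "\<And>x. x \<in> U \<inter> SU \<Longrightarrow> g' x = g x"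
      "\<And>k. Ck_on k U h'" "\<And>x. x \<in> U \<inter> SU \<Longrightarrow> h' x = h x" for f f' g g' h h'
  proof (rule bracket_local[OF \<sigma> U u fgh(1,2)])
    show "Ck_on k U (?br g' h')" for k
      by (rule Ck_on_lin_bivec[OF U(1) fgh(3,5)])
    show "?br g' h' x = bracket \<sigma> g h x" if x: "x \<in> U \<inter> SU" for x
      using x fgh(4,6) by (intro bracket_local[OF \<sigma> U(1) _ _ fgh(3) _ fgh(5), symmetric]) auto
  qed
  have lin: "linear (frechet_derivative F' (at u))" "linear (frechet_derivative G' (at u))"
    "linear (frechet_derivative H' (at u))"
    using C[of "Suc 0"] U(2) by (auto intro!: frechet_derivative_linear)
  have "bracket \<sigma> F (bracket \<sigma> G H) u = ?br F' (?br G' H') u"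
    "bracket \<sigma> G (bracket \<sigma> H F) u = ?br G' (?br H' F') u"
    "bracket \<sigma> H (bracket \<sigma> F G) u = ?br H' (?br F' G') u"
    by (rule nest[OF C(1) _ C(2) _ C(3)] nest[OF C(2) _ C(3) _ C(1)] nest[OF C(3) _ C(1) _ C(2)];
        erule E)+
  then show ?thesis
    using lin_bivec_deriv_fields_cyclic[OF \<sigma> u lin(2,1,3)]
      jacobi_lin_bivec[where I = field_ix and A = "fieldA \<sigma>" and B = "fieldB \<sigma>",
        OF C(1) C(2) C(3) U bounded_linear_fields]
    by simp
qed

section \<open>Covariance, bivectors and smoothness of translations\<close>

lemma r_form_cong:
  assumes "\<And>i j. i < j \<Longrightarrow> \<alpha> (Xplus i j) = \<alpha>' (Xplus i j) \<and> \<alpha> (Xminus i j) = \<alpha>' (Xminus i j)"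
    and "\<And>i j. i < j \<Longrightarrow> \<beta> (Xplus i j) = \<beta>' (Xplus i j) \<and> \<beta> (Xminus i j) = \<beta>' (Xminus i j)"
  shows "r_form \<alpha> \<beta> = r_form \<alpha>' \<beta>'"
  unfolding r_form_def using assms by (intro sum.cong) auto

text \<open>Pushed to \<open>g ** p\<close>, the tensor of the first factor contributes r translated
  by \<open>g\<close> on the left and \<open>p\<close> on the right, and so does the right invariant
  part of the second factor, with the opposite sign. What remains is the affine tensor at
  \<open>g ** p\<close>.\<close>

lemma bracket_covariant:
  fixes F G :: "'n::{finite,linorder} cmat \<Rightarrow> real"
  assumes \<sigma>: "\<sigma> \<in> SU" and FG: "smooth_fun SU F" "smooth_fun SU G" and g: "g \<in> SU" and p: "p \<in> SU"
  shows "std_poisson g (differential SU g (\<lambda>x. F (x ** p))) (differential SU g (\<lambda>x. G (x ** p)))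
    + bracket \<sigma> (\<lambda>y. F (g ** y)) (\<lambda>y. G (g ** y)) p = bracket \<sigma> F G (g ** p)"
proof -
  have dR: "differential SU g (\<lambda>x. K (x ** p)) Z = differential SU (g ** p) K (Z ** p)"
    if "smooth_fun SU K" "Z \<in> curve_tangent SU g" for K Z
    using SU_mult[OF _ p] that g bounded_linear_imp_has_derivative[OF mm.bounded_linear_left]
    by (intro differential_compose) auto
  have dL: "differential SU p (\<lambda>y. K (g ** y)) Z = differential SU (g ** p) K (g ** Z)"
    if "smooth_fun SU K" "Z \<in> curve_tangent SU p" for K Z
    using SU_mult[OF g] that p bounded_linear_imp_has_derivative[OF mm.bounded_linear_right]
    by (intro differential_compose) auto
  have t: "u ** X \<in> curve_tangent SU u" "X ** u \<in> curve_tangent SU u"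
    "u ** \<sigma>\<^sup>\<dagger> ** X ** \<sigma> \<in> curve_tangent SU u" if "X \<in> su_gen" "u \<in> SU" for X u
    using su_gen_tangent[OF that SU_one] su_gen_tangent[OF that(1) SU_one that(2)]
      su_gen_tangent[OF that(1) SU_mult[OF that(2) SU_adjoint_mem[OF \<sigma>]] \<sigma>]
    by (simp_all add: matrix_mul_assoc[symmetric] SU_adjoint[OF \<sigma>])
  have gen: "Xplus i j \<in> su_gen" "Xminus i j \<in> su_gen" if "i < j" for i j :: 'n
    using that by (auto intro: su_gen.intros)
  let ?F = "differential SU (g ** p) F" and ?G = "differential SU (g ** p) G"
  note d = dR[OF FG(1)] dR[OF FG(2)] dL[OF FG(1)] dL[OF FG(2)]
  \<comment> \<open>\<open>r_form\<close> evaluates covectors on generators only; there all vectors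
    are tangent to \<open>SU\<close>, so the chain rules \<open>d\<close> may be
    substituted.\<close>
  have "std_poisson g (differential SU g (\<lambda>x. F (x ** p))) (differential SU g (\<lambda>x. G (x ** p)))
      = r_form (\<lambda>X. ?F (g ** X ** p)) (\<lambda>X. ?G (g ** X ** p))
        - r_form (\<lambda>X. ?F (X ** g ** p)) (\<lambda>X. ?G (X ** g ** p))"
    unfolding std_poisson_apply
    by (intro arg_cong2[where f = minus] r_form_cong) (simp_all add: d t gen g)
  moreover have "bracket \<sigma> (\<lambda>y. F (g ** y)) (\<lambda>y. G (g ** y)) p
      = r_form (\<lambda>X. ?F (g ** (p ** \<sigma>\<^sup>\<dagger> ** X ** \<sigma>))) (\<lambda>X. ?G (g ** (p ** \<sigma>\<^sup>\<dagger> ** X ** \<sigma>)))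
        - r_form (\<lambda>X. ?F (g ** (X ** p))) (\<lambda>X. ?G (g ** (X ** p)))"
    unfolding bracket_def right_translate_std_poisson_apply[OF \<sigma>]
    by (intro arg_cong2[where f = minus] r_form_cong) (simp_all add: d t gen p)
  ultimately show ?thesis
    by (simp add: bracket_def right_translate_std_poisson_apply[OF \<sigma>] matrix_mul_assoc)
qed

lemma bivector_at_bracket:
  assumes "\<sigma> \<in> SU" "u \<in> SU"
    and "\<And>f g. f \<in> smooth_funs SU q \<Longrightarrow> g \<in> smooth_funs SU q \<Longrightarrow> P f g = bracket \<sigma> (f \<circ> q) (g \<circ> q) u"
  shows "bivector_at (smooth_funs SU q) (q u) P"
proof (rule bivector_at_sum)
  show "finite (field_ix :: (bool \<times> 'a \<times> 'a) set)" by simp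
  show "tangent_vector (smooth_funs SU q) (q u) (\<lambda>f. differential SU u (f \<circ> q) (fieldA \<sigma> p u)) \<and>
      tangent_vector (smooth_funs SU q) (q u) (\<lambda>f. differential SU u (f \<circ> q) (fieldB \<sigma> p u))"
    if "p \<in> field_ix" for p
    using fields_tangent[OF assms(1,2) that] tangent_vector_differential[OF assms(2)] by blast
  show "P f g = (\<Sum>p\<in>field_ix.
      differential SU u (f \<circ> q) (fieldA \<sigma> p u) * differential SU u (g \<circ> q) (fieldB \<sigma> p u)
      - differential SU u (f \<circ> q) (fieldB \<sigma> p u) * differential SU u (g \<circ> q) (fieldA \<sigma> p u))"
    if "f \<in> smooth_funs SU q" "g \<in> smooth_funs SU q" for f g
    using assms(3)[OF that] bracket_eq_sum[OF assms(1)] by simp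
qed

lemma smooth_fun_left_translate:
  assumes "smooth_fun SU F" "g \<in> SU"
  shows "smooth_fun SU (\<lambda>y. F (g ** y))"
  using assms SU_mult[OF assms(2)]
  by (intro smooth_fun_compose[OF assms(1)] Ck_on_bounded_linear
      bounded_linear_compose[OF bounded_linear_inner_left mm.bounded_linear_right]) auto

lemma smooth_fun_mult:
  fixes F :: "'n::finite cmat \<Rightarrow> real"
  assumes "smooth_fun SU F"
  shows "smooth_fun (SU \<times> SU) (\<lambda>x. F (fst x ** snd x))"
proof (rule smooth_fun_compose[OF assms])
  show "(\<lambda>x. fst x ** snd x) ` (SU \<times> SU) \<subseteq> SU"
    by (auto intro: SU_mult)
  fix k and b :: "'n cmat" assume "b \<in> Basis"
  have coord: "Ck_on k UNIV (\<lambda>x. f (c x))" if "bounded_linear f" "bounded_linear c"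
    for c :: "'n cmat \<times> 'n cmat \<Rightarrow> 'n cmat" and f :: "'n cmat \<Rightarrow> real"
    by (rule Ck_on_bounded_linear[OF bounded_linear_compose[OF that]])
  \<comment> \<open>Bilinearity makes each coordinate of the product a polynomial in the coordinates
    of the factors.\<close>
  have expand: "(fst x ** snd x) \<bullet> b
      = (\<Sum>a\<in>Basis. \<Sum>a'\<in>Basis. (fst x \<bullet> a) * (snd x \<bullet> a') * ((a ** a') \<bullet> b))" for x :: "'n cmat \<times> 'n cmat"
  proof -
    have "fst x ** snd x = (\<Sum>a\<in>Basis. (fst x \<bullet> a) *\<^sub>R a) ** (\<Sum>a'\<in>Basis. (snd x \<bullet> a') *\<^sub>R a')"
      by (simp add: euclidean_representation)
    also have "\<dots> = (\<Sum>a\<in>Basis. \<Sum>a'\<in>Basis. ((fst x \<bullet> a) * (snd x \<bullet> a')) *\<^sub>R (a ** a'))"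
      by (subst mm.sum_left, subst mm.sum_right)
        (simp only: mm.scaleR_left mm.scaleR_right scaleR_scaleR mult.commute)
    finally show ?thesis
      by (simp only: inner_sum_left inner_scaleR_left)
  qed
  show "Ck_on k UNIV (\<lambda>x :: 'n cmat \<times> 'n cmat. (fst x ** snd x) \<bullet> b)"
    proof (rule Ck_on_cong[OF open_UNIV expand[symmetric]], intro Ck_on_sum Ck_on_mult Ck_on_const open_UNIV)
    fix a a' :: "'n cmat"
    show "Ck_on k UNIV (\<lambda>x :: 'n cmat \<times> 'n cmat. fst x \<bullet> a)"
      by (rule coord[OF bounded_linear_inner_left bounded_linear_fst])
    show "Ck_on k UNIV (\<lambda>x :: 'n cmat \<times> 'n cmat. snd x \<bullet> a')"
      by (rule coord[OF bounded_linear_inner_left bounded_linear_snd])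
  qed
qed

section \<open>The subgroup \<open>U(n - 1)\<close>\<close>

text \<open>The same linear condition cuts U(n - 1) out of \<open>SU\<close> and its Lie algebra out
  of the traceless skew-Hermitian matrices, so one predicate serves both.\<close>

definition block :: "'n::{finite,linorder} cmat \<Rightarrow> bool" where
  "block X \<longleftrightarrow> (\<forall>j. j \<noteq> ix1 \<longrightarrow> X $ ix1 $ j = 0 \<and> X $ j $ ix1 = 0)"

lemma block_simps:
  "block (mat 1)" "block X \<Longrightarrow> block Y \<Longrightarrow> block (X + Y)" "block X \<Longrightarrow> block (a *\<^sub>R X)"
  "block X \<Longrightarrow> block (X\<^sup>\<dagger>)"
  by (auto simp: block_def mat_def)

lemma block_mult_row:
  fixes X Y :: "'n::{finite,linorder} cmat"
  assumes X: "block X"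
  shows "(X ** Y) $ ix1 $ j = X $ ix1 $ ix1 * Y $ ix1 $ j"
proof -
  have "(X ** Y) $ ix1 $ j = (\<Sum>k\<in>UNIV. X $ ix1 $ k * Y $ k $ j)"
    by (simp add: matrix_matrix_mult_def)
  also have "\<dots> = (\<Sum>k\<in>(UNIV :: 'n set). if k = ix1 then X $ ix1 $ ix1 * Y $ ix1 $ j else 0)"
    by (intro sum.cong refl) (use X in \<open>auto simp: block_def\<close>)
  finally show ?thesis by simp
qed

lemma block_mult_col:
  fixes X Y :: "'n::{finite,linorder} cmat"
  assumes Y: "block Y"
  shows "(X ** Y) $ j $ ix1 = X $ j $ ix1 * Y $ ix1 $ ix1"
proof -
  have "(X ** Y) $ j $ ix1 = (\<Sum>k\<in>UNIV. X $ j $ k * Y $ k $ ix1)"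
    by (simp add: matrix_matrix_mult_def)
  also have "\<dots> = (\<Sum>k\<in>(UNIV :: 'n set). if k = ix1 then X $ j $ ix1 * Y $ ix1 $ ix1 else 0)"
    by (intro sum.cong refl) (use Y in \<open>auto simp: block_def\<close>)
  finally show ?thesis by simp
qed

lemma block_mult:
  assumes "block X" "block Y"
  shows "block (X ** Y)"
  unfolding block_def using assms by (simp add: block_mult_row block_mult_col) (simp add: block_def)

lemma block_corner_unit:
  assumes "unitary u" "block u"
  shows "cnj (u $ ix1 $ ix1) * u $ ix1 $ ix1 = 1"
proof -
  have "(u\<^sup>\<dagger> ** u) $ ix1 $ ix1 = 1"
    using assms(1) by (simp add: unitary_iff mat_def)
  then show ?thesis
    by (simp add: block_mult_col[OF assms(2)])
qed

text \<open>In a block matrix the corner enters the Gram matrix only through its modulus, which is 1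
  before and after the change.\<close>

lemma unitary_change_corner:
  assumes u: "unitary u" "block u" and M: "\<And>i j. i \<noteq> ix1 \<or> j \<noteq> ix1 \<Longrightarrow> M $ i $ j = u $ i $ j"
    and d: "cnj (M $ ix1 $ ix1) * M $ ix1 $ ix1 = 1"
  shows "unitary M"
proof -
  have "cnj (M $ k $ i) * M $ k $ j = cnj (u $ k $ i) * u $ k $ j" for i j k
  proof (cases "k = ix1")
    case False
    then show ?thesis by (simp add: M)
  next
    case True
    have off: "u $ ix1 $ l = 0" "M $ ix1 $ l = 0" if "l \<noteq> ix1" for l
      using u(2) M[of ix1 l] that by (auto simp: block_def)
    show ?thesis
      using d block_corner_unit[OF u] True off
      by (cases "i = ix1"; cases "j = ix1") auto
  qed
  then have "M\<^sup>\<dagger> ** M = u\<^sup>\<dagger> ** u"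
    by (simp add: matrix_matrix_mult_def vec_eq_iff)
  with u(1) show ?thesis by (simp add: unitary_iff)
qed

text \<open>The first row of a block matrix consists of the corner and zeros, so rescaling the
  corner rescales a whole row.\<close>

lemma det_change_corner:
  fixes u M :: "'n::{finite,linorder} cmat"
  assumes u: "block u" and M: "\<And>i j. i \<noteq> ix1 \<or> j \<noteq> ix1 \<Longrightarrow> M $ i $ j = u $ i $ j"
    and d: "M $ ix1 $ ix1 = d * u $ ix1 $ ix1"
  shows "det M = d * det u"
proof -
  have "M = (\<chi> i. if i = ix1 then d *s u $ i else u $ i)"
  proof (intro iffD2[OF vec_eq_iff] allI)
    fix i j
    show "M $ i $ j = (\<chi> i. if i = ix1 then d *s u $ i else u $ i) $ i $ j"
      using u M[of i j] d by (cases "i = ix1"; cases "j = ix1") (auto simp: block_def)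
  qed
  then have "det M = d * det (\<chi> i. if i = ix1 then u $ i else u $ i)"
    using det_row_mul[of ix1 d "\<lambda>i. u $ i" "\<lambda>i. u $ i"] by simp
  moreover have "(\<chi> i. if i = ix1 then u $ i else u $ i) = u"
    by (simp add: vec_eq_iff)
  ultimately show ?thesis by simp
qed

lemma U_sub_eq: "U_sub = {u \<in> SU. block u}"
proof (intro equalityI subsetI)
  fix M :: "'a cmat" assume "M \<in> U_sub"
  then obtain u where u: "unitary u" "u $ ix1 $ ix1 = 1" "block u"
    and M: "M = (\<chi> i j. if i = ix1 \<and> j = ix1 then inverse (det u) else u $ i $ j)"
    unfolding U_sub_def block_def by blast
  have det: "cnj (det u) * det u = 1"
    using arg_cong[OF u(1)[unfolded unitary_iff], of det] by (simp add: det_mul det_adjoint)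
  then have nz: "det u \<noteq> 0" by auto
  have off: "M $ i $ j = u $ i $ j" if "i \<noteq> ix1 \<or> j \<noteq> ix1" for i j
    using that by (auto simp: M)
  have corner: "M $ ix1 $ ix1 = inverse (det u)" by (simp add: M)
  have "cnj (inverse (det u)) * inverse (det u) = inverse (cnj (det u) * det u)"
    by (simp add: mult.commute)
  then have "unitary M"
    using unitary_change_corner[OF u(1,3) off] det by (simp add: corner)
  moreover have "det M = 1"
    using det_change_corner[OF u(3) off, of "inverse (det u)"] nz by (simp add: corner u(2))
  moreover have "block M"
    using u(3) off unfolding block_def by metis
  ultimately show "M \<in> {u \<in> SU. block u}" by (simp add: SU_def)
next
  fix u :: "'a cmat" assume "u \<in> {u \<in> SU. block u}"
  then have u: "unitary u" "det u = 1" "block u" by (auto simp: SU_def)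
  \<comment> \<open>Setting the corner to 1 recovers the parameter matrix of \<open>U_sub\<close>;
    the original corner is then forced to be the inverse of \<open>det v\<close>, because
    \<open>det u\<close> is 1.\<close>
  define v where "v = (\<chi> i j. if i = ix1 \<and> j = ix1 then 1 else u $ i $ j)"
  have off: "v $ i $ j = u $ i $ j" if "i \<noteq> ix1 \<or> j \<noteq> ix1" for i j
    using that by (auto simp: v_def)
  have corner: "v $ ix1 $ ix1 = 1" by (simp add: v_def)
  have v: "unitary v" "block v"
    using unitary_change_corner[OF u(1,3) off] u(3) off unfolding block_def by (auto simp: corner)
  have "det u = u $ ix1 $ ix1 * det v"
    using det_change_corner[OF v(2) off[symmetric], of "u $ ix1 $ ix1"] by (simp add: corner)
  then have "u $ ix1 $ ix1 = inverse (det v)"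
    using u(2) inverse_unique[of "det v" "u $ ix1 $ ix1"] by (simp add: mult.commute)
  then have "u = (\<chi> i j. if i = ix1 \<and> j = ix1 then inverse (det v) else v $ i $ j)"
    by (simp add: vec_eq_iff v_def)
  with v corner show "u \<in> U_sub"
    unfolding U_sub_def block_def by blast
qed

lemma closed_subgroup_U_sub: "closed_subgroup (U_sub :: 'n::{finite,linorder} cmat set) SU"
  unfolding closed_subgroup_def
proof (intro conjI ballI)
  have "closed {X :: 'n cmat. block X}"
    unfolding block_def
    by (intro closed_Collect_all closed_Collect_imp closed_Collect_conj closed_Collect_eq
        open_Collect_const continuous_intros)
  then show "closedin (top_of_set SU) (U_sub :: 'n cmat set)"
    unfolding U_sub_eq Collect_conj_eq Collect_mem_eq by (rule closedin_closed_Int)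
qed (auto simp: U_sub_eq SU_one SU_mult block_simps block_mult matrix_inv_SU SU_adjoint_mem)

section \<open>Generation of the Lie algebras\<close>

lemma su_gen_lie_algebra_SU: "X \<in> su_gen \<Longrightarrow> X \<in> lie_algebra SU"
  by (intro lie_algebraI_rot rot_su_gen_SU)

lemma su_gen_lie_algebra_U_sub: "X \<in> su_gen \<Longrightarrow> block X \<Longrightarrow> X \<in> lie_algebra U_sub"
  proof (rule lie_algebraI_rot)
  fix t assume "X \<in> su_gen" "block X"
  moreover from this have "block (rot X t)"
    by (simp add: rot_def block_simps block_mult)
  ultimately show "rot X t \<in> U_sub"
    by (simp add: U_sub_eq rot_su_gen_SU)
qed

text \<open>The sum runs over ordered pairs, so every unordered pair occurs twice, which explains
  1/2. The factor is also right on the diagonal, where \<open>Xplus i i\<close> vanishes and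
  \<open>Xminus i i\<close> has the entry 2i.\<close>

lemma skew_expand:
  fixes X :: "'n::finite cmat"
  assumes "skew X"
  shows "X = (\<Sum>i\<in>UNIV. \<Sum>j\<in>UNIV. (1/2) *\<^sub>R (Re (X $ i $ j) *\<^sub>R Xplus i j + Im (X $ i $ j) *\<^sub>R Xminus i j))"
proof (intro iffD2[OF vec_eq_iff] allI)
  fix k l
  let ?c = "\<lambda>i j. complex_of_real (Re (X $ i $ j)) / 2" and ?d = "\<lambda>i j. \<i> * complex_of_real (Im (X $ i $ j)) / 2"
  have delta: "(\<Sum>i\<in>UNIV. \<Sum>j\<in>UNIV. if k = i \<and> l = j then g i j else 0) = g k l"
    for g :: "'n \<Rightarrow> 'n \<Rightarrow> complex" and k l
  proof -
    have "(\<Sum>i\<in>UNIV. \<Sum>j\<in>UNIV. if k = i \<and> l = j then g i j else 0)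
        = (\<Sum>i\<in>UNIV. if i = k then (\<Sum>j\<in>UNIV. if j = l then g k l else 0) else 0)"
      by (intro sum.cong refl) (auto intro!: sum.cong)
    then show ?thesis by simp
  qed
  have delta': "(\<Sum>i\<in>UNIV. \<Sum>j\<in>UNIV. if k = j \<and> l = i then g i j else 0) = g l k" for g :: "'n \<Rightarrow> 'n \<Rightarrow> complex"
    unfolding conj_commute[of "k = _"] by (rule delta)
  have entry: "(1/2) *\<^sub>R (a *\<^sub>R ((if P then 1 else 0) - (if Q then 1 else 0))
        + b *\<^sub>R (\<i> * ((if P then 1 else 0) + (if Q then 1 else 0))))
      = (if P then complex_of_real a / 2 + \<i> * complex_of_real b / 2 else 0)
        + (if Q then - (complex_of_real a / 2) + \<i> * complex_of_real b / 2 else 0)" for a b P Q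
    by (cases P; cases Q; simp add: complex_eq_iff)
  have "(\<Sum>i\<in>UNIV. \<Sum>j\<in>UNIV. (1/2) *\<^sub>R (Re (X $ i $ j) *\<^sub>R Xplus i j + Im (X $ i $ j) *\<^sub>R Xminus i j)) $ k $ l
      = (\<Sum>i\<in>UNIV. \<Sum>j\<in>UNIV. (if k = i \<and> l = j then ?c i j + ?d i j else 0)
          + (if k = j \<and> l = i then - ?c i j + ?d i j else 0))"
    unfolding sum_component
    by (simp only: vector_scaleR_component vector_add_component Xplus_nth Xminus_nth entry)
  also have "\<dots> = (?c k l + ?d k l) + (- ?c l k + ?d l k)"
    by (simp only: sum.distrib delta delta')
  also have "\<dots> = X $ k $ l"
    using arg_cong[OF skew_nth[OF assms, of l k], of Re] arg_cong[OF skew_nth[OF assms, of l k], of Im]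
    by (simp add: complex_eq_iff)
  finally show "X $ k $ l = (\<Sum>i\<in>UNIV. \<Sum>j\<in>UNIV.
      (1/2) *\<^sub>R (Re (X $ i $ j) *\<^sub>R Xplus i j + Im (X $ i $ j) *\<^sub>R Xminus i j)) $ k $ l" ..
qed

text \<open>In the expansion of \<open>X\<close> the diagonal terms are corrected by multiples of \<open>e\<^sub>1\<^sub>1\<close>, whose sum
  vanishes with the trace.\<close>

lemma skew_traceless_in_span:
  fixes X :: "'n::{finite,linorder} cmat"
  assumes "skew X" "trace X = 0"
    and B: "\<And>i j. i \<noteq> j \<Longrightarrow> X $ i $ j \<noteq> 0 \<Longrightarrow> Xplus i j \<in> B \<and> Xminus i j \<in> B"
    and D: "\<And>i. i \<noteq> ix1 \<Longrightarrow> Hdiag i ix1 \<in> B"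
  shows "X \<in> span B"
proof -
  let ?t = "\<lambda>i j. (1/2) *\<^sub>R (Re (X $ i $ j) *\<^sub>R Xplus i j + Im (X $ i $ j) *\<^sub>R Xminus i j)"
  let ?e = "mat \<i> ** mat_unit ix1 ix1 :: 'n cmat"
  have "(\<Sum>i\<in>UNIV. \<Sum>j\<in>UNIV. (if j = i then Im (X $ i $ i) *\<^sub>R ?e else 0)) = (\<Sum>i\<in>UNIV. Im (X $ i $ i)) *\<^sub>R ?e"
    by (simp add: scaleR_sum_left)
  also have "\<dots> = 0"
    using arg_cong[OF assms(2), of Im] by (simp add: trace_def)
  finally have "X = (\<Sum>i\<in>UNIV. \<Sum>j\<in>UNIV. ?t i j) - (\<Sum>i\<in>UNIV. \<Sum>j\<in>UNIV. (if j = i then Im (X $ i $ i) *\<^sub>R ?e else 0))"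
    using skew_expand[OF assms(1)] by simp
  then have "X = (\<Sum>i\<in>UNIV. \<Sum>j\<in>UNIV. ?t i j - (if j = i then Im (X $ i $ i) *\<^sub>R ?e else 0))"
    by (simp only: sum_subtractf)
  moreover have "?t i j - (if j = i then Im (X $ i $ i) *\<^sub>R ?e else 0) \<in> span B" for i j
  proof (cases "j = i")
    case False
    show ?thesis
    proof (cases "X $ i $ j = 0")
      case True
      then show ?thesis using False by (simp add: span_zero)
    next
      case nz: False
      have "?t i j \<in> span B"
        using B[OF False[symmetric] nz] by (intro span_scale span_add span_base) auto
      then show ?thesis using False by simp
    qed
  next
    case True
    have "Xplus i i = 0" "Xminus i i = 2 *\<^sub>R (mat \<i> ** mat_unit i i)"
      unfolding Xplus_def Xminus_def scaleR_2[symmetric] mm.scaleR_right by simp_all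
    then have eq: "?t i i - Im (X $ i $ i) *\<^sub>R ?e = Im (X $ i $ i) *\<^sub>R Hdiag i ix1"
      by (simp add: Hdiag_def mm.diff_right scaleR_diff_right)
    show ?thesis
    proof (cases "i = ix1")
      case True
      then show ?thesis using eq \<open>j = i\<close> by (simp add: Hdiag_def span_zero)
    next
      case False
      have "Im (X $ i $ i) *\<^sub>R Hdiag i ix1 \<in> span B"
        by (intro span_scale span_base D[OF False])
      then show ?thesis using eq \<open>j = i\<close> by simp
    qed
  qed
  ultimately show ?thesis
    using span_sum by (metis (no_types, lifting))
qed

text \<open>Only generators are shown to be velocities of one-parameter subgroups; passing to the
  span costs nothing, since coisotropy concerns the span of wedge products.\<close>

lemma su_span:
  fixes X :: "'n::{finite,linorder} cmat"
  assumes "skew X" "trace X = 0"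
  shows "X \<in> span (lie_algebra SU)"
  using assms
  by (rule skew_traceless_in_span) (auto intro!: su_gen_lie_algebra_SU intro: su_gen.intros)

text \<open>The nonzero off-diagonal entries of a block matrix avoid the first row and column, so
  the off-diagonal generators in its expansion are themselves block, as every
  \<open>Hdiag i ix1\<close> is.\<close>

lemma su_span_block:
  fixes X :: "'n::{finite,linorder} cmat"
  assumes "skew X" "trace X = 0" "block X"
  shows "X \<in> span (lie_algebra U_sub)"
  using assms(1,2)
proof (rule skew_traceless_in_span)
  fix i j assume ij: "i \<noteq> j" "X $ i $ j \<noteq> 0"
  then have "i \<noteq> ix1" "j \<noteq> ix1"
    using assms(3) unfolding block_def by metis+
  then have "block (Xplus i j)" "block (Xminus i j)"
    by (auto simp: block_def Xplus_nth Xminus_nth)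
  then show "Xplus i j \<in> lie_algebra U_sub \<and> Xminus i j \<in> lie_algebra U_sub"
    using ij(1) by (auto intro!: su_gen_lie_algebra_U_sub intro: su_gen.intros)
next
  fix i :: 'n assume "i \<noteq> ix1"
  moreover have "block (Hdiag i ix1)"
    using \<open>i \<noteq> ix1\<close> by (auto simp: block_def Hdiag_nth)
  ultimately show "Hdiag i ix1 \<in> lie_algebra U_sub"
    by (auto intro!: su_gen_lie_algebra_U_sub intro: su_gen.intros)
qed

section \<open>Coisotropy of \<open>U(n - 1)\<close>\<close>

lemma wedge_add_left: "wedge (x + y) z = wedge x z + wedge y z"
  and wedge_diff_left: "wedge (x - y) z = wedge x z - wedge y z"
  and wedge_scaleR_left: "wedge (a *\<^sub>R x) z = a *\<^sub>R wedge x z"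
  and wedge_0_left: "wedge 0 z = 0"
  and wedge_anticommute: "wedge z x = - wedge x z"
  by (intro blinfun_eqI; simp add: wedge_apply blinfun.bilinear_simps algebra_simps)+

lemma wedge_add_right: "wedge z (x + y) = wedge z x + wedge z y"
  and wedge_scaleR_right: "wedge z (a *\<^sub>R x) = a *\<^sub>R wedge z x"
  and wedge_0_right: "wedge z 0 = 0"
  by (intro blinfun_eqI; simp add: wedge_apply blinfun.bilinear_simps algebra_simps)+

lemma wedge_span:
  assumes "x \<in> span A" "y \<in> span B"
  shows "wedge x y \<in> span {wedge x y | x y. x \<in> A \<and> y \<in> B}"
proof -
  let ?W = "span {wedge x y | x y. x \<in> A \<and> y \<in> B}"
  have "wedge a y \<in> ?W" if "a \<in> A" for a
  proof -
    have "subspace {y. wedge a y \<in> ?W}"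
      by (auto simp: subspace_def wedge_add_right wedge_scaleR_right wedge_0_right
          intro: span_add span_scale span_zero)
    moreover have "B \<subseteq> {y. wedge a y \<in> ?W}"
      using that by (auto intro!: span_base)
    ultimately have "span B \<subseteq> {y. wedge a y \<in> ?W}"
      by (intro span_minimal)
    then show ?thesis using assms(2) by blast
  qed
  moreover have "subspace {x. wedge x y \<in> ?W}"
    by (auto simp: subspace_def wedge_add_left wedge_scaleR_left wedge_0_left
        intro: span_add span_scale span_zero)
  ultimately have "span A \<subseteq> {x. wedge x y \<in> ?W}"
    by (intro span_minimal) auto
  then show ?thesis using assms(1) by blast
qed

text \<open>The projection onto the complement of the Lie algebra of \<open>U(n - 1)\<close> spanned by the matrices
  \<open>X\<^sup>\<plusminus>\<^sub>1\<^sub>j\<close>.\<close>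

definition offblock :: "'n::{finite,linorder} cmat \<Rightarrow> 'n cmat" where
  "offblock X = (\<chi> k l. if (k = ix1) = (l = ix1) then 0 else X $ k $ l)"

lemma offblock_nth: "offblock X $ k $ l = (if (k = ix1) = (l = ix1) then 0 else X $ k $ l)"
  by (simp add: offblock_def)

lemma linear_offblock: "linear offblock"
  by (auto simp: linear_iff vec_eq_iff offblock_nth)

lemma skew_offblock: "skew X \<Longrightarrow> skew (offblock X)"
  by (auto simp: skew_def vec_eq_iff offblock_nth)

lemma trace_offblock: "trace (offblock X) = 0"
  by (simp add: trace_def offblock_nth)

lemma block_diff_offblock: "block (X - offblock X)"
  by (auto simp: block_def offblock_nth)

lemma trace_mult_offblock: "trace (\<xi> ** offblock X) = trace (offblock \<xi> ** X)"
  unfolding trace_mult_nth offblock_nth by (intro sum.cong refl) auto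

text \<open>The complement is stable under the subgroup, because the nonzero entries of
  \<open>h\<close> never connect the first index with another one.\<close>

lemma offblock_conj_block:
  assumes h: "block h" and \<xi>: "offblock \<xi> = \<xi>"
  shows "offblock (h ** \<xi> ** h\<^sup>\<dagger>) = h ** \<xi> ** h\<^sup>\<dagger>"
proof -
  have h0: "h $ k $ i = 0" if "(k = ix1) \<noteq> (i = ix1)" for k i
    using h that unfolding block_def by metis
  have \<xi>0: "\<xi> $ i $ j = 0" if "(i = ix1) = (j = ix1)" for i j
    using arg_cong[OF \<xi>, of "\<lambda>X. X $ i $ j"] that by (simp add: offblock_nth)
  have "(h ** \<xi> ** h\<^sup>\<dagger>) $ k $ l = 0" if kl: "(k = ix1) = (l = ix1)" for k l
  proof -
    have z: "(\<Sum>i\<in>UNIV. h $ k $ i * \<xi> $ i $ j) * cnj (h $ l $ j) = 0" for j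
    proof (cases "(l = ix1) = (j = ix1)")
      case False
      then show ?thesis using h0[of l j] by simp
    next
      case True
      have "h $ k $ i * \<xi> $ i $ j = 0" for i
        using h0[of k i] \<xi>0[of i j] True kl by (cases "(k = ix1) = (i = ix1)") auto
      then show ?thesis by (simp add: sum.neutral)
    qed
    show ?thesis
      by (simp only: matrix_matrix_mult_def vec_lambda_beta adjoint_nth z sum.neutral_const)
  qed
  then show ?thesis
    by (auto simp: vec_eq_iff offblock_nth)
qed

text \<open>The conjugate of r that forms the left invariant part of the affine tensor. Its
  projection \<open>conj_r_off\<close> represents its class in the second exterior power of the
  quotient of su(n) by the Lie algebra of \<open>U_sub\<close>.\<close>

definition conj_r :: "'n::{finite,linorder} cmat \<Rightarrow> 'n cmat two_tensor" where
  "conj_r \<tau> = (\<Sum>(i, j) | i < j. wedge (\<tau>\<^sup>\<dagger> ** Xplus i j ** \<tau>) (\<tau>\<^sup>\<dagger> ** Xminus i j ** \<tau>))"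

definition conj_r_off :: "'n::{finite,linorder} cmat \<Rightarrow> 'n cmat two_tensor" where
  "conj_r_off \<tau> = (\<Sum>(i, j) | i < j.
     wedge (offblock (\<tau>\<^sup>\<dagger> ** Xplus i j ** \<tau>)) (offblock (\<tau>\<^sup>\<dagger> ** Xminus i j ** \<tau>)))"

lemma conj_r_apply: "conj_r \<tau> \<alpha> \<beta> = r_form (\<lambda>X. \<alpha> (\<tau>\<^sup>\<dagger> ** X ** \<tau>)) (\<lambda>X. \<beta> (\<tau>\<^sup>\<dagger> ** X ** \<tau>))"
  and conj_r_off_apply: "conj_r_off \<tau> \<alpha> \<beta>
    = r_form (\<lambda>X. \<alpha> (offblock (\<tau>\<^sup>\<dagger> ** X ** \<tau>))) (\<lambda>X. \<beta> (offblock (\<tau>\<^sup>\<dagger> ** X ** \<tau>)))"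
  by (simp_all add: conj_r_def conj_r_off_def r_form_def blinfun.sum_left split_def wedge_apply)

text \<open>Replacing one factor at a time leaves wedges with the block part of \<open>a\<close> or
  \<open>b\<close> as a factor; skewness and zero trace put these parts in the span of the Lie
  algebra of \<open>U_sub\<close>.\<close>

lemma wedge_diff_wedge_offblock:
  fixes a b :: "'n::{finite,linorder} cmat"
  assumes a: "skew a" "trace a = 0" and b: "skew b" "trace b = 0"
  shows "wedge a b - wedge (offblock a) (offblock b)
    \<in> span {wedge x y | x y. x \<in> lie_algebra U_sub \<and> y \<in> lie_algebra SU}"
proof -
  have h: "X - offblock X \<in> span (lie_algebra U_sub)" if "skew X" "trace X = 0" for X :: "'n cmat"
    using that by (intro su_span_block skew_diff skew_offblock block_diff_offblock)
      (simp_all add: trace_sub trace_offblock)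
  have "wedge a b - wedge (offblock a) (offblock b)
      = wedge (a - offblock a) b - wedge (b - offblock b) (offblock a)"
    by (simp add: wedge_diff_left wedge_anticommute[of "offblock a"])
  then show ?thesis
    using wedge_span[OF h[OF a] su_span[OF b]]
      wedge_span[OF h[OF b] su_span[OF skew_offblock[OF a(1)] trace_offblock]]
    by (simp add: span_diff)
qed

lemma trace_generators:
  fixes \<tau> :: "'a::finite cmat"
  assumes that: "\<tau> \<in> SU" "i \<noteq> j"
  shows "trace (\<tau>\<^sup>\<dagger> ** Xplus i j ** \<tau>) = 0" "trace (\<tau>\<^sup>\<dagger> ** Xminus i j ** \<tau>) = 0"
proof -
  have tr: "trace (\<tau>\<^sup>\<dagger> ** X ** \<tau>) = trace X" for X :: "'a cmat"
    using trace_mul_sym[of "\<tau>\<^sup>\<dagger> ** X" \<tau>] by (simp add: matrix_mul_assoc SU_adjoint[OF that(1)])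
  have "Xplus i j $ k $ k = 0" "Xminus i j $ k $ k = 0" for k
    using that(2) by (auto simp: Xplus_nth Xminus_nth)
  then show "trace (\<tau>\<^sup>\<dagger> ** Xplus i j ** \<tau>) = 0" "trace (\<tau>\<^sup>\<dagger> ** Xminus i j ** \<tau>) = 0"
    by (simp_all only: tr) (simp_all add: trace_def)
qed

lemma conj_r_diff_off:
  assumes "\<tau> \<in> SU"
  shows "conj_r \<tau> - conj_r_off \<tau> \<in> span {wedge x y | x y. x \<in> lie_algebra U_sub \<and> y \<in> lie_algebra SU}"
proof -
  have sk: "skew (\<tau>\<^sup>\<dagger> ** X ** \<tau>)" if "skew X" for X
    using skew_conj[OF that, of "\<tau>\<^sup>\<dagger>"] by simp
  show ?thesis
    unfolding conj_r_def conj_r_off_def sum_subtractf[symmetric] split_def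
    by (intro span_sum wedge_diff_wedge_offblock sk skew_generators trace_generators assms) auto
qed

text \<open>The tensor r as a bilinear form on the matrices that represent covectors in the trace
  pairing; twice its imaginary part is \<open>r_form\<close>.\<close>

definition sign_form :: "'n::{finite,linorder} cmat \<Rightarrow> 'n cmat \<Rightarrow> complex" where
  "sign_form \<xi> \<eta> = (\<Sum>k\<in>UNIV. \<Sum>l\<in>UNIV. pair_sign k l * \<xi> $ k $ l * \<eta> $ l $ k)"

lemma r_form_sign_form:
  fixes f g :: "'n::{finite,linorder} cmat \<Rightarrow> real"
  assumes \<xi>: "skew \<xi>" "\<And>X. skew X \<Longrightarrow> f X = Re (trace (\<xi> ** X))"
    and \<eta>: "skew \<eta>" "\<And>X. skew X \<Longrightarrow> g X = Re (trace (\<eta> ** X))" and "linear g"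
  shows "r_form f g = 2 * Im (sign_form \<xi> \<eta>)"
proof -
  have "trace (\<eta> ** r_sharp f) = (\<Sum>l\<in>UNIV. \<Sum>k\<in>UNIV. - 2 * \<i> * (pair_sign k l * \<xi> $ k $ l * \<eta> $ l $ k))"
    unfolding trace_mult_nth by (intro sum.cong refl) (simp add: r_sharp_nth[OF \<xi>] algebra_simps)
  also have "\<dots> = - 2 * \<i> * sign_form \<xi> \<eta>"
    unfolding sign_form_def sum_distrib_left by (rule sum.swap)
  finally show ?thesis
    by (simp add: r_form_sharp[OF assms(5)] \<eta>(2)[OF skew_r_sharp])
qed

section \<open>The rotation sigma and the extreme indices\<close>

lemma ix1_le: "ix1 \<le> (i :: 'n::{finite,linorder})"
  and le_ixn: "(i :: 'n::{finite,linorder}) \<le> ixn"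
  by (simp_all add: ix1_def ixn_def)

lemma ix1_neq_ixn:
  assumes "CARD('n::{finite,linorder}) \<ge> 2"
  shows "(ix1 :: 'n) \<noteq> ixn"
proof
  assume "(ix1 :: 'n) = ixn"
  then have "(UNIV :: 'n set) = {ix1}"
    using ix1_le le_ixn by (metis UNIV_eq_I antisym singletonI)
  then have "CARD('n) = card {ix1 :: 'n}" by simp
  with assms show False by simp
qed

lemma sigma_nth:
  assumes ne: "(ix1 :: 'n::{finite,linorder}) \<noteq> ixn"
  shows "(sigma c :: 'n cmat) $ ix1 $ l = (if l = ix1 then sqrt c else if l = ixn then - sqrt (1 - c) else 0)"
    and "(sigma c :: 'n cmat) $ ixn $ l = (if l = ix1 then sqrt (1 - c) else if l = ixn then sqrt c else 0)"
    and "k \<noteq> ix1 \<Longrightarrow> k \<noteq> ixn \<Longrightarrow> (sigma c :: 'n cmat) $ k $ l = (if k = l then 1 else 0)"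
proof -
  have mid: "(\<Sum>i\<in>{ix1<..<ixn}. if k = i \<and> l = i then 1 else 0) = (if ix1 < k \<and> k < ixn \<and> k = l then 1 else (0::complex))"
    for k l :: 'n
  proof -
    have "(\<Sum>i\<in>{ix1<..<ixn}. if k = i \<and> l = i then 1 else 0)
        = (\<Sum>i\<in>{ix1<..<ixn}. if i = k then (if k = l then 1 else 0) else (0::complex))"
      by (intro sum.cong refl) auto
    also have "\<dots> = (if k \<in> {ix1<..<ixn} then (if k = l then 1 else 0) else 0)"
      by (rule sum.delta) simp
    also have "\<dots> = (if ix1 < k \<and> k < ixn \<and> k = l then 1 else 0)"
      by auto
    finally show ?thesis .
  qed
  note simps = sigma_def mid mat_unit_nth scaleR_conv_of_real[where 'a = complex] ne ne[symmetric]
  show "(sigma c :: 'n cmat) $ ix1 $ l = (if l = ix1 then sqrt c else if l = ixn then - sqrt (1 - c) else 0)"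
    "(sigma c :: 'n cmat) $ ixn $ l = (if l = ix1 then sqrt (1 - c) else if l = ixn then sqrt c else 0)"
    by (simp_all add: simps)
  assume k: "k \<noteq> ix1" "k \<noteq> ixn"
  then have "ix1 < k" "k < ixn"
    using ix1_le[of k] le_ixn[of k] by auto
  with k show "(sigma c :: 'n cmat) $ k $ l = (if k = l then 1 else 0)"
    by (simp add: simps)
qed

text \<open>For the angle t with cos t = sqrt c and sin t = sqrt (1 - c), \<open>sigma c\<close> is
  the element at time t of the one-parameter group generated by
  \<open>Xplus ixn ix1\<close>.\<close>

lemma sigma_SU:
  assumes ne: "(ix1 :: 'n::{finite,linorder}) \<noteq> ixn" and c: "0 \<le> c" "c \<le> 1"
  shows "(sigma c :: 'n cmat) \<in> SU"
proof -
  obtain t where t: "sqrt c = cos t" "sqrt (1 - c) = sin t"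
    using sincos_total_2pi[of "sqrt c" "sqrt (1 - c)"] c by auto
  have "sigma c = rot (Xplus (ixn :: 'n) ix1) t"
  proof (intro iffD2[OF vec_eq_iff] allI)
    fix k l :: 'n
    have e: "rot (Xplus ixn ix1) t $ k $ l = (if k = l then 1 else 0) + sin t * Xplus ixn ix1 $ k $ l
        - (1 - cos t) * (mat_unit ixn ixn $ k $ l + mat_unit ix1 ix1 $ k $ l)"
      unfolding rot_def Xplus_sq[OF ne[symmetric]]
      by (simp add: mat_def scaleR_conv_of_real[where 'a = complex] algebra_simps)
    consider "k = ix1" | "k = ixn" | "k \<noteq> ix1" "k \<noteq> ixn" by blast
    then show "sigma c $ k $ l = rot (Xplus ixn ix1) t $ k $ l"
      unfolding e using ne ne[symmetric]
      by cases (simp_all add: sigma_nth[OF ne] t Xplus_nth mat_unit_nth)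
  qed
  then show ?thesis
    using rot_su_gen_SU su_gen.Xplus ne by metis
qed

lemma sum_split_ends:
  fixes f :: "'n::{finite,linorder} \<Rightarrow> 'a::comm_monoid_add"
  assumes "(ix1 :: 'n) \<noteq> ixn"
  shows "sum f UNIV = f ix1 + f ixn + sum f (UNIV - {ix1, ixn})"
proof -
  have "sum f UNIV = sum f {ix1, ixn} + sum f (UNIV - {ix1, ixn})"
    using sum.subset_diff[of "{ix1, ixn}" UNIV f] by (simp add: add.commute)
  then show ?thesis using assms by simp
qed

text \<open>\<open>ix1\<close> lies below and \<open>ixn\<close> above all other indices, so the
  terms through a middle index combine with the weights C * C and - S * S. The terms joining the two
  ends carry C^4 - S^4, and C * C + S * S = 1 makes this the same factor C * C - S * S. With one
  common factor the form is a multiple of the corner of the commutator.\<close>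

lemma sign_form_sigma:
  fixes \<xi> \<eta> :: "'n::{finite,linorder} cmat"
  assumes ne: "(ix1 :: 'n) \<noteq> ixn" and c: "0 \<le> c" "c \<le> 1"
    and \<xi>: "offblock \<xi> = \<xi>" and \<eta>: "offblock \<eta> = \<eta>"
  shows "sign_form (sigma c ** \<xi> ** (sigma c)\<^sup>\<dagger>) (sigma c ** \<eta> ** (sigma c)\<^sup>\<dagger>)
    = complex_of_real (2 * c - 1) * ((\<xi> ** \<eta>) $ ix1 $ ix1 - (\<eta> ** \<xi>) $ ix1 $ ix1)"
proof -
  let ?a = "ix1 :: 'n" and ?b = "ixn :: 'n"
  let ?M = "UNIV - {?a, ?b}"
  define C S where "C = complex_of_real (sqrt c)" and "S = complex_of_real (sqrt (1 - c))"
  have CS: "C * C = complex_of_real c" "S * S = 1 - complex_of_real c"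
    using c by (simp_all add: C_def S_def of_real_mult[symmetric] del: of_real_mult)
  have left: "(sigma c ** A) $ ?a $ l = C * A $ ?a $ l - S * A $ ?b $ l"
    "(sigma c ** A) $ ?b $ l = S * A $ ?a $ l + C * A $ ?b $ l"
    "k \<in> ?M \<Longrightarrow> (sigma c ** A) $ k $ l = A $ k $ l" for A :: "'n cmat" and k l
    using ne ne[symmetric]
    by (simp_all add: matrix_matrix_mult_def sum_split_ends[OF ne] sigma_nth[OF ne] C_def S_def
        if_distrib[of "\<lambda>x. x * _"] cong: if_cong)
  have right: "(A ** (sigma c)\<^sup>\<dagger>) $ k $ ?a = C * A $ k $ ?a - S * A $ k $ ?b"
    "(A ** (sigma c)\<^sup>\<dagger>) $ k $ ?b = S * A $ k $ ?a + C * A $ k $ ?b"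
    "l \<in> ?M \<Longrightarrow> (A ** (sigma c)\<^sup>\<dagger>) $ k $ l = A $ k $ l" for A :: "'n cmat" and k l
  proof -
    have "(A ** (sigma c)\<^sup>\<dagger>) $ k $ l = cnj ((sigma c ** A\<^sup>\<dagger>) $ l $ k)" for l
      using adjoint_nth[of "sigma c ** A\<^sup>\<dagger>" k l] by (simp add: adjoint_mult)
    moreover have "cnj C = C" "cnj S = S" by (simp_all add: C_def S_def)
    ultimately show "(A ** (sigma c)\<^sup>\<dagger>) $ k $ ?a = C * A $ k $ ?a - S * A $ k $ ?b"
      "(A ** (sigma c)\<^sup>\<dagger>) $ k $ ?b = S * A $ k $ ?a + C * A $ k $ ?b"
      "l \<in> ?M \<Longrightarrow> (A ** (sigma c)\<^sup>\<dagger>) $ k $ l = A $ k $ l"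
      by (simp_all add: left)
  qed
  have off: "\<theta> $ i $ j = 0" if "offblock \<theta> = \<theta>" "(i = ?a) = (j = ?a)" for \<theta> i j
    using arg_cong[OF that(1), of "\<lambda>X. X $ i $ j"] that(2) by (simp add: offblock_nth)
  have sgn: "pair_sign ?a ?b = 1" "pair_sign ?b ?a = - 1" "pair_sign k k = 0"
    "m \<in> ?M \<Longrightarrow> pair_sign ?a m = 1" "m \<in> ?M \<Longrightarrow> pair_sign m ?a = - 1"
    "m \<in> ?M \<Longrightarrow> pair_sign ?b m = - 1" "m \<in> ?M \<Longrightarrow> pair_sign m ?b = 1" for m k :: 'n
    using ne ix1_le[of m] le_ixn[of m] ix1_le[of ?b] by (auto simp: pair_sign_def)
  let ?\<xi> = "sigma c ** \<xi> ** (sigma c)\<^sup>\<dagger>" and ?\<eta> = "sigma c ** \<eta> ** (sigma c)\<^sup>\<dagger>"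
  have entries: "(sigma c ** \<theta> ** (sigma c)\<^sup>\<dagger>) $ ?a $ ?b = C * C * \<theta> $ ?a $ ?b - S * S * \<theta> $ ?b $ ?a"
    "(sigma c ** \<theta> ** (sigma c)\<^sup>\<dagger>) $ ?b $ ?a = C * C * \<theta> $ ?b $ ?a - S * S * \<theta> $ ?a $ ?b"
    "m \<in> ?M \<Longrightarrow> (sigma c ** \<theta> ** (sigma c)\<^sup>\<dagger>) $ ?a $ m = C * \<theta> $ ?a $ m"
    "m \<in> ?M \<Longrightarrow> (sigma c ** \<theta> ** (sigma c)\<^sup>\<dagger>) $ m $ ?a = C * \<theta> $ m $ ?a"
    "m \<in> ?M \<Longrightarrow> (sigma c ** \<theta> ** (sigma c)\<^sup>\<dagger>) $ ?b $ m = S * \<theta> $ ?a $ m"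
    "m \<in> ?M \<Longrightarrow> (sigma c ** \<theta> ** (sigma c)\<^sup>\<dagger>) $ m $ ?b = S * \<theta> $ m $ ?a"
    "m \<in> ?M \<Longrightarrow> m' \<in> ?M \<Longrightarrow> (sigma c ** \<theta> ** (sigma c)\<^sup>\<dagger>) $ m $ m' = 0"
    if "offblock \<theta> = \<theta>" for \<theta> m m'
    using ne off[OF that] by (simp_all add: left right algebra_simps)
  note entries = entries[OF \<xi>] entries[OF \<eta>]
  have "sign_form ?\<xi> ?\<eta> = (?\<xi> $ ?a $ ?b * ?\<eta> $ ?b $ ?a - ?\<xi> $ ?b $ ?a * ?\<eta> $ ?a $ ?b)
      + ((\<Sum>m\<in>?M. ?\<xi> $ ?a $ m * ?\<eta> $ m $ ?a) - (\<Sum>m\<in>?M. ?\<xi> $ ?b $ m * ?\<eta> $ m $ ?b)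
      + (\<Sum>m\<in>?M. ?\<xi> $ m $ ?b * ?\<eta> $ ?b $ m - ?\<xi> $ m $ ?a * ?\<eta> $ ?a $ m))"
  proof -
    \<comment> \<open>Conjugation by \<open>sigma c\<close> mixes only the two end indices, so the
      entries of an off-block matrix at two middle indices stay zero.\<close>
    have "(\<Sum>l\<in>?M. pair_sign m l * ?\<xi> $ m $ l * ?\<eta> $ l $ m) = 0" if "m \<in> ?M" for m
      using entries(7)[OF that] by (intro sum.neutral ballI) simp
    then show ?thesis
      by (simp add: sign_form_def sum_split_ends[OF ne] sgn sum_negf sum_subtractf cong: sum.cong_simp)
  qed
  also have "(\<Sum>m\<in>?M. ?\<xi> $ ?a $ m * ?\<eta> $ m $ ?a) = C * C * (\<Sum>m\<in>?M. \<xi> $ ?a $ m * \<eta> $ m $ ?a)"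
    by (simp add: entries sum_distrib_left algebra_simps)
  also have "(\<Sum>m\<in>?M. ?\<xi> $ ?b $ m * ?\<eta> $ m $ ?b) = S * S * (\<Sum>m\<in>?M. \<xi> $ ?a $ m * \<eta> $ m $ ?a)"
    by (simp add: entries sum_distrib_left algebra_simps)
  also have "(\<Sum>m\<in>?M. ?\<xi> $ m $ ?b * ?\<eta> $ ?b $ m - ?\<xi> $ m $ ?a * ?\<eta> $ ?a $ m)
      = (S * S - C * C) * (\<Sum>m\<in>?M. \<xi> $ m $ ?a * \<eta> $ ?a $ m)"
    by (simp add: entries sum_distrib_left algebra_simps)
  also have "?\<xi> $ ?a $ ?b * ?\<eta> $ ?b $ ?a - ?\<xi> $ ?b $ ?a * ?\<eta> $ ?a $ ?b
      = (C * C - S * S) * (C * C + S * S) * (\<xi> $ ?a $ ?b * \<eta> $ ?b $ ?a - \<xi> $ ?b $ ?a * \<eta> $ ?a $ ?b)"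
    by (simp only: entries) (simp add: algebra_simps)
  finally have "sign_form ?\<xi> ?\<eta> = (C * C - S * S) * ((\<xi> $ ?a $ ?b * \<eta> $ ?b $ ?a - \<xi> $ ?b $ ?a * \<eta> $ ?a $ ?b)
      + ((\<Sum>m\<in>?M. \<xi> $ ?a $ m * \<eta> $ m $ ?a) - (\<Sum>m\<in>?M. \<xi> $ m $ ?a * \<eta> $ ?a $ m)))"
    by (simp add: CS algebra_simps)
  also have "\<dots> = (C * C - S * S) * ((\<xi> ** \<eta>) $ ?a $ ?a - (\<eta> ** \<xi>) $ ?a $ ?a)"
    using off[OF \<xi>, of ?a ?a]
    by (simp add: matrix_matrix_mult_def sum_split_ends[OF ne] mult.commute)
  also have "C * C - S * S = complex_of_real (2 * c - 1)"
    by (simp add: CS)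
  finally show ?thesis .
qed

lemma offblock_representation:
  fixes f :: "'n::{finite,linorder} cmat \<Rightarrow> real"
  assumes "linear f"
  obtains \<xi> where "skew \<xi>" "offblock \<xi> = \<xi>" "\<And>X. skew X \<Longrightarrow> f (offblock X) = Re (trace (\<xi> ** X))"
proof -
  obtain \<xi> where \<xi>: "skew \<xi>" "\<And>X. skew X \<Longrightarrow> f X = Re (trace (\<xi> ** X))"
    using skew_representation[OF assms] by metis
  show ?thesis
  proof (rule that[of "offblock \<xi>"])
    show "skew (offblock \<xi>)" using \<xi>(1) by (rule skew_offblock)
    show "offblock (offblock \<xi>) = offblock \<xi>" by (simp add: vec_eq_iff offblock_nth)
    show "f (offblock X) = Re (trace (offblock \<xi> ** X))" if "skew X" for X
      using \<xi>(2)[OF skew_offblock[OF that]] by (simp add: trace_mult_offblock)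
  qed
qed

text \<open>The element \<open>h\<close> is moved from \<open>sigma c ** h\<close> onto the
  covectors, where conjugation keeps them off-block. The corner of their product is then multiplied
  by the squared modulus of the corner of \<open>h\<close>, which is 1.\<close>

lemma conj_r_off_invariant:
  fixes h :: "'n::{finite,linorder} cmat"
  assumes ne: "(ix1 :: 'n) \<noteq> ixn" and c: "0 \<le> c" "c \<le> 1" and h: "h \<in> U_sub"
  shows "conj_r_off (sigma c ** h) = conj_r_off (sigma c)"
proof (intro blinfun_eqI)
  fix \<alpha> \<beta> :: "'n cmat \<Rightarrow>\<^sub>L real"
  let ?\<sigma> = "sigma c :: 'n cmat"
  have hS: "h \<in> SU" "block h" using h by (auto simp: U_sub_eq)
  obtain \<xi> where \<xi>: "skew \<xi>" "offblock \<xi> = \<xi>" "\<And>X. skew X \<Longrightarrow> \<alpha> (offblock X) = Re (trace (\<xi> ** X))"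
    using offblock_representation[of "blinfun_apply \<alpha>"] blinfun.bounded_linear_right bounded_linear.linear by metis
  obtain \<eta> where \<eta>: "skew \<eta>" "offblock \<eta> = \<eta>" "\<And>X. skew X \<Longrightarrow> \<beta> (offblock X) = Re (trace (\<eta> ** X))"
    using offblock_representation[of "blinfun_apply \<beta>"] blinfun.bounded_linear_right bounded_linear.linear by metis
  have lin: "linear (\<lambda>X. \<beta> (offblock (\<tau>\<^sup>\<dagger> ** X ** \<tau>)))" for \<tau> :: "'n cmat"
    by (rule linear_left_field, rule linear_compose[OF linear_offblock, unfolded o_def])
      (intro bounded_linear.linear blinfun.bounded_linear_right)
  have eval: "conj_r_off \<tau> \<alpha> \<beta> = 2 * Im (sign_form (\<tau> ** \<xi> ** \<tau>\<^sup>\<dagger>) (\<tau> ** \<eta> ** \<tau>\<^sup>\<dagger>))" for \<tau> :: "'n cmat"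
  proof -
    have tr: "trace (\<theta> ** (\<tau>\<^sup>\<dagger> ** X ** \<tau>)) = trace ((\<tau> ** \<theta> ** \<tau>\<^sup>\<dagger>) ** X)" for \<theta> X
      using trace_mul_sym[of "\<theta> ** \<tau>\<^sup>\<dagger> ** X" \<tau>] by (simp add: matrix_mul_assoc)
    have sk: "skew (\<tau>\<^sup>\<dagger> ** X ** \<tau>)" if "skew X" for X
      using skew_conj[OF that, of "\<tau>\<^sup>\<dagger>"] by simp
    show ?thesis
      unfolding conj_r_off_apply
      by (rule r_form_sign_form) (auto simp: \<xi> \<eta> skew_conj sk tr intro: lin)
  qed
  have unit: "h $ ix1 $ ix1 * cnj (h $ ix1 $ ix1) = 1"
    using block_corner_unit[of h] hS by (simp add: SU_def mult.commute)
  have corner: "((h ** \<theta> ** h\<^sup>\<dagger>) ** (h ** \<theta>' ** h\<^sup>\<dagger>)) $ ix1 $ ix1 = (\<theta> ** \<theta>') $ ix1 $ ix1" for \<theta> \<theta>'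
  proof -
    have "(h ** \<theta> ** h\<^sup>\<dagger>) ** (h ** \<theta>' ** h\<^sup>\<dagger>) = h ** (\<theta> ** \<theta>') ** h\<^sup>\<dagger>"
      by (simp add: matrix_mul_assoc[symmetric] SU_cancel[OF hS(1)])
    then show ?thesis
      using unit by (simp add: block_mult_col[OF block_simps(4)[OF hS(2)]] block_mult_row[OF hS(2)] algebra_simps)
  qed
  have "conj_r_off (?\<sigma> ** h) \<alpha> \<beta> = 2 * Im (sign_form
      (?\<sigma> ** (h ** \<xi> ** h\<^sup>\<dagger>) ** ?\<sigma>\<^sup>\<dagger>) (?\<sigma> ** (h ** \<eta> ** h\<^sup>\<dagger>) ** ?\<sigma>\<^sup>\<dagger>))"
    by (simp add: eval adjoint_mult matrix_mul_assoc)
  also have "\<dots> = conj_r_off ?\<sigma> \<alpha> \<beta>"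
    unfolding eval sign_form_sigma[OF ne c \<xi>(2) \<eta>(2)]
      sign_form_sigma[OF ne c offblock_conj_block[OF hS(2) \<xi>(2)] offblock_conj_block[OF hS(2) \<eta>(2)]]
      corner ..
  finally show "conj_r_off (?\<sigma> ** h) \<alpha> \<beta> = conj_r_off ?\<sigma> \<alpha> \<beta>" .
qed

lemma coisotropic_U_sub:
  assumes ne: "(ix1 :: 'n::{finite,linorder}) \<noteq> ixn" and c: "0 \<le> c" "c \<le> 1"
  shows "coisotropic (U_sub :: 'n cmat set) (right_translate (sigma c) std_poisson)"
  unfolding coisotropic_def
proof (intro conjI ballI closed_subgroup_U_sub)
  fix g h :: "'n cmat" assume g: "g \<in> SU" and h: "h \<in> U_sub"
  let ?\<sigma> = "sigma c :: 'n cmat"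
  let ?W = "span {wedge x y | x y. x \<in> lie_algebra U_sub \<and> y \<in> lie_algebra (SU :: 'n cmat set)}"
  have \<sigma>: "?\<sigma> \<in> SU" by (rule sigma_SU[OF ne c])
  have hS: "h \<in> SU" using h by (simp add: U_sub_eq)
  have "right_translate ?\<sigma> std_poisson (g ** h) - rtrans h (right_translate ?\<sigma> std_poisson g)
      = ltrans (g ** h) (conj_r ?\<sigma> - conj_r (?\<sigma> ** h))"
    by (intro blinfun_eqI)
      (simp add: blinfun.diff_left ltrans_apply rtrans_apply conj_r_apply
        right_translate_std_poisson_apply[OF \<sigma>],
       simp add: adjoint_mult matrix_mul_assoc[symmetric] SU_cancel[OF hS])
  \<comment> \<open>The two projected tensors coincide and may be inserted with opposite signs; each
    of the two differences then lies in the required span.\<close>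
  moreover have eq: "conj_r ?\<sigma> - conj_r (?\<sigma> ** h)
      = (conj_r ?\<sigma> - conj_r_off ?\<sigma>) - (conj_r (?\<sigma> ** h) - conj_r_off (?\<sigma> ** h))"
    by (simp add: conj_r_off_invariant[OF ne c h])
  have "conj_r ?\<sigma> - conj_r (?\<sigma> ** h) \<in> ?W"
    unfolding eq by (rule span_diff[OF conj_r_diff_off[OF \<sigma>] conj_r_diff_off[OF SU_mult[OF \<sigma> hS]]])
  ultimately show "right_translate ?\<sigma> std_poisson (g ** h) - rtrans h (right_translate ?\<sigma> std_poisson g)
      \<in> ltrans (g ** h) ` ?W"
    by (simp only: imageI)
qed

section \<open>Descent to the homogeneous space\<close>

lemma bracket_cong:
  assumes "u \<in> SU" "\<And>x. x \<in> SU \<Longrightarrow> F x = F' x" "\<And>x. x \<in> SU \<Longrightarrow> G x = G' x"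
  shows "bracket \<sigma> F G u = bracket \<sigma> F' G' u"
  using differential_cong[OF assms(1,2)] differential_cong[OF assms(1,3)] by (simp add: bracket_def)

text \<open>The hypothesis only asks that \<tau> lift to \<open>bracket\<close> along
  \<open>q\<close>, so the statement covers the group with \<open>q = id\<close> and the quotient
  with \<open>q = coset\<close>.\<close>

lemma bracket_poisson_structure:
  assumes \<sigma>: "\<sigma> \<in> SU"
    and \<tau>: "\<And>u f k. u \<in> SU \<Longrightarrow> f \<in> smooth_funs SU q \<Longrightarrow> k \<in> smooth_funs SU q
      \<Longrightarrow> \<tau> (q u) f k = bracket \<sigma> (f \<circ> q) (k \<circ> q) u"
  shows "poisson_structure (q ` SU) (smooth_funs SU q) \<tau>"
proof -
  have br: "(\<lambda>p. \<tau> p f k) \<in> smooth_funs SU q" if "f \<in> smooth_funs SU q" "k \<in> smooth_funs SU q" for f k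
  proof -
    have "smooth_fun SU (bracket \<sigma> (f \<circ> q) (k \<circ> q))"
      using that by (intro smooth_bracket \<sigma>) (simp_all add: smooth_funs_def)
    then have "smooth_fun SU ((\<lambda>p. \<tau> p f k) \<circ> q)"
      by (rule smooth_fun_cong) (simp add: \<tau> that)
    then show ?thesis by (simp add: smooth_funs_def)
  qed
  \<comment> \<open>The lift of the inner bracket is known on \<open>SU\<close> only; this suffices,
    as \<open>differential\<close> depends on the values there alone.\<close>
  have nest: "\<tau> (q u) f (\<lambda>p. \<tau> p g h) = bracket \<sigma> (f \<circ> q) (bracket \<sigma> (g \<circ> q) (h \<circ> q)) u"
    if "u \<in> SU" "f \<in> smooth_funs SU q" "g \<in> smooth_funs SU q" "h \<in> smooth_funs SU q" for u f g h
    unfolding \<tau>[OF that(1,2) br[OF that(3,4)]]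
    by (rule bracket_cong[OF that(1)]) (simp_all add: \<tau> that(3,4))
  show ?thesis
    unfolding poisson_structure_def
  proof (intro conjI ballI)
    fix p assume "p \<in> q ` SU"
    then obtain u where "u \<in> SU" "p = q u" by blast
    then show "bivector_at (smooth_funs SU q) p (\<tau> p)"
      using bivector_at_bracket[OF \<sigma>, of u q "\<tau> (q u)"] \<tau> by simp
  next
    fix f g h p assume fgh: "f \<in> smooth_funs SU q" "g \<in> smooth_funs SU q" "h \<in> smooth_funs SU q"
      and "p \<in> q ` SU"
    then obtain u where u: "u \<in> SU" "p = q u" by blast
    have s: "smooth_fun SU (f \<circ> q)" "smooth_fun SU (g \<circ> q)" "smooth_fun SU (h \<circ> q)"
      using fgh by (simp_all add: smooth_funs_def)
    show "\<tau> p f (\<lambda>q. \<tau> q g h) + \<tau> p g (\<lambda>q. \<tau> q h f) + \<tau> p h (\<lambda>q. \<tau> q f g) = 0"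
      unfolding u(2) nest[OF u(1) fgh] nest[OF u(1) fgh(2,3,1)] nest[OF u(1) fgh(3,1,2)]
      by (rule jacobi_bracket[OF \<sigma> s u(1)])
  qed (rule br)
qed

lemma bracket_left_covariant:
  fixes q :: "'n::{finite,linorder} cmat \<Rightarrow> 'p"
  assumes \<sigma>: "\<sigma> \<in> SU"
    and \<tau>: "\<And>u f k. u \<in> SU \<Longrightarrow> f \<in> smooth_funs SU q \<Longrightarrow> k \<in> smooth_funs SU q
      \<Longrightarrow> \<tau> (q u) f k = bracket \<sigma> (f \<circ> q) (k \<circ> q) u"
    and act: "\<And>g u. act g (q u) = q (g ** u)"
  shows "left_covariant q act \<tau>"
  unfolding left_covariant_def poisson_map_def
proof (intro conjI ballI)
  fix f assume "f \<in> smooth_funs SU q"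
  then have "smooth_fun SU (f \<circ> q)" by (simp add: smooth_funs_def)
  then have "smooth_fun (SU \<times> SU) (\<lambda>x. (f \<circ> q) (fst x ** snd x))"
    by (rule smooth_fun_mult)
  moreover have "f \<circ> (\<lambda>(g, p). act g p) \<circ> map_prod id q = (\<lambda>x. (f \<circ> q) (fst x ** snd x))"
    by (simp add: fun_eq_iff act)
  ultimately show "f \<circ> (\<lambda>(g, p). act g p) \<in> smooth_funs (SU \<times> SU) (map_prod id q)"
    by (simp add: smooth_funs_def)
next
  fix f k and gp :: "'n cmat \<times> 'p"
  assume fk: "f \<in> smooth_funs SU q" "k \<in> smooth_funs SU q" and "gp \<in> SU \<times> q ` SU"
  then obtain g u where gu: "g \<in> SU" "u \<in> SU" "gp = (g, q u)" by blast
  have s: "smooth_fun SU (f \<circ> q)" "smooth_fun SU (k \<circ> q)"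
    using fk by (simp_all add: smooth_funs_def)
  \<comment> \<open>Freezing \<open>g\<close> has to give a smooth function on the quotient before
    the hypothesis on \<tau> applies.\<close>
  have left: "(\<lambda>y. l (act g y)) \<in> smooth_funs SU q" if "l \<in> smooth_funs SU q" for l
    using smooth_fun_left_translate[of "l \<circ> q" g] gu(1) that by (simp add: smooth_funs_def o_def act)
  have "product_tensor (on_SU std_poisson) \<tau> gp (f \<circ> (\<lambda>(g, p). act g p)) (k \<circ> (\<lambda>(g, p). act g p))
      = std_poisson g (differential SU g (\<lambda>x. (f \<circ> q) (x ** u))) (differential SU g (\<lambda>x. (k \<circ> q) (x ** u)))
        + bracket \<sigma> (\<lambda>y. (f \<circ> q) (g ** y)) (\<lambda>y. (k \<circ> q) (g ** y)) u"
    by (simp add: gu(3) product_tensor_def push_action_def \<tau>[OF gu(2) left[OF fk(1)] left[OF fk(2)]] o_def act)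
  also have "\<dots> = \<tau> (q (g ** u)) f k"
    unfolding bracket_covariant[OF \<sigma> s gu(1,2)] \<tau>[OF SU_mult[OF gu(1,2)] fk] ..
  finally show "product_tensor (on_SU std_poisson) \<tau> gp (f \<circ> (\<lambda>(g, p). act g p)) (k \<circ> (\<lambda>(g, p). act g p))
      = \<tau> (case gp of (g, p) \<Rightarrow> act g p) f k"
    by (simp add: gu(3) act)
qed

lemma coset_mult:
  assumes "h \<in> U_sub"
  shows "coset (u ** h) = coset u"
proof -
  have h: "h \<in> SU" "block h" using assms by (auto simp: U_sub_eq)
  have "(\<lambda>k. h ** k) ` U_sub = U_sub"
  proof (intro equalityI subsetI)
    fix x :: "'a cmat" assume "x \<in> U_sub"
    then have "x = h ** (h\<^sup>\<dagger> ** x)" "h\<^sup>\<dagger> ** x \<in> U_sub"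
      using h by (auto simp: U_sub_eq SU_cancel SU_mult SU_adjoint_mem block_mult block_simps)
    then show "x \<in> (\<lambda>k. h ** k) ` U_sub" by blast
  qed (use h in \<open>auto simp: U_sub_eq SU_mult block_mult\<close>)
  then have "coset u = (\<lambda>k. u ** k) ` (\<lambda>k. h ** k) ` U_sub"
    by (simp add: coset_def)
  also have "\<dots> = coset (u ** h)"
    by (simp add: coset_def image_image matrix_mul_assoc)
  finally show ?thesis ..
qed

lemma coset_eqD:
  assumes "coset u = coset v"
  obtains h where "h \<in> U_sub" "v = u ** h"
proof -
  have "mat 1 \<in> U_sub" by (simp add: U_sub_eq SU_one block_simps)
  then have "v ** mat 1 \<in> coset v" unfolding coset_def by (rule imageI)
  then have "v \<in> coset u" using assms by simp
  then show ?thesis using that unfolding coset_def by blast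
qed

lemma coset_act_coset: "coset_act g (coset u) = coset (g ** u)"
  by (simp add: coset_act_def coset_def image_image matrix_mul_assoc)

text \<open>A one-parameter subgroup of \<open>U_sub\<close> gives a curve in the fibre through
  \<open>u\<close>, along which \<open>F\<close> is constant.\<close>

lemma differential_lie_algebra_eq_0:
  assumes F: "smooth_fun SU F" and inv: "\<And>u h. h \<in> U_sub \<Longrightarrow> F (u ** h) = F u"
    and u: "u \<in> SU" and X: "X \<in> lie_algebra U_sub"
  shows "differential SU u F (u ** X) = 0"
proof -
  obtain \<gamma> where \<gamma>: "\<And>t. \<gamma> t \<in> U_sub" "\<And>s t. \<gamma> (s + t) = \<gamma> s ** \<gamma> t"
    "(\<gamma> has_vector_derivative X) (at (0::real))"
    using X unfolding lie_algebra_def by blast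
  have \<gamma>S: "\<gamma> t \<in> SU" for t using \<gamma>(1) by (simp add: U_sub_eq)
  \<comment> \<open>The homomorphism property makes \<open>\<gamma> 0\<close> idempotent, and
    cancellation in the group makes it the identity.\<close>
  have "\<gamma> 0 ** \<gamma> 0 = \<gamma> 0" using \<gamma>(2)[of 0 0] by simp
  then have \<gamma>0: "\<gamma> 0 = mat 1"
    using SU_cancel(1)[OF \<gamma>S[of 0], of "\<gamma> 0"] SU_adjoint(1)[OF \<gamma>S[of 0]] by simp
  show ?thesis
  proof (rule differential_eq_0[OF F, of "\<lambda>t. u ** \<gamma> t"])
    show "u ** \<gamma> t \<in> SU" for t using SU_mult[OF u \<gamma>S] .
    show "u ** \<gamma> 0 = u" by (simp add: \<gamma>0)
    show "((\<lambda>t. u ** \<gamma> t) has_vector_derivative u ** X) (at 0)"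
      by (rule bounded_linear.has_vector_derivative[OF mm.bounded_linear_right \<gamma>(3)])
    show "F (u ** \<gamma> t) = F u" for t using inv \<gamma>(1) .
  qed
qed

text \<open>Coisotropy makes the correction term in \<open>\<rho> (u h)\<close> vanish on differentials of \<open>U(n - 1)\<close>-invariant
  functions.\<close>

lemma bracket_U_sub_invariant:
  fixes F G :: "'n::{finite,linorder} cmat \<Rightarrow> real"
  assumes co: "coisotropic U_sub (right_translate \<sigma> std_poisson)" and \<sigma>: "\<sigma> \<in> SU"
    and F: "smooth_fun SU F" "\<And>u h. h \<in> U_sub \<Longrightarrow> F (u ** h) = F u"
    and G: "smooth_fun SU G" "\<And>u h. h \<in> U_sub \<Longrightarrow> G (u ** h) = G u"
    and u: "u \<in> SU" and h: "h \<in> U_sub"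
  shows "bracket \<sigma> F G (u ** h) = bracket \<sigma> F G u"
proof -
  let ?\<rho> = "right_translate \<sigma> std_poisson"
  let ?dF = "differential SU (u ** h) F" and ?dG = "differential SU (u ** h) G"
  have hS: "h \<in> SU" using h by (simp add: U_sub_eq)
  have uh: "u ** h \<in> SU" using SU_mult[OF u hS] .
  obtain w where w: "w \<in> span {wedge x y | x y. x \<in> lie_algebra U_sub \<and> y \<in> lie_algebra (SU :: 'n cmat set)}"
    "?\<rho> (u ** h) - rtrans h (?\<rho> u) = ltrans (u ** h) w"
    using co u h unfolding coisotropic_def by blast
  let ?N = "{w :: 'n cmat two_tensor. ltrans (u ** h) w ?dF ?dG = 0}"
  \<comment> \<open>A linear condition is checked on the generating wedges, where the factor from
    the Lie algebra of \<open>U_sub\<close> is annihilated by both differentials.\<close>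
  have "subspace ?N"
    by (auto simp: subspace_def ltrans_apply blinfun.bilinear_simps)
  moreover have "{wedge x y | x y. x \<in> lie_algebra U_sub \<and> y \<in> lie_algebra (SU :: 'n cmat set)} \<subseteq> ?N"
    using differential_lie_algebra_eq_0[OF F uh] differential_lie_algebra_eq_0[OF G uh]
    by (auto simp: ltrans_apply wedge_apply)
  ultimately have "ltrans (u ** h) w ?dF ?dG = 0"
    using w(1) span_minimal by blast
  then have "bracket \<sigma> F G (u ** h) = rtrans h (?\<rho> u) ?dF ?dG"
    using arg_cong[OF w(2), of "\<lambda>P. P ?dF ?dG"] by (simp add: bracket_def blinfun.diff_left)
  also have "\<dots> = bracket \<sigma> F G u"
  proof -
    \<comment> \<open>An invariant function equals its right translate by \<open>h\<close>, so right
      translation matches its differentials at \<open>u\<close> and \<open>u ** h\<close> on tangent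
      vectors.\<close>
    have d: "differential SU (u ** h) K (Z ** h) = differential SU u K Z"
      if K: "smooth_fun SU K" "\<And>u h. h \<in> U_sub \<Longrightarrow> K (u ** h) = K u" and Z: "Z \<in> curve_tangent SU u"
      for K :: "'n cmat \<Rightarrow> real" and Z
    proof -
      have "differential SU u (\<lambda>x. K (x ** h)) Z = differential SU (u ** h) K (Z ** h)"
        using SU_mult[OF _ hS] bounded_linear_imp_has_derivative[OF mm.bounded_linear_left]
        by (intro differential_compose[OF K(1) _ _ u Z]) auto
      then show ?thesis by (simp add: K(2)[OF h])
    qed
    show ?thesis
      unfolding rtrans_apply right_translate_std_poisson_lin_bivec[OF \<sigma>] bracket_eq_sum[OF \<sigma>] lin_bivec_def
      by (intro sum.cong refl) (simp add: d[OF F] d[OF G] fields_tangent[OF \<sigma> u])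
  qed
  finally show ?thesis .
qed

theorem theorem3:
  fixes c :: real and \<sigma> :: "'n::{finite,linorder} cmat"
    and \<rho> :: "'n cmat \<Rightarrow> 'n cmat two_tensor"
  assumes "CARD('n) \<ge> 2" and "0 \<le> c" and "c \<le> 1"
    and "\<sigma> = sigma c" and "\<rho> = right_translate \<sigma> std_poisson"
  shows "\<sigma> \<in> SU
    \<and> (poisson_structure SU (smooth_funs SU id) (on_SU \<rho>)
        \<and> affine_tensor \<rho> \<and> left_covariant id (**) (on_SU \<rho>))
    \<and> coisotropic U_sub \<rho>
    \<and> (\<exists>\<tau>. (\<forall>u\<in>SU. \<forall>f\<in>smooth_funs SU coset. \<forall>k\<in>smooth_funs SU coset.
              \<tau> (coset u) f k = push_action SU coset u (\<rho> u) f k)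
          \<and> poisson_structure (coset ` SU) (smooth_funs SU coset) \<tau>
          \<and> left_covariant coset coset_act \<tau>)"
proof -
  note ne = ix1_neq_ixn[OF assms(1)]
  have \<sigma>: "\<sigma> \<in> SU"
    using sigma_SU[OF ne assms(2,3)] assms(4) by simp
  have co: "coisotropic U_sub \<rho>"
    using coisotropic_U_sub[OF ne assms(2,3)] assms(4,5) by simp
  have on_SU: "on_SU \<rho> (id u) f k = bracket \<sigma> (f \<circ> id) (k \<circ> id) u" for u f k
    by (simp add: push_action_def bracket_def assms(5))
  have group: "poisson_structure SU (smooth_funs SU id) (on_SU \<rho>)" "left_covariant id (**) (on_SU \<rho>)"
    using bracket_poisson_structure[OF \<sigma>, of id "on_SU \<rho>", OF on_SU]
      bracket_left_covariant[OF \<sigma>, of id "on_SU \<rho>" "(**)", OF on_SU] by simp_all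
  \<comment> \<open>A representative is chosen for every coset. Independence of it is established
    for smooth functions, whose lifts are \<open>U_sub\<close>-invariant; on other functions the
    value is arbitrary.\<close>
  define \<tau> where "\<tau> K f k =
    (let u = SOME u. u \<in> SU \<and> coset u = K in bracket \<sigma> (f \<circ> coset) (k \<circ> coset) u)"
    for K :: "'n cmat set" and f k
  have \<tau>: "\<tau> (coset u) f k = bracket \<sigma> (f \<circ> coset) (k \<circ> coset) u"
    if u: "u \<in> SU" and fk: "f \<in> smooth_funs SU coset" "k \<in> smooth_funs SU coset" for u f k
  proof -
    define v where "v = (SOME v. v \<in> SU \<and> coset v = coset u)"
    have "v \<in> SU \<and> coset v = coset u"
      unfolding v_def by (rule someI[of _ u]) (simp add: u)
    then obtain h where "h \<in> U_sub" "v = u ** h"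
      using coset_eqD[of u v] by metis
    then show ?thesis
      using bracket_U_sub_invariant[OF co[unfolded assms(5)] \<sigma>, of "f \<circ> coset" "k \<circ> coset" u h] u fk
      by (simp add: \<tau>_def v_def[symmetric] smooth_funs_def coset_mult)
  qed
  have "\<tau> (coset u) f k = push_action SU coset u (\<rho> u) f k"
    if "u \<in> SU" "f \<in> smooth_funs SU coset" "k \<in> smooth_funs SU coset" for u f k
    by (simp add: \<tau>[OF that] push_action_def bracket_def assms(5))
  moreover have "poisson_structure (coset ` SU) (smooth_funs SU coset) \<tau>"
    by (rule bracket_poisson_structure[OF \<sigma> \<tau>])
  moreover have "left_covariant coset coset_act \<tau>"
    by (rule bracket_left_covariant[OF \<sigma> \<tau> coset_act_coset])
  ultimately show ?thesis
    using \<sigma> group co affine_right_translate_std_poisson[OF \<sigma>] assms(5) by blast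
qed

end
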